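(* Let $n$ be a non-negative integer, let $p,q\in\mathbb{C}$ with $q\notin\{-1,-2,-3,\dots\}$, and let $\delta,\delta',\mu,\mu',\epsilon,\tau\in\mathbb{C}$ be such that $\Re(\epsilon)>0$ and $$\Re(\tau)>\max\{0,\ \Re(-\delta+\mu),\ \Re(-\delta-\delta'-\mu'+\epsilon)\}.$$ Assume that none of $\tau-\mu$, $\tau+\delta+\delta'-\epsilon$, $\tau+\delta+\mu'-\epsilon$ is a non-positive integer. Then for every $x>0$, $$\left(D_{0+}^{\delta,\delta',\mu,\mu',\epsilon}\,t^{\tau-1}M_n^{(p,q)}(t)\right)(x)=\frac{(-1)^n\,\Gamma(q+n+1)\,\Gamma(\tau)\,\Gamma(\tau+\delta-\mu)\,\Gamma(\tau+\delta+\delta'+\mu'-\epsilon)}{\Gamma(q+1)\,\Gamma(\tau-\mu)\,\Gamma(\tau+\delta+\delta'-\epsilon)\,\Gamma(\tau+\delta+\mu'-\epsilon)}\,x^{\delta+\delta'-\epsilon+\tau-1}$$ $$\times\ {}_5F_4\left[\begin{array}{c}1+n-p,\ -n,\ \tau,\ -\mu+\delta+\tau,\ \delta+\delta'+\mu'-\epsilon+\tau\\ q+1,\ -\mu+\tau,\ \delta+\delta'-\epsilon+\tau,\ \delta+\mu'-\epsilon+\tau\end{array}\Big|\,-x\right].$$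
   Context: Pochhammer symbol: $(a)_0=1$, $(a)_k=a(a+1)\cdots(a+k-1)$. The generalized hypergeometric function is $${}_rF_s\left[\begin{array}{c}a_1,\dots,a_r\\ c_1,\dots,c_s\end{array}\Big|\,z\right]=\sum_{k=0}^\infty\frac{(a_1)_k\cdots(a_r)_k}{(c_1)_k\cdots(c_s)_k}\frac{z^k}{k!};$$ when one upper parameter is $-n$ with $n$ a non-negative integer (as here), the series is the finite sum over $0\le k\le n$ and is taken for all $z$. The Jacobi type orthogonal polynomial is $$M_n^{(p,q)}(x)=(-1)^n\,n!\sum_{k=0}^n\binom{p-n-1}{k}\binom{q+n}{n-k}(-x)^k,$$ where $\binom{a}{k}=a(a-1)\cdots(a-k+1)/k!$ for $a\in\mathbb{C}$. Appell's function is $F_3(a,a',b,b';c;X,Y)=\sum_{m,l\ge0}\frac{(a)_m(a')_l(b)_m(b')_l}{(c)_{m+l}\,m!\,l!}X^mY^l$ for $|X|,|Y|<1$, extended by analytic continuation to $(\mathbb{C}\setminus[1,\infty))^2$. The (left-sided) Marichev-Saigo-Maeda fractional integral, for $\Re(\epsilon)>0$ and $x>0$, is $$\left(I_{0+}^{\delta,\delta',\mu,\mu',\epsilon}f\right)(x)=\frac{x^{-\delta}}{\Gamma(\epsilon)}\int_0^x(x-t)^{\epsilon-1}t^{-\delta'}F_3\left(\delta,\delta',\mu,\mu';\epsilon;1-\frac tx,1-\frac xt\right)f(t)\,dt.$$ The corresponding fractional derivative is $$\left(D_{0+}^{\delta,\delta',\mu,\mu',\epsilon}f\right)(x)=\left(\frac{d}{dx}\right)^{[\Re(\epsilon)]+1}\left(I_{0+}^{-\delta',-\delta,-\mu'+[\Re(\epsilon)]+1,-\mu,-\epsilon+[\Re(\epsilon)]+1}f\right)(x),$$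 where $[\cdot]$ denotes the integer part (floor). Here $(D f(t))(x)$ means the operator applied to the function $t\mapsto f(t)$, evaluated at $x$. *)

theory Defs
  imports "HOL-Complex_Analysis.Complex_Analysis"
begin

definition hypergeometric_F :: "complex list \<Rightarrow> complex list \<Rightarrow> complex \<Rightarrow> complex" where
  "hypergeometric_F as cs z = eval_fps (fps_hypergeo as cs 1) z"

lemma hypergeometric_F_series:
  "hypergeometric_F as cs z =
     (\<Sum>k. (\<Prod>a\<leftarrow>as. pochhammer a k) / (\<Prod>c\<leftarrow>cs. pochhammer c k) * (z ^ k / fact k))"
proof -
  have fold: "foldl (\<lambda>r a. r * pochhammer a k) r xs = r * (\<Prod>a\<leftarrow>xs. pochhammer a k)"
    for r :: complex and xs k
    by (induction xs arbitrary: r) (auto simp: mult.assoc)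
  show ?thesis
    by (simp add: hypergeometric_F_def eval_fps_def fold)
qed

definition jacobi_type_M :: "nat \<Rightarrow> complex \<Rightarrow> complex \<Rightarrow> complex \<Rightarrow> complex" where
  "jacobi_type_M n p q x =
     (-1) ^ n * fact n *
     (\<Sum>k=0..n. ((p - of_nat n - 1) gchoose k) * ((q + of_nat n) gchoose (n - k)) * (- x) ^ k)"

definition appell_F3_series ::
  "complex \<Rightarrow> complex \<Rightarrow> complex \<Rightarrow> complex \<Rightarrow> complex \<Rightarrow> complex \<Rightarrow> complex \<Rightarrow> complex" where
  "appell_F3_series a a' b b' c X Y =
     (\<Sum>\<^sub>\<infinity>(m, l)\<in>(UNIV :: (nat \<times> nat) set).
        pochhammer a m * pochhammer a' l * pochhammer b m * pochhammer b' l /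
        (pochhammer c (m + l) * fact m * fact l) * X ^ m * Y ^ l)"

definition cut_plane :: "complex set" where
  "cut_plane = - (complex_of_real ` {1..})"

text \<open>Holomorphy in two variables on the product of the cut planes is expressed as joint
  continuity together with holomorphy in each variable separately.\<close>

definition appell_F3_continuation ::
  "complex \<Rightarrow> complex \<Rightarrow> complex \<Rightarrow> complex \<Rightarrow> complex \<Rightarrow> (complex \<Rightarrow> complex \<Rightarrow> complex) \<Rightarrow> bool" where
  "appell_F3_continuation a a' b b' c F \<longleftrightarrow>
     continuous_on (cut_plane \<times> cut_plane) (\<lambda>(X, Y). F X Y) \<and>
     (\<forall>Y\<in>cut_plane. (\<lambda>X. F X Y) holomorphic_on cut_plane) \<and>
     (\<forall>X\<in>cut_plane. (\<lambda>Y. F X Y) holomorphic_on cut_plane) \<and>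
     (\<forall>X Y. norm X < 1 \<longrightarrow> norm Y < 1 \<longrightarrow> F X Y = appell_F3_series a a' b b' c X Y)"

text \<open>Only the values on the product of the cut planes are meaningful; there the choice below
  is unique, by the lemma after it.\<close>

definition appell_F3 ::
  "complex \<Rightarrow> complex \<Rightarrow> complex \<Rightarrow> complex \<Rightarrow> complex \<Rightarrow> complex \<Rightarrow> complex \<Rightarrow> complex" where
  "appell_F3 a a' b b' c = (SOME F. appell_F3_continuation a a' b b' c F)"

lemma open_cut_plane: "open cut_plane"
proof -
  have "closed (complex_of_real ` {1..})"
    by (intro closed_injective_linear_image)
      (auto simp: linear_iff scaleR_conv_of_real intro!: inj_onI)
  then show ?thesis
    by (simp add: cut_plane_def open_Compl)
qed

lemma connected_cut_plane: "connected cut_plane"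
proof -
  have "starlike cut_plane"
    unfolding starlike_def
  proof (intro bexI ballI subsetI)
    show "0 \<in> cut_plane"
      by (auto simp: cut_plane_def)
  next
    fix z w assume z: "z \<in> cut_plane" and "w \<in> closed_segment 0 z"
    then obtain u where u: "0 \<le> u" "u \<le> 1" "w = complex_of_real u * z"
      by (auto simp: in_segment scaleR_conv_of_real)
    show "w \<in> cut_plane"
    proof (rule ccontr)
      assume "w \<notin> cut_plane"
      then obtain r where r: "r \<ge> 1" "complex_of_real u * z = complex_of_real r"
        using u by (auto simp: cut_plane_def)
      with u have "u > 0"
        by (cases "u = 0") auto
      with r have "z = complex_of_real (r / u)"
        by (simp add: field_simps)
      moreover have "r / u \<ge> 1"
        using r u \<open>u > 0\<close> by (simp add: field_simps)
      ultimately show False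
        using z unfolding cut_plane_def by blast
    qed
  qed
  then show ?thesis
    by (rule starlike_imp_connected)
qed

lemma unit_ball_subset_cut_plane: "ball 0 1 \<subseteq> cut_plane"
  by (auto simp: cut_plane_def)

lemma appell_F3_continuation_unique:
  assumes F: "appell_F3_continuation a a' b b' c F"
    and G: "appell_F3_continuation a a' b b' c G"
    and X: "X \<in> cut_plane" and Y: "Y \<in> cut_plane"
  shows "F X Y = G X Y"
proof -
  have ball_Y: "F X' Y' = G X' Y'" if X': "X' \<in> cut_plane" and Y': "Y' \<in> ball 0 1" for X' Y'
  proof (rule analytic_continuation_open[where s = "ball 0 1" and s' = cut_plane
          and f = "\<lambda>X. F X Y'" and g = "\<lambda>X. G X Y'"])
    show "(\<lambda>X. F X Y') holomorphic_on cut_plane" "(\<lambda>X. G X Y') holomorphic_on cut_plane"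
      using F G Y' unit_ball_subset_cut_plane by (auto simp: appell_F3_continuation_def)
    show "F z Y' = G z Y'" if "z \<in> ball 0 1" for z
      using F G Y' that by (auto simp: appell_F3_continuation_def)
  qed (use X' open_cut_plane connected_cut_plane unit_ball_subset_cut_plane in auto)
  show ?thesis
  proof (rule analytic_continuation_open[where s = "ball 0 1" and s' = cut_plane
          and f = "\<lambda>Y. F X Y" and g = "\<lambda>Y. G X Y"])
    show "(\<lambda>Y. F X Y) holomorphic_on cut_plane" "(\<lambda>Y. G X Y) holomorphic_on cut_plane"
      using F G X by (auto simp: appell_F3_continuation_def)
  qed (use X Y ball_Y open_cut_plane connected_cut_plane unit_ball_subset_cut_plane in auto)
qed

text \<open>The left-sided Marichev-Saigo-Maeda fractional integral and derivative, intended for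
  \<^term>\<open>Re \<epsilon> > 0\<close> and positive arguments.\<close>

definition MSM_integral ::
  "complex \<Rightarrow> complex \<Rightarrow> complex \<Rightarrow> complex \<Rightarrow> complex \<Rightarrow> (real \<Rightarrow> complex) \<Rightarrow> real \<Rightarrow> complex" where
  "MSM_integral \<delta> \<delta>' \<mu> \<mu>' \<epsilon> f x =
     of_real x powr (- \<delta>) / Gamma \<epsilon> *
     (LINT t:{0<..<x}|lborel.
        of_real (x - t) powr (\<epsilon> - 1) * of_real t powr (- \<delta>') *
        appell_F3 \<delta> \<delta>' \<mu> \<mu>' \<epsilon> (of_real (1 - t / x)) (of_real (1 - x / t)) * f t)"

definition MSM_derivative ::
  "complex \<Rightarrow> complex \<Rightarrow> complex \<Rightarrow> complex \<Rightarrow> complex \<Rightarrow> (real \<Rightarrow> complex) \<Rightarrow> real \<Rightarrow> complex" where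
  "MSM_derivative \<delta> \<delta>' \<mu> \<mu>' \<epsilon> f =
     (let k = nat \<lfloor>Re \<epsilon>\<rfloor> + 1
      in ((\<lambda>g x. vector_derivative g (at x)) ^^ k)
           (MSM_integral (- \<delta>') (- \<delta>) (- \<mu>' + of_nat k) (- \<mu>) (- \<epsilon> + of_nat k) f))"

end

theory Submission
  imports Defs
begin

text \<open>
  The function \<open>t powr (\<tau> - 1) * M_n(t)\<close> is a finite combination of powers \<open>t powr (\<rho> - 1)\<close> with
  \<open>\<rho> = \<tau> + j\<close>, so the point is the action of the operator on one power. With \<open>t = x s\<close>, the
  Marichev-Saigo-Maeda integral with parameters \<open>a, a', b, b', c\<close> multiplies it by a power of
      \<open>x\<close>, by
  \<open>Gamma c\<close> (which its prefactor removes) and by the Mellin transform at \<open>\<rho>\<close> of the kernel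
  \<open>K(s) = s^(-a') (1 - s)^(c - 1) F3(a, a', b, b'; c; 1 - s, 1 - 1/s) / Gamma c\<close> on \<open>(0, 1)\<close>. This
  transform is the quotient of
  \<open>Gamma \<rho> * Gamma (\<rho> + b' - a') * Gamma (\<rho> + c - a - a' - b)\<close> by
  \<open>Gamma (\<rho> + b') * Gamma (\<rho> + c - a - a') * Gamma (\<rho> + c - a' - b)\<close>
  (lemma \<open>has_mellin_appell_kernel\<close>). Each \<open>k\<close>-fold derivative of a power of \<open>x\<close> is a Pochhammer
  symbol, which shifts the second Gamma factor below by \<open>k\<close>; and the dependence of the six Gamma
  factors on \<open>j\<close> is six Pochhammer symbols, those of the 5F4 with upper parameters other than
  \<open>1 + n - p\<close>, \<open>- n\<close> and lower parameters other than \<open>q + 1\<close>.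

  To work with \<open>F3\<close> away from its bidisc of convergence, a continuation must first be exhibited. For
  \<open>c = g + g'\<close> with \<open>Re g, Re g' > 0\<close> it is the Beta average of
  \<open>2F1(a, b; g; u X) * 2F1(a', b'; g'; (1 - u) Y)\<close> (lemma \<open>appell_F3_eq_beta_mean\<close>), which
      reduces the
  question to one variable. There the sequences that continue to the cut plane are closed
  under shifts, multiplication by polynomials in the index, and multiplication by Beta moments, and
  the binomial series is a starting point.

  For \<open>X = 1 - s\<close> and \<open>Y = 1 - 1/s\<close> the Beta average is a multiplicative convolution of two kernels
  of the form \<open>s^\<sigma> (1 - s)^(g - 1) 2F1(1 - s)\<close> (lemma \<open>appell_kernel_eq_mult_conv\<close>, by Pfaff's
  transformation), whose Mellin transforms Gauss's summation theorem evaluates. Their product is the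
  quotient above, but with a Gamma factor cancelled whose poles obstruct convergence, so the formula
  is established only for large \<open>Re \<rho>\<close>. To reach the sharp half plane, the same quotient is realised
  by a different convolution, with its parameters paired so that no such obstruction exists
  (lemma \<open>ex_gamma_ratio3_kernel\<close>). Both kernels have the same moments far to the right, hence they
  agree almost everywhere, and \<open>K\<close> inherits the full range of validity.
\<close>

section \<open>Parameter integrals and the complex Beta integral\<close>

text \<open>Differentiation under a Lebesgue integral. Only a local majorant of the integrand itself is
  required: Cauchy's inequality turns it into one for the derivative, hence for the difference
  quotients, and dominated convergence applies. This form suits weights that are singular at the
  end points of the range of integration.\<close>

lemma holomorphic_on_integral_param:
  fixes f :: "complex \<Rightarrow> 'a \<Rightarrow> complex"
  assumes S: "open S"
    and meas: "\<And>z. z \<in> S \<Longrightarrow> f z \<in> borel_measurable M"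
    and hol: "\<And>u. u \<in> space M \<Longrightarrow> (\<lambda>z. f z u) holomorphic_on S"
    and dom: "\<And>z. z \<in> S \<Longrightarrow> \<exists>r>0. \<exists>B. cball z r \<subseteq> S \<and> integrable M B \<and>
                 (\<forall>w\<in>cball z r. \<forall>u\<in>space M. norm (f w u) \<le> B u)"
  shows "(\<lambda>z. \<integral>u. f z u \<partial>M) holomorphic_on S"
proof -
  have "(\<lambda>z. \<integral>u. f z u \<partial>M) field_differentiable at z" if z: "z \<in> S" for z
  proof -
    obtain r B where r: "r > 0" and sub: "cball z r \<subseteq> S" and B: "integrable M B"
      and bd: "\<And>w u. w \<in> cball z r \<Longrightarrow> u \<in> space M \<Longrightarrow> norm (f w u) \<le> B u"
      using dom[OF z] by blast
    have int: "integrable M (f w)" if "w \<in> cball z r" for w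
      using bd[OF that] B meas that sub by (intro Bochner_Integration.integrable_bound[OF B])
        (auto intro!: AE_I2 order_trans[OF bd[OF that]])
    define T where "T = ball z (r/2)"
    have deriv_bd: "norm (deriv (\<lambda>z. f z u) y) \<le> 2 * B u / r"
      if "y \<in> T" "u \<in> space M" for y u
    proof -
      have sub2: "cball y (r/2) \<subseteq> cball z r"
        using that(1) r unfolding T_def by (simp add: cball_subset_cball_iff dist_commute)
      have h: "(\<lambda>z. f z u) holomorphic_on cball y (r/2)"
        using hol[OF that(2)] sub sub2 by (blast intro: holomorphic_on_subset)
      have "norm ((deriv ^^ 1) (\<lambda>z. f z u) y) \<le> fact 1 * B u / (r/2) ^ 1"
      proof (rule Cauchy_inequality)
        show "(\<lambda>z. f z u) holomorphic_on ball y (r/2)"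
          using h by (rule holomorphic_on_subset) auto
        show "continuous_on (cball y (r/2)) (\<lambda>z. f z u)"
          using h by (rule holomorphic_on_imp_continuous_on)
        show "norm (f x u) \<le> B u" if "norm (y - x) = r/2" for x
          using sub2 that \<open>u \<in> space M\<close> by (intro bd) (auto simp: dist_norm)
      qed (use r in auto)
      then show ?thesis by (simp add: mult.commute)
    qed
    have TS: "T \<subseteq> S"
    proof -
      have "T \<subseteq> cball z r" using r by (auto simp: T_def)
      then show ?thesis using sub by simp
    qed
    have quot_bd: "norm ((f w u - f z u) / (w - z)) \<le> 2 * B u / r"
      if w: "w \<in> T - {z}" and u: "u \<in> space M" for w u
    proof -
      have "norm (f w u - f z u) \<le> 2 * B u / r * norm (w - z)"
      proof (rule field_differentiable_bound[where S = T and f' = "deriv (\<lambda>z. f z u)"])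
        show "((\<lambda>z. f z u) has_field_derivative deriv (\<lambda>z. f z u) y) (at y within T)"
          if "y \<in> T" for y
          using holomorphic_derivI[OF hol[OF u] S] TS that has_field_derivative_at_within by blast
        show "norm (deriv (\<lambda>z. f z u) y) \<le> 2 * B u / r" if "y \<in> T" for y
          using deriv_bd that u by blast
        show "convex T" "w \<in> T" "z \<in> T" using w r by (auto simp: T_def)
      qed
      moreover have "norm (w - z) > 0" using w by auto
      ultimately show ?thesis by (simp add: norm_divide pos_divide_le_eq)
    qed
    have lim_quot: "(\<lambda>i. (f (X i) u - f z u) / (X i - z)) \<longlonglongrightarrow> deriv (\<lambda>z. f z u) z"
      if X: "\<And>i. X i \<in> T - {z}" "X \<longlonglongrightarrow> z" and u: "u \<in> space M" for X u
    proof -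
      have "((\<lambda>z. f z u) has_field_derivative deriv (\<lambda>z. f z u) z) (at z)"
        by (rule holomorphic_derivI[OF hol[OF u] S z])
      then have "((\<lambda>w. (f w u - f z u) / (w - z)) \<longlongrightarrow> deriv (\<lambda>z. f z u) z) (at z)"
        by (simp add: has_field_derivative_iff)
      then show ?thesis using X unfolding tendsto_at_iff_sequentially o_def by blast
    qed
    have "((\<lambda>w. ((\<integral>u. f w u \<partial>M) - (\<integral>u. f z u \<partial>M)) / (w - z)) \<longlongrightarrow> (\<integral>u. deriv (\<lambda>z. f z u) z \<partial>M))
           (at z within T)"
      unfolding tendsto_at_iff_sequentially o_def
    proof (intro allI impI)
      fix X assume X: "\<forall>i. X i \<in> T - {z}" "X \<longlonglongrightarrow> z"
      have XT: "X i \<in> cball z r" for i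
        using X(1)[rule_format, of i] r by (auto simp: T_def)
      have zz: "z \<in> cball z r" using r by simp
      have meas': "(\<lambda>u. (f (X i) u - f z u) / (X i - z)) \<in> borel_measurable M" for i
        using int[OF XT[of i]] int[OF zz] by (intro borel_measurable_divide
            borel_measurable_diff) auto
      have "(\<lambda>i. \<integral>u. (f (X i) u - f z u) / (X i - z) \<partial>M) \<longlonglongrightarrow> (\<integral>u. deriv (\<lambda>z. f z u) z \<partial>M)"
      proof (rule integral_dominated_convergence[where w = "\<lambda>u. 2 * B u / r"])
        show "(\<lambda>u. deriv (\<lambda>z. f z u) z) \<in> borel_measurable M"
          by (rule borel_measurable_LIMSEQ_metric[OF meas' lim_quot]) (use X in auto)
        show "AE u in M. norm ((f (X i) u - f z u) / (X i - z)) \<le> 2 * B u / r" for i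
          using X(1) by (intro AE_I2 quot_bd) auto
        show "AE u in M. (\<lambda>i. (f (X i) u - f z u) / (X i - z)) \<longlonglongrightarrow> deriv (\<lambda>z. f z u) z"
          using X by (intro AE_I2 lim_quot) auto
      qed (use B meas' in auto)
      moreover have "(\<integral>u. (f (X i) u - f z u) / (X i - z) \<partial>M) =
          ((\<integral>u. f (X i) u \<partial>M) - (\<integral>u. f z u \<partial>M)) / (X i - z)" for i
        using int[OF XT[of i]] int[OF zz] by simp
      ultimately show "(\<lambda>i. ((\<integral>u. f (X i) u \<partial>M) - (\<integral>u. f z u \<partial>M)) / (X i - z))
          \<longlonglongrightarrow> (\<integral>u. deriv (\<lambda>z. f z u) z \<partial>M)" by (simp only:)
    qed
    moreover have "at z within T = at z"
      using r by (intro at_within_open) (auto simp: T_def)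
    ultimately show ?thesis
      unfolding field_differentiable_def has_field_derivative_iff by auto
  qed
  then show ?thesis
    by (intro holomorphic_onI) (auto intro: field_differentiable_at_within)
qed

text \<open>The weight is extended by zero, so that integrals run over the whole line and affine
  substitutions need no bookkeeping of end points.\<close>

definition beta_weight :: "complex \<Rightarrow> complex \<Rightarrow> real \<Rightarrow> complex" where
  "beta_weight a b u =
     indicator {0<..<1} u *\<^sub>R (of_real u powr (a - 1) * of_real (1 - u) powr (b - 1))"

lemma beta_weight_measurable [measurable]: "beta_weight a b \<in> borel_measurable borel"
  unfolding beta_weight_def
  by (rule borel_measurable_continuous_on_indicator)
     (auto intro!: continuous_intros simp: complex_nonpos_Reals_iff)

lemma norm_beta_weight: "norm (beta_weight a b u) =
   indicator {0<..<1} u * (u powr (Re a - 1) * (1 - u) powr (Re b - 1))"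
proof (cases "u \<in> {0<..<1}")
  case True
  then show ?thesis
    using norm_powr_real_powr[of "of_real u" "a - 1"] norm_powr_real_powr[of "of_real (1 - u)"
        "b - 1"]
    by (simp add: beta_weight_def norm_mult)
qed (simp add: beta_weight_def)

lemma norm_beta_weight_Re: "norm (beta_weight a b u) = norm (beta_weight (of_real (Re a))
    (of_real (Re b)) u)"
  by (simp add: norm_beta_weight)

lemma beta_weight_real:
  "beta_weight (of_real a) (of_real b) u = of_real (indicator {0<..<1} u * (u powr (a - 1) * (1
      - u) powr (b - 1)))"
proof (cases "u \<in> {0<..<1}")
  case True
  then show ?thesis
    using powr_of_real[of u "a - 1"] powr_of_real[of "1 - u" "b - 1"] by (simp add: beta_weight_def)
qed (simp add: beta_weight_def)

lemma has_bochner_integral_beta_weight_real: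
  assumes "a > 0" "b > 0"
  shows "has_bochner_integral lborel (beta_weight (of_real a) (of_real b)) (Beta (of_real a)
      (of_real b))"
proof -
  have int: "set_integrable lborel {0..1} (\<lambda>t. t powr (a - 1) * (1 - t) powr (b - 1))"
    by (rule integrable_Beta[OF assms])
  have int': "set_integrable lborel {0<..<1} (\<lambda>t. t powr (a - 1) * (1 - t) powr (b - 1))"
    by (rule set_integrable_subset[OF int]) auto
  have "((\<lambda>t. t powr (a - 1) * (1 - t) powr (b - 1)) has_integral
      (LINT t:{0<..<1}|lborel. t powr (a - 1) * (1 - t) powr (b - 1))) {0<..<1}"
    using set_borel_integral_eq_integral[OF int'] by (simp add: has_integral_iff)
  moreover have "((\<lambda>t. t powr (a - 1) * (1 - t) powr (b - 1)) has_integral Beta a b) {0<..<1}"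
    using has_integral_Beta_real[OF assms] by (simp add: has_integral_Icc_iff_Ioo)
  ultimately have eq: "(LINT t:{0<..<1}|lborel. t powr (a - 1) * (1 - t) powr (b - 1)) = Beta a b"
    using has_integral_unique by blast
  have "has_bochner_integral lborel (\<lambda>u. indicator {0<..<1} u * (u powr (a - 1) * (1 - u) powr
      (b - 1))) (Beta a b)"
    using int' eq by (simp add: has_bochner_integral_iff set_integrable_def
        set_lebesgue_integral_def)
  then have "has_bochner_integral lborel (beta_weight (of_real a) (of_real b)) (of_real (Beta a b))"
    unfolding beta_weight_real by (rule has_bochner_integral_of_real)
  also have "of_real (Beta a b) = (Beta (of_real a) (of_real b) :: complex)"
    by (simp add: Beta_def Gamma_complex_of_real flip: of_real_add)
  finally show ?thesis .
qed

lemma integrable_beta_weight: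
  assumes "Re a > 0" "Re b > 0"
  shows "integrable lborel (beta_weight a b)"
proof (rule Bochner_Integration.integrable_bound)
  show "integrable lborel (beta_weight (of_real (Re a)) (of_real (Re b)))"
    using has_bochner_integral_beta_weight_real[OF assms] by (simp add: has_bochner_integral_iff)
  show "AE u in lborel. norm (beta_weight a b u) \<le> norm (beta_weight (of_real (Re a)) (of_real
      (Re b)) u)"
    by (intro AE_I2 eq_refl norm_beta_weight_Re)
qed simp

lemma integral_norm_beta_weight:
  assumes "Re a > 0" "Re b > 0"
  shows "(\<integral>u. norm (beta_weight a b u) \<partial>lborel) = Beta (Re a) (Re b)"
proof -
  have "has_bochner_integral lborel (\<lambda>u. Re (beta_weight (of_real (Re a)) (of_real (Re b)) u))
          (Re (Beta (of_real (Re a)) (of_real (Re b))))"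
    by (intro has_bochner_integral_Re has_bochner_integral_beta_weight_real assms)
  also have "(Beta (of_real (Re a)) (of_real (Re b)) :: complex) = of_real (Beta (Re a) (Re b))"
    by (simp add: Beta_def Gamma_complex_of_real flip: of_real_add)
  also have "(\<lambda>u. Re (beta_weight (of_real (Re a)) (of_real (Re b)) u)) = (\<lambda>u. norm (beta_weight
      a b u))"
    unfolding beta_weight_real norm_beta_weight by auto
  finally show ?thesis by (simp add: has_bochner_integral_iff)
qed

lemma beta_weight_reflect: "beta_weight a b u = beta_weight b a (1 - u)"
  by (auto simp: beta_weight_def indicator_def)

lemma integral_beta_weight_holomorphic:
  assumes "Re b > 0"
  shows "(\<lambda>a. \<integral>u. beta_weight a b u \<partial>lborel) holomorphic_on {a. Re a > 0}"
proof (rule holomorphic_on_integral_param)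
  show "open {a. Re a > 0}" by (rule open_halfspace_Re_gt)
  show "(\<lambda>z. beta_weight z b u) holomorphic_on {a. Re a > 0}" for u
    by (cases "u \<in> {0<..<1}") (auto simp: beta_weight_def intro!: holomorphic_intros)
  fix z assume z: "z \<in> {a. Re a > 0}"
  define r where "r = Re z / 2"
  have "norm (beta_weight w b u) \<le> norm (beta_weight (of_real r) b u)" if "w \<in> cball z r" for w u
  proof -
    have "\<bar>Re z - Re w\<bar> \<le> r" using that abs_Re_le_cmod[of "z - w"] by (simp add: dist_norm)
    then have "Re w \<ge> r" unfolding r_def by linarith
    then show ?thesis
    proof (cases "u \<in> {0<..<1}")
      case True
      then have "u powr (Re w - 1) \<le> u powr (r - 1)" using \<open>Re w \<ge> r\<close> by (intro powr_mono') auto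
      with True show ?thesis by (simp add: norm_beta_weight mult_right_mono)
    qed (simp add: norm_beta_weight)
  qed
  moreover have "cball z r \<subseteq> {a. Re a > 0}"
  proof
    fix w assume "w \<in> cball z r"
    then have "\<bar>Re z - Re w\<bar> \<le> r" using abs_Re_le_cmod[of "z - w"] by (simp add: dist_norm)
    then have "Re w \<ge> r" unfolding r_def by linarith
    then show "w \<in> {a. Re a > 0}" using z by (simp add: r_def)
  qed
  moreover have "integrable lborel (\<lambda>u. norm (beta_weight (of_real r) b u))"
    using z assms by (intro integrable_norm integrable_beta_weight) (auto simp: r_def)
  ultimately show "\<exists>r>0. \<exists>B. cball z r \<subseteq> {a. 0 < Re a} \<and> integrable lborel B \<and>
        (\<forall>w\<in>cball z r. \<forall>u\<in>space lborel. norm (beta_weight w b u) \<le> B u)"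
    using z by (intro exI[of _ r] exI[of _ "\<lambda>u. norm (beta_weight (of_real r) b u)"]) (auto
        simp: r_def)
qed auto

text \<open>The identity theorem; the positive reals accumulate at 1.\<close>

lemma holomorphic_eq_on_right_halfplane:
  assumes "f holomorphic_on {a. Re a > 0}" "g holomorphic_on {a. Re a > 0}"
    and "\<And>r. r > 0 \<Longrightarrow> f (of_real r) = g (of_real r)" "Re a > 0"
  shows "f a = g a"
proof -
  have lim: "1 islimpt complex_of_real ` {0<..}"
    unfolding islimpt_sequential
  proof (intro exI[of _ "\<lambda>n. complex_of_real (1 + inverse (real (Suc n)))"] conjI allI)
    fix n
    have "1 + inverse (real (Suc n)) \<in> {0<..}" "1 + inverse (real (Suc n)) \<noteq> 1" by (auto intro!:
        add_pos_pos)
    then show "complex_of_real (1 + inverse (real (Suc n))) \<in> complex_of_real ` {0<..} - {1}"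
      by (metis Diff_iff imageI of_real_eq_1_iff singletonD)
  next
    have "(\<lambda>n. complex_of_real (1 + inverse (real (Suc n)))) \<longlonglongrightarrow> of_real (1 + 0)"
      by (intro tendsto_intros LIMSEQ_inverse_real_of_nat)
    then show "(\<lambda>n. complex_of_real (1 + inverse (real (Suc n)))) \<longlonglongrightarrow> 1" by simp
  qed
  have "f a - g a = 0"
  proof (rule analytic_continuation[of "\<lambda>z. f z - g z" "{a. Re a > 0}" "complex_of_real `
      {0<..}" 1])
    show "connected {a. Re a > 0}" by (intro convex_connected convex_halfspace_Re_gt)
    show "(\<lambda>z. f z - g z) holomorphic_on {a. Re a > 0}" by (intro holomorphic_intros assms)
  qed (use assms lim open_halfspace_Re_gt in auto)
  then show ?thesis by simp
qed

text \<open>Both sides are holomorphic in each parameter, and for positive real parameters the value is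
  Euler's integral; the identity theorem is applied to one parameter at a time.\<close>

lemma integral_beta_weight:
  assumes "Re a > 0" "Re b > 0"
  shows "(\<integral>u. beta_weight a b u \<partial>lborel) = Beta a b"
proof -
  have hB: "(\<lambda>a. Beta a b) holomorphic_on {a. Re a > 0}" if "Re b > 0" for b
    using that by (intro holomorphic_intros) (auto elim!: nonpos_Ints_cases)
  have comm: "(\<integral>u. beta_weight a b u \<partial>lborel) = (\<integral>u. beta_weight b a u \<partial>lborel)" for a b
    using lborel_integral_real_affine[of "-1" "beta_weight a b" 1]
    by (simp add: beta_weight_reflect[of a b])
  have real: "(\<integral>u. beta_weight a (of_real b) u \<partial>lborel) = Beta a (of_real b)"
    if "Re a > 0" "b > 0" for a b
  proof (rule holomorphic_eq_on_right_halfplane[where a = a])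
    show "(\<lambda>a. \<integral>u. beta_weight a (of_real b) u \<partial>lborel) holomorphic_on {a. Re a > 0}"
      using that by (intro integral_beta_weight_holomorphic) simp
    show "(\<lambda>a. Beta a (of_real b)) holomorphic_on {a. Re a > 0}"
      using that by (intro hB) simp
    show "(\<integral>u. beta_weight (of_real r) (of_real b) u \<partial>lborel) = Beta (of_real r) (of_real b)" if
        "r > 0" for r
      using has_bochner_integral_beta_weight_real[OF that \<open>b > 0\<close>] by (simp add:
          has_bochner_integral_iff)
  qed (use that in auto)
  show ?thesis
  proof (rule holomorphic_eq_on_right_halfplane[where a = a])
    show "(\<lambda>a. \<integral>u. beta_weight a b u \<partial>lborel) holomorphic_on {a. Re a > 0}"
      by (rule integral_beta_weight_holomorphic[OF assms(2)])
    show "(\<lambda>a. Beta a b) holomorphic_on {a. Re a > 0}"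
      by (rule hB[OF assms(2)])
    show "(\<integral>u. beta_weight (of_real r) b u \<partial>lborel) = Beta (of_real r) b" if "r > 0" for r
      using real[OF assms(2) that] comm[of b "of_real r"] Beta_commute[of b "of_real r"] by simp
  qed (use assms in auto)
qed

section \<open>Beta means of functions on the cut plane\<close>

text \<open>The cut plane is starlike about 0, which is what makes averages over \<open>u * X\<close> with
  \<open>0 < u < 1\<close> available for functions on it.\<close>

lemma cut_plane_scale:
  assumes "z \<in> cut_plane" "0 \<le> t" "t \<le> 1"
  shows "of_real t * z \<in> cut_plane"
proof (rule ccontr)
  assume "of_real t * z \<notin> cut_plane"
  then obtain r where r: "r \<ge> 1" "complex_of_real t * z = complex_of_real r"
    by (auto simp: cut_plane_def)
  with assms have "t > 0" by (cases "t = 0") auto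
  with r have "z = complex_of_real (r / t)" by (simp add: field_simps)
  moreover have "r / t \<ge> 1" using r assms \<open>t > 0\<close> by (simp add: field_simps)
  ultimately show False using assms(1) unfolding cut_plane_def by blast
qed

text \<open>Supplies the local majorants for dominated convergence: the rays from 0 to a compact set form
  a compact subset of the cut plane.\<close>

lemma bounded_on_rays:
  assumes f: "continuous_on cut_plane f" and K: "compact K" "K \<subseteq> cut_plane"
  obtains M :: real where "M \<ge> 0" "\<And>z t. z \<in> K \<Longrightarrow> 0 \<le> t \<Longrightarrow> t \<le> 1 \<Longrightarrow> norm (f (of_real t * z)) \<le> M"
proof -
  define K' where "K' = (\<lambda>(t, z). complex_of_real t * z) ` ({0..1} \<times> K)"
  have "compact K'" unfolding K'_def
    by (intro compact_continuous_image compact_Times K) (auto intro!: continuous_intros simp: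
        case_prod_unfold)
  moreover have "K' \<subseteq> cut_plane" using K cut_plane_scale by (auto simp: K'_def)
  ultimately have "bounded (f ` K')"
    by (meson f compact_continuous_image compact_imp_bounded continuous_on_subset)
  then obtain M where M: "M > 0" "\<And>x. x \<in> f ` K' \<Longrightarrow> norm x \<le> M" by (auto simp: bounded_pos)
  have "norm (f (of_real t * z)) \<le> M" if "z \<in> K" "0 \<le> t" "t \<le> 1" for z t
    by (rule M(2)) (use that in \<open>force simp: K'_def\<close>)
  then show ?thesis using that[of M] M(1) by auto
qed

lemma summable_on_times_nat:
  fixes A B :: "nat \<Rightarrow> real"
  assumes "summable A" "summable B" "\<And>n. A n \<ge> 0" "\<And>n. B n \<ge> 0"
  shows "(\<lambda>(m, l). A m * B l) summable_on UNIV"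
proof -
  have A: "A summable_on UNIV" and B: "B summable_on UNIV"
    using assms by (simp_all add: summable_on_UNIV_nonneg_real_iff)
  have "(\<lambda>(m, l). A m * B l) summable_on UNIV \<times> UNIV"
  proof (rule summable_on_SigmaI)
    show "((\<lambda>l. case (m, l) of (m, l) \<Rightarrow> A m * B l) has_sum A m * infsum B UNIV) UNIV" for m
      using B by (auto intro!: has_sum_cmult_right has_sum_infsum)
    show "(\<lambda>m. A m * infsum B UNIV) summable_on UNIV"
      using A by (rule summable_on_cmult_left)
  qed (use assms in auto)
  then show ?thesis by simp
qed

lemma has_sum_times_nat:
  fixes f g :: "nat \<Rightarrow> complex"
  assumes "summable (\<lambda>n. norm (f n))" "summable (\<lambda>n. norm (g n))" "f sums F" "g sums G"
  shows "((\<lambda>(m, l). f m * g l) has_sum F * G) UNIV"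
proof -
  have f: "(f has_sum F) UNIV" and g: "(g has_sum G) UNIV"
    using assms norm_summable_imp_has_sum by auto
  have "(\<lambda>(m, l). f m * g l) summable_on UNIV"
  proof (rule abs_summable_summable)
    have "(\<lambda>(m, l). norm (f m) * norm (g l)) summable_on UNIV"
      using assms by (intro summable_on_times_nat) auto
    then show "(\<lambda>x. norm (case x of (m, l) \<Rightarrow> f m * g l)) summable_on UNIV"
      by (simp add: case_prod_unfold norm_mult)
  qed
  then have "(\<lambda>(m, l). f m * g l) summable_on UNIV \<times> UNIV" by simp
  then have "((\<lambda>(m, l). f m * g l) has_sum F * G) (UNIV \<times> UNIV)"
    by (rule has_sum_SigmaI[where g = "\<lambda>m. f m * G", rotated 2])
       (use f g in \<open>auto intro: has_sum_cmult_right has_sum_cmult_left\<close>)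
  then show ?thesis by simp
qed

text \<open>Keeping the coefficient sequence next to the continued function lets the closure properties
  below be read as operations on coefficients.\<close>

definition cut_plane_extension :: "(nat \<Rightarrow> complex) \<Rightarrow> (complex \<Rightarrow> complex) \<Rightarrow> bool" where
  "cut_plane_extension h f \<longleftrightarrow>
     f holomorphic_on cut_plane \<and> (\<forall>z. norm z < 1 \<longrightarrow> (\<lambda>m. h m * z ^ m) sums f z)"

lemma cut_plane_extension_norm_summable:
  assumes "cut_plane_extension h f" "norm z < 1"
  shows "summable (\<lambda>m. norm (h m * z ^ m))"
proof -
  obtain r where r: "norm z < r" "r < 1" using assms dense by blast
  have "norm (of_real r :: complex) = r" using r norm_ge_zero[of z] by (simp del: norm_ge_zero)
  then show ?thesis using assms r
    by (intro powser_insidea[of h "of_real r"]) (auto simp: cut_plane_extension_def sums_iff)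
qed

lemma beta_weight_times_measurable:
  assumes "continuous_on {0<..<1} \<phi>"
  shows "(\<lambda>u. beta_weight a b u * \<phi> u) \<in> borel_measurable borel"
proof -
  have "(\<lambda>u. beta_weight a b u * (indicator {0<..<1} u *\<^sub>R \<phi> u)) \<in> borel_measurable borel"
    by (intro borel_measurable_times beta_weight_measurable
        borel_measurable_continuous_on_indicator assms) auto
  also have "(\<lambda>u. beta_weight a b u * (indicator {0<..<1} u *\<^sub>R \<phi> u)) = (\<lambda>u. beta_weight a b u *
      \<phi> u)"
    by (auto simp: beta_weight_def indicator_def)
  finally show ?thesis .
qed

text \<open>Multiplication by powers shifts the parameters of the weight, so integrating a power series
  against it multiplies the coefficients by quotients of Pochhammer symbols.\<close>

lemma beta_weight_times_power:
  "beta_weight a b u * of_real u ^ m * of_real (1 - u) ^ l = beta_weight (a + of_nat m) (b +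
      of_nat l) u"
proof (cases "u \<in> {0<..<1}")
  case True
  have "z powr (c + of_nat n - 1) = z powr (c - 1) * z ^ n" if "z \<noteq> 0" for z c :: complex and n
    using that powr_add[of z "c - 1" "of_nat n"] by (simp add: powr_nat algebra_simps)
  with True show ?thesis by (simp add: beta_weight_def)
qed (simp add: beta_weight_def)

lemma Beta_shift:
  assumes "a \<notin> \<int>\<^sub>\<le>\<^sub>0" "b \<notin> \<int>\<^sub>\<le>\<^sub>0" "a + b \<notin> \<int>\<^sub>\<le>\<^sub>0"
  shows "Beta (a + of_nat m) (b + of_nat l) =
     Beta a b * (pochhammer a m * pochhammer b l / pochhammer (a + b) (m + l) :: complex)"
proof -
  have e: "a + of_nat m + (b + of_nat l) = a + b + of_nat (m + l)" by simp
  have nz: "Gamma a \<noteq> 0" "Gamma b \<noteq> 0" "Gamma (a + b) \<noteq> 0"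
    using assms by (simp_all add: Gamma_eq_zero_iff)
  show ?thesis
    unfolding Beta_def e pochhammer_Gamma[OF assms(1)] pochhammer_Gamma[OF assms(2)]
        pochhammer_Gamma[OF assms(3)]
    using nz by (simp only: times_divide_times_eq divide_divide_times_eq times_divide_eq_left
        times_divide_eq_right
          nonzero_mult_divide_mult_cancel_left mult_ac divide_divide_eq_left divide_divide_eq_right
          nonzero_mult_div_cancel_left mult_eq_0_iff) simp
qed

lemma Re_pos_not_nonpos_Int: "Re z > 0 \<Longrightarrow> z \<notin> \<int>\<^sub>\<le>\<^sub>0"
  by (auto elim!: nonpos_Ints_cases)

lemma Beta_nonzero: "Re a > 0 \<Longrightarrow> Re b > 0 \<Longrightarrow> Beta a b \<noteq> 0"
  using Re_pos_not_nonpos_Int[of a] Re_pos_not_nonpos_Int[of b] Re_pos_not_nonpos_Int[of "a + b"]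
  by (simp add: Beta_def Gamma_eq_zero_iff)

text \<open>The average of \<open>f (u X) g ((1 - u) Y)\<close> over the Beta distribution. It multiplies the
  coefficient of \<open>X ^ m * Y ^ l\<close> by \<open>(a)_m (b)_l / (a + b)_(m + l)\<close>, the coupling that turns a
  product of two Gauss series into an Appell series.\<close>

definition beta_mean ::
  "complex \<Rightarrow> complex \<Rightarrow> (complex \<Rightarrow> complex) \<Rightarrow> (complex \<Rightarrow> complex) \<Rightarrow> complex \<Rightarrow> complex \<Rightarrow> complex"
where
  "beta_mean a b f g X Y =
     (\<integral>u. beta_weight a b u * (f (of_real u * X) * g (of_real (1 - u) * Y)) \<partial>lborel) / Beta a b"

context
  fixes a b :: complex and f g :: "complex \<Rightarrow> complex"
  assumes ab: "Re a > 0" "Re b > 0"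
    and f: "f holomorphic_on cut_plane" and g: "g holomorphic_on cut_plane"
begin

lemma beta_mean_measurable:
  assumes "X \<in> cut_plane" "Y \<in> cut_plane"
  shows "(\<lambda>u. beta_weight a b u * (f (of_real u * X) * g (of_real (1 - u) * Y))) \<in>
      borel_measurable borel"
proof (rule beta_weight_times_measurable, rule continuous_on_mult)
  have "of_real u * X \<in> cut_plane" "of_real (1 - u) * Y \<in> cut_plane" if "u \<in> {0<..<1}" for u
    using that assms by (auto intro!: cut_plane_scale simp del: of_real_diff)
  then have sub: "(\<lambda>u. of_real u * X) ` {0<..<1} \<subseteq> cut_plane" "(\<lambda>u. of_real (1 - u) * Y) `
      {0<..<1} \<subseteq> cut_plane"
    by auto
  show "continuous_on {0<..<1} (\<lambda>u. f (of_real u * X))"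
    by (rule continuous_on_compose2[OF holomorphic_on_imp_continuous_on[OF f] _ sub(1)])
       (intro continuous_intros)
  show "continuous_on {0<..<1} (\<lambda>u. g (of_real (1 - u) * Y))"
    by (rule continuous_on_compose2[OF holomorphic_on_imp_continuous_on[OF g] _ sub(2)])
       (intro continuous_intros)
qed

lemma beta_mean_dominated:
  assumes K: "compact K" "K \<subseteq> cut_plane" and L: "compact L" "L \<subseteq> cut_plane"
  obtains B where "integrable lborel B"
    "\<And>X Y u. X \<in> K \<Longrightarrow> Y \<in> L \<Longrightarrow>
       norm (beta_weight a b u * (f (of_real u * X) * g (of_real (1 - u) * Y))) \<le> B u"
proof -
  obtain M1 where M1: "M1 \<ge> 0" "\<And>z t. z \<in> K \<Longrightarrow> 0 \<le> t \<Longrightarrow> t \<le> 1 \<Longrightarrow> norm (f (of_real t * z)) \<le> M1"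
    using bounded_on_rays[OF holomorphic_on_imp_continuous_on[OF f] K] by metis
  obtain M2 where M2: "M2 \<ge> 0" "\<And>z t. z \<in> L \<Longrightarrow> 0 \<le> t \<Longrightarrow> t \<le> 1 \<Longrightarrow> norm (g (of_real t * z)) \<le> M2"
    using bounded_on_rays[OF holomorphic_on_imp_continuous_on[OF g] L] by metis
  show ?thesis
  proof (rule that[of "\<lambda>u. norm (beta_weight a b u) * (M1 * M2)"])
    show "integrable lborel (\<lambda>u. norm (beta_weight a b u) * (M1 * M2))"
      by (intro integrable_mult_left integrable_norm integrable_beta_weight ab)
    fix X Y u assume XY: "X \<in> K" "Y \<in> L"
    show "norm (beta_weight a b u * (f (of_real u * X) * g (of_real (1 - u) * Y))) \<le>
            norm (beta_weight a b u) * (M1 * M2)"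
    proof (cases "u \<in> {0<..<1}")
      case True
      then have "norm (f (of_real u * X)) \<le> M1" "norm (g (of_real (1 - u) * Y)) \<le> M2"
        using M1(2)[OF XY(1), of u] M2(2)[OF XY(2), of "1 - u"] by auto
      then show ?thesis using M1(1) M2(1) by (auto simp: norm_mult intro!: mult_mono)
    qed (simp add: beta_weight_def)
  qed
qed

lemma beta_mean_continuous: "continuous_on (cut_plane \<times> cut_plane) (\<lambda>(X, Y). beta_mean a b f g X Y)"
proof (rule continuous_on_sequentiallyI)
  fix s :: "nat \<Rightarrow> complex \<times> complex" and p
  assume s: "\<forall>n. s n \<in> cut_plane \<times> cut_plane" "p \<in> cut_plane \<times> cut_plane" "s \<longlonglongrightarrow> p"
  have s1: "(\<lambda>n. fst (s n)) \<longlonglongrightarrow> fst p" and s2: "(\<lambda>n. snd (s n)) \<longlonglongrightarrow> snd p"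
    using s(3) by (auto intro: tendsto_intros)
  define K L where "K = insert (fst p) (range (\<lambda>n. fst (s n)))" and "L = insert (snd p) (range
      (\<lambda>n. snd (s n)))"
  have KL: "compact K" "compact L" "K \<subseteq> cut_plane" "L \<subseteq> cut_plane"
    unfolding K_def L_def using s1 s2 s(1,2)
    by (auto intro: compact_sequence_with_limit simp: mem_Times_iff)
  obtain B where B: "integrable lborel B"
    "\<And>X Y u. X \<in> K \<Longrightarrow> Y \<in> L \<Longrightarrow>
       norm (beta_weight a b u * (f (of_real u * X) * g (of_real (1 - u) * Y))) \<le> B u"
    using beta_mean_dominated[OF KL(1,3) KL(2,4)] by metis
  have "(\<lambda>n. \<integral>u. beta_weight a b u * (f (of_real u * fst (s n)) * g (of_real (1 - u) * snd (s
      n))) \<partial>lborel)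
     \<longlonglongrightarrow> (\<integral>u. beta_weight a b u * (f (of_real u * fst p) * g (of_real (1 - u) * snd p)) \<partial>lborel)"
  proof (rule integral_dominated_convergence[where w = B])
    show "AE u in lborel. (\<lambda>n. beta_weight a b u * (f (of_real u * fst (s n)) * g (of_real (1 -
        u) * snd (s n))))
       \<longlonglongrightarrow> beta_weight a b u * (f (of_real u * fst p) * g (of_real (1 - u) * snd p))"
    proof (rule AE_I2)
      fix u :: real
      show "(\<lambda>n. beta_weight a b u * (f (of_real u * fst (s n)) * g (of_real (1 - u) * snd (s n))))
       \<longlonglongrightarrow> beta_weight a b u * (f (of_real u * fst p) * g (of_real (1 - u) * snd p))"
      proof (cases "u \<in> {0<..<1}")
        case True
        have ev: "of_real t * z \<in> cut_plane" if "z \<in> cut_plane" "t \<in> {0<..<1}" for t z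
          using cut_plane_scale[of z t] that by auto
        have "(\<lambda>n. f (of_real u * fst (s n))) \<longlonglongrightarrow> f (of_real u * fst p)"
          by (rule continuous_on_tendsto_compose[OF holomorphic_on_imp_continuous_on[OF f]])
             (use True s s1 in \<open>auto intro!: tendsto_intros ev always_eventually simp:
                 mem_Times_iff\<close>)
        moreover have "(\<lambda>n. g (of_real (1 - u) * snd (s n))) \<longlonglongrightarrow> g (of_real (1 - u) * snd p)"
          by (rule continuous_on_tendsto_compose[OF holomorphic_on_imp_continuous_on[OF g]])
             (use True s s2 in \<open>auto intro!: tendsto_intros ev always_eventually simp:
                 mem_Times_iff simp del: of_real_diff\<close>)
        ultimately show ?thesis by (intro tendsto_intros)
      qed (simp add: beta_weight_def)
    qed
    show "AE u in lborel. norm (beta_weight a b u * (f (of_real u * fst (s n)) * g (of_real (1 -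
        u) * snd (s n)))) \<le> B u" for n
      by (intro AE_I2 B(2)) (auto simp: K_def L_def)
  qed (use s beta_mean_measurable B(1) in \<open>auto simp: mem_Times_iff\<close>)
  then show "(\<lambda>n. case s n of (X, Y) \<Rightarrow> beta_mean a b f g X Y) \<longlonglongrightarrow> (case p of (X, Y) \<Rightarrow> beta_mean a
      b f g X Y)"
    unfolding beta_mean_def case_prod_unfold using ab
    by (intro tendsto_intros) (auto simp: Beta_nonzero)
qed

lemma beta_mean_holomorphic_left:
  assumes Y: "Y \<in> cut_plane"
  shows "(\<lambda>X. beta_mean a b f g X Y) holomorphic_on cut_plane"
proof -
  have "(\<lambda>X. \<integral>u. beta_weight a b u * (f (of_real u * X) * g (of_real (1 - u) * Y)) \<partial>lborel)
      holomorphic_on cut_plane"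
  proof (rule holomorphic_on_integral_param[OF open_cut_plane])
    show "(\<lambda>X. beta_weight a b u * (f (of_real u * X) * g (of_real (1 - u) * Y))) holomorphic_on
        cut_plane" for u
    proof (cases "u \<in> {0<..<1}")
      case True
      then show ?thesis
        by (intro holomorphic_intros holomorphic_on_compose_gen[OF _ f, unfolded o_def])
           (auto intro!: cut_plane_scale)
    qed (simp add: beta_weight_def)
    fix X assume "X \<in> cut_plane"
    then obtain r where r: "r > 0" "cball X r \<subseteq> cut_plane" using open_cut_plane
        open_contains_cball by blast
    obtain B where "integrable lborel B"
      "\<And>X' Y' u. X' \<in> cball X r \<Longrightarrow> Y' \<in> {Y} \<Longrightarrow>
         norm (beta_weight a b u * (f (of_real u * X') * g (of_real (1 - u) * Y'))) \<le> B u"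
      using beta_mean_dominated[OF _ r(2), of "{Y}"] Y by auto
    then show "\<exists>r>0. \<exists>B. cball X r \<subseteq> cut_plane \<and> integrable lborel B \<and> (\<forall>w\<in>cball X r. \<forall>u\<in>space
        lborel.
        norm (beta_weight a b u * (f (of_real u * w) * g (of_real (1 - u) * Y))) \<le> B u)"
      using r by blast
  qed (use beta_mean_measurable Y in auto)
  then show ?thesis unfolding beta_mean_def using ab
    by (intro holomorphic_intros) (auto simp: Beta_nonzero)
qed

end

lemma beta_mean_commute: "beta_mean a b f g X Y = beta_mean b a g f Y X"
proof -
  have "(\<integral>u. beta_weight a b u * (f (of_real u * X) * g (of_real (1 - u) * Y)) \<partial>lborel) =
        (\<integral>u. beta_weight a b (1 - u) * (f (of_real (1 - u) * X) * g (of_real u * Y)) \<partial>lborel)"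
    by (subst lborel_integral_real_affine[of "-1" _ 1]) auto
  also have "\<dots> = (\<integral>u. beta_weight b a u * (g (of_real u * Y) * f (of_real (1 - u) * X)) \<partial>lborel)"
    by (subst beta_weight_reflect) (simp add: mult_ac)
  finally show ?thesis by (simp add: beta_mean_def Beta_commute)
qed

lemma beta_mean_holomorphic_right:
  assumes "Re a > 0" "Re b > 0" "f holomorphic_on cut_plane" "g holomorphic_on cut_plane" "X \<in>
      cut_plane"
  shows "(\<lambda>Y. beta_mean a b f g X Y) holomorphic_on cut_plane"
proof -
  have "(\<lambda>Y. beta_mean a b f g X Y) = (\<lambda>Y. beta_mean b a g f Y X)"
    by (intro ext beta_mean_commute)
  then show ?thesis using beta_mean_holomorphic_left[OF assms(2,1,4,3,5)] by simp
qed

text \<open>The double series is enumerated by \<open>prod_decode\<close>, so that a single interchange of sum and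
  integral suffices; the majorant is the product of the two absolutely convergent series.\<close>

lemma beta_mean_has_sum:
  assumes ab: "Re a > 0" "Re b > 0"
    and f: "cut_plane_extension p f" and g: "cut_plane_extension q g"
    and X: "norm X < 1" and Y: "norm Y < 1"
  shows "((\<lambda>(m, l). p m * q l * (pochhammer a m * pochhammer b l / pochhammer (a + b) (m + l)) *
      X ^ m * Y ^ l)
           has_sum beta_mean a b f g X Y) UNIV"
proof -
  define A B where "A m = norm (p m * X ^ m)" and "B l = norm (q l * Y ^ l)" for m l
  define T where "T n u = beta_weight a b u * (case prod_decode n of (m, l) \<Rightarrow>
     (p m * (of_real u * X) ^ m) * (q l * (of_real (1 - u) * Y) ^ l))" for n u
  have sA: "summable A" and sB: "summable B"
    unfolding A_def B_def by (rule cut_plane_extension_norm_summable[OF f X], rule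
        cut_plane_extension_norm_summable[OF g Y])
  have sAB: "summable (\<lambda>n. case prod_decode n of (m, l) \<Rightarrow> A m * B l)"
  proof -
    have "(\<lambda>(m, l). A m * B l) summable_on UNIV"
      by (rule summable_on_times_nat[OF sA sB]) (simp_all add: A_def B_def)
    then have "(\<lambda>n. (\<lambda>(m, l). A m * B l) (prod_decode n)) summable_on UNIV"
      by (subst summable_on_reindex_bij_betw[OF bij_prod_decode])
    then show ?thesis by (rule summable_on_imp_summable)
  qed
  have T_eq: "T n u = (case prod_decode n of (m, l) \<Rightarrow>
       p m * q l * X ^ m * Y ^ l * beta_weight (a + of_nat m) (b + of_nat l) u)" for n u
    unfolding T_def case_prod_unfold beta_weight_times_power[symmetric] power_mult_distrib
    by (simp only: mult_ac)
  have T_bound: "norm (T n u) \<le> norm (beta_weight a b u) * (case prod_decode n of (m, l) \<Rightarrow> A m *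
      B l)" for n u
  proof (cases "u \<in> {0<..<1}")
    case True
    obtain m l where ml: "prod_decode n = (m, l)" by force
    have nrm: "norm (of_real u :: complex) = u" "norm (of_real (1 - u) :: complex) = 1 - u"
      using True by (simp_all del: of_real_diff)
    have "norm (T n u) = norm (beta_weight a b u) * (A m * B l) * (u ^ m * (1 - u) ^ l)"
      unfolding T_def ml case_prod_conv A_def B_def norm_mult norm_power nrm power_mult_distrib
      by (simp only: mult_ac)
    also have "\<dots> \<le> norm (beta_weight a b u) * (A m * B l) * (1 * 1)"
      using True by (intro mult_left_mono mult_mono power_le_one) (auto simp: A_def B_def)
    finally show ?thesis by (simp add: ml)
  qed (simp add: T_def beta_weight_def)
  have int_w: "integrable lborel (\<lambda>u. norm (beta_weight a b u))"
    using ab by (intro integrable_norm integrable_beta_weight)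
  have int_T: "integrable lborel (T n)" for n
    unfolding T_eq case_prod_unfold using ab by (intro integrable_mult_right
        integrable_beta_weight) auto
  have "(\<lambda>n. \<integral>u. T n u \<partial>lborel) sums (\<integral>u. (\<Sum>n. T n u) \<partial>lborel)"
  proof (rule sums_integral[OF int_T])
    show "AE u in lborel. summable (\<lambda>n. norm (T n u))"
      by (rule AE_I2, rule summable_comparison_test'[OF summable_mult[OF sAB]]) (use T_bound in
          auto)
    show "summable (\<lambda>n. \<integral>u. norm (T n u) \<partial>lborel)"
    proof (rule summable_comparison_test'[OF summable_mult[OF sAB]])
      fix n
      have "(\<integral>u. norm (T n u) \<partial>lborel) \<le> (\<integral>u. norm (beta_weight a b u) * (case prod_decode n of
          (m, l) \<Rightarrow> A m * B l) \<partial>lborel)"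
        by (intro integral_mono integrable_mult_left int_w integrable_norm[OF int_T] T_bound)
      then show "norm (\<integral>u. norm (T n u) \<partial>lborel) \<le> (\<integral>u. norm (beta_weight a b u) \<partial>lborel) *
          (case prod_decode n of (m, l) \<Rightarrow> A m * B l)"
        by simp
    qed
  qed
  moreover have "(\<Sum>n. T n u) = beta_weight a b u * (f (of_real u * X) * g (of_real (1 - u) *
      Y))" for u
  proof (cases "u \<in> {0<..<1}")
    case True
    have "norm (of_real u * X) \<le> norm X" "norm (of_real (1 - u) * Y) \<le> norm Y"
      using True by (auto simp: norm_mult mult_left_le_one_le simp del: of_real_diff)
    then have uX: "norm (of_real u * X) < 1" and uY: "norm (of_real (1 - u) * Y) < 1" using X Y
        by auto
    have "((\<lambda>(m, l). (p m * (of_real u * X) ^ m) * (q l * (of_real (1 - u) * Y) ^ l))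
            has_sum f (of_real u * X) * g (of_real (1 - u) * Y)) UNIV"
      using f g uX uY cut_plane_extension_norm_summable
      by (intro has_sum_times_nat) (auto simp: cut_plane_extension_def)
    then have "((\<lambda>n. (\<lambda>(m, l). (p m * (of_real u * X) ^ m) * (q l * (of_real (1 - u) * Y) ^ l))
        (prod_decode n))
            has_sum f (of_real u * X) * g (of_real (1 - u) * Y)) UNIV"
      by (subst has_sum_reindex_bij_betw[OF bij_prod_decode])
    from sums_mult[OF has_sum_imp_sums[OF this], of "beta_weight a b u"] show ?thesis
      by (simp add: T_def sums_iff)
  qed (simp add: T_def beta_weight_def)
  moreover have int_T_eq: "(\<integral>u. T n u \<partial>lborel) = Beta a b * (\<lambda>(m, l). p m * q l * (pochhammer a
      m * pochhammer b l / pochhammer (a + b) (m + l)) * X ^ m * Y ^ l) (prod_decode n)" for n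
  proof -
    obtain m l where ml: "prod_decode n = (m, l)" by force
    have "(\<integral>u. T n u \<partial>lborel) = p m * q l * X ^ m * Y ^ l * Beta (a + of_nat m) (b + of_nat l)"
      using ab by (simp add: T_eq ml integral_beta_weight)
    also have "Beta (a + of_nat m) (b + of_nat l) = Beta a b * (pochhammer a m * pochhammer b l
        / pochhammer (a + b) (m + l))"
      using ab by (intro Beta_shift Re_pos_not_nonpos_Int) auto
    finally show ?thesis by (simp add: ml)
  qed
  moreover have B0: "Beta a b \<noteq> 0"
    using ab by (auto simp: Beta_nonzero)
  moreover have "summable (\<lambda>n. norm (\<integral>u. T n u \<partial>lborel))"
  proof (rule summable_comparison_test'[OF summable_mult[OF sAB]])
    fix n
    have "norm (\<integral>u. T n u \<partial>lborel) \<le> (\<integral>u. norm (T n u) \<partial>lborel)" by simp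
    also have "\<dots> \<le> (\<integral>u. norm (beta_weight a b u) * (case prod_decode n of (m, l) \<Rightarrow> A m * B l)
        \<partial>lborel)"
      by (intro integral_mono integrable_mult_left int_w integrable_norm[OF int_T] T_bound)
    finally show "norm (norm (\<integral>u. T n u \<partial>lborel)) \<le> (\<integral>u. norm (beta_weight a b u) \<partial>lborel) *
        (case prod_decode n of (m, l) \<Rightarrow> A m * B l)"
      by simp
  qed
  ultimately have "((\<lambda>n. \<integral>u. T n u \<partial>lborel) has_sum (\<integral>u. beta_weight a b u * (f (of_real u * X)
      * g (of_real (1 - u) * Y)) \<partial>lborel)) UNIV"
    by (intro norm_summable_imp_has_sum) auto
  then have "((\<lambda>n. (\<lambda>(m, l). p m * q l * (pochhammer a m * pochhammer b l / pochhammer (a + b)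
      (m + l)) * X ^ m * Y ^ l) (prod_decode n))
     has_sum beta_mean a b f g X Y) UNIV"
    unfolding int_T_eq beta_mean_def using has_sum_cmult_right[of _ _ _ "1 / Beta a b"] B0 by
        fastforce
  then show ?thesis by (subst (asm) has_sum_reindex_bij_betw[OF bij_prod_decode])
qed

section \<open>Continuation of Gauss and Appell functions to the cut plane\<close>

lemma cut_plane_extension_binomial:
  "cut_plane_extension (\<lambda>m. pochhammer a m / fact m) (\<lambda>z. (1 - z) powr (- a))"
  unfolding cut_plane_extension_def
proof (intro conjI allI impI)
  have "1 - z \<notin> \<real>\<^sub>\<le>\<^sub>0" if "z \<in> cut_plane" for z
  proof
    assume "1 - z \<in> \<real>\<^sub>\<le>\<^sub>0"
    then obtain r where r: "1 - z = of_real r" "r \<le> 0" by (auto elim!: nonpos_Reals_cases)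
    have "z = 1 - (1 - z)" by simp
    also have "\<dots> = complex_of_real (1 - r)" unfolding r(1) by simp
    finally have "z = complex_of_real (1 - r)" .
    moreover have "1 - r \<in> {1..}" using r by simp
    ultimately have "z \<in> complex_of_real ` {1..}" by (rule image_eqI)
    with that show False by (simp add: cut_plane_def)
  qed
  then show "(\<lambda>z. (1 - z) powr (- a)) holomorphic_on cut_plane"
    by (intro holomorphic_intros) auto
  fix z :: complex assume "norm z < 1"
  then have "(\<lambda>n. ((- a) gchoose n) * (- z) ^ n) sums (1 + (- z)) powr (- a)"
    by (intro gen_binomial_complex) simp
  moreover have "((- a) gchoose n) * (- z) ^ n = pochhammer a n / fact n * z ^ n" for n
    by (simp add: gbinomial_pochhammer power_minus[of z] mult_ac flip: power_add)
  ultimately show "(\<lambda>m. pochhammer a m / fact m * z ^ m) sums (1 - z) powr (- a)"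
    by simp
qed

lemma cut_plane_extension_deriv_sums:
  assumes h: "cut_plane_extension h f" and z: "norm z < 1"
  shows "(\<lambda>n. diffs h n * z ^ n) sums deriv f z"
proof -
  have s: "\<And>z. norm z < 1 \<Longrightarrow> summable (\<lambda>n. h n * z ^ n)"
    and e: "\<And>z. norm z < 1 \<Longrightarrow> (\<Sum>n. h n * z ^ n) = f z"
    using h by (auto simp: cut_plane_extension_def sums_iff)
  have "((\<lambda>z. \<Sum>n. h n * z ^ n) has_field_derivative (\<Sum>n. diffs h n * z ^ n)) (at z)"
    using s z by (rule termdiffs_strong')
  then have "(f has_field_derivative (\<Sum>n. diffs h n * z ^ n)) (at z)"
  proof (rule has_field_derivative_transform_within_open[where S = "ball 0 1"])
    show "(\<Sum>n. h n * w ^ n) = f w" if "w \<in> ball 0 1" for w using e that by simp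
  qed (use z in auto)
  then have "deriv f z = (\<Sum>n. diffs h n * z ^ n)" by (rule DERIV_imp_deriv)
  moreover have "summable (\<lambda>n. diffs h n * z ^ n)" using z s by (rule termdiff_converges)
  ultimately show ?thesis by (simp add: sums_iff)
qed

lemma cut_plane_extension_0: "cut_plane_extension h f \<Longrightarrow> f 0 = h 0"
  unfolding cut_plane_extension_def
  by (metis norm_zero powser_sums_zero sums_unique2 zero_less_one)

text \<open>Dropping the leading coefficient divides \<open>f - f 0\<close> by \<open>z\<close>, which leaves a removable
  singularity at 0.\<close>

lemma cut_plane_extension_Suc:
  assumes h: "cut_plane_extension h f"
  shows "cut_plane_extension (\<lambda>m. h (Suc m)) (\<lambda>z. if z = 0 then deriv f 0 else (f z - f 0) / (z
      - 0))"
  unfolding cut_plane_extension_def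
proof (intro conjI allI impI)
  show "(\<lambda>z. if z = 0 then deriv f 0 else (f z - f 0) / (z - 0)) holomorphic_on cut_plane"
    using h open_cut_plane by (intro pole_lemma_open) (auto simp: cut_plane_extension_def)
  fix z :: complex assume z: "norm z < 1"
  show "(\<lambda>m. h (Suc m) * z ^ m) sums (if z = 0 then deriv f 0 else (f z - f 0) / (z - 0))"
  proof (cases "z = 0")
    case True
    have "(\<lambda>n. diffs h n * 0 ^ n) sums deriv f 0"
      by (rule cut_plane_extension_deriv_sums[OF h]) simp
    then have "deriv f 0 = diffs h 0"
      using powser_sums_zero sums_unique2 by blast
    with True show ?thesis
      using powser_sums_zero[of "\<lambda>m. h (Suc m)"] by (simp add: diffs_def)
  next
    case False
    have "(\<lambda>m. h m * z ^ m) sums f z" using h z by (simp add: cut_plane_extension_def)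
    then have "(\<lambda>m. h (Suc m) * z ^ Suc m) sums (f z - f 0)"
      using cut_plane_extension_0[OF h] by (subst sums_Suc_iff) simp
    from sums_divide[OF this, of z] False show ?thesis by (simp add: field_simps)
  qed
qed

lemma cut_plane_extension_shift:
  assumes "cut_plane_extension h f"
  obtains g where "cut_plane_extension (\<lambda>m. h (m + N)) g"
proof -
  have "\<exists>g. cut_plane_extension (\<lambda>m. h (m + N)) g"
  proof (induction N)
    case (Suc N)
    then show ?case using cut_plane_extension_Suc by fastforce
  qed (use assms in auto)
  then show ?thesis using that by blast
qed

lemma cut_plane_extension_unSuc:
  assumes g: "cut_plane_extension (\<lambda>m. h (Suc m)) g"
  shows "cut_plane_extension h (\<lambda>z. h 0 + z * g z)"
  unfolding cut_plane_extension_def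
proof (intro conjI allI impI)
  show "(\<lambda>z. h 0 + z * g z) holomorphic_on cut_plane"
    using g by (intro holomorphic_intros) (auto simp: cut_plane_extension_def)
  fix z :: complex assume "norm z < 1"
  then have "(\<lambda>m. z * (h (Suc m) * z ^ m)) sums (z * g z)"
    using g by (intro sums_mult) (auto simp: cut_plane_extension_def)
  then have "(\<lambda>m. h (Suc m) * z ^ Suc m) sums (z * g z)" by (simp add: mult_ac)
  then show "(\<lambda>m. h m * z ^ m) sums (h 0 + z * g z)"
    by (subst (asm) sums_Suc_iff) (simp add: add.commute)
qed

lemma cut_plane_extension_unshift:
  assumes "cut_plane_extension (\<lambda>m. h (m + N)) g"
  obtains f where "cut_plane_extension h f"
proof -
  have "\<exists>f. cut_plane_extension h f"
    using assms
  proof (induction N arbitrary: g)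
    case (Suc N)
    have "cut_plane_extension (\<lambda>m. (\<lambda>m. h (m + N)) (Suc m)) g" using Suc.prems by simp
    from cut_plane_extension_unSuc[OF this] show ?case by (rule Suc.IH)
  qed auto
  then show ?thesis using that by blast
qed

text \<open>A factor linear in the index is the Euler operator \<open>c + z d/dz\<close> acting on the function.\<close>

lemma cut_plane_extension_times_linear:
  assumes h: "cut_plane_extension h f"
  shows "cut_plane_extension (\<lambda>m. (c + of_nat m) * h m) (\<lambda>z. c * f z + z * deriv f z)"
  unfolding cut_plane_extension_def
proof (intro conjI allI impI)
  show "(\<lambda>z. c * f z + z * deriv f z) holomorphic_on cut_plane"
    using h open_cut_plane by (intro holomorphic_intros) (auto simp: cut_plane_extension_def)
  fix z :: complex assume z: "norm z < 1"
  have "(\<lambda>n. z * (diffs h n * z ^ n)) sums (z * deriv f z)"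
    by (intro sums_mult cut_plane_extension_deriv_sums[OF h z])
  then have "(\<lambda>n. of_nat (Suc n) * h (Suc n) * z ^ Suc n) sums (z * deriv f z)"
    by (simp add: diffs_def mult_ac)
  then have "(\<lambda>n. of_nat n * h n * z ^ n) sums (z * deriv f z)"
    by (subst (asm) sums_Suc_iff) simp
  moreover have "(\<lambda>n. c * (h n * z ^ n)) sums (c * f z)"
    using h z by (intro sums_mult) (auto simp: cut_plane_extension_def)
  ultimately have "(\<lambda>n. c * (h n * z ^ n) + of_nat n * h n * z ^ n) sums (c * f z + z * deriv f z)"
    by (intro sums_add)
  then show "(\<lambda>m. (c + of_nat m) * h m * z ^ m) sums (c * f z + z * deriv f z)"
    by (simp add: algebra_simps)
qed

lemma cut_plane_extension_times_pochhammer: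
  assumes "cut_plane_extension h f"
  obtains g where "cut_plane_extension (\<lambda>m. pochhammer (c + of_nat m) M * h m) g"
proof -
  have "\<exists>g. cut_plane_extension (\<lambda>m. pochhammer (c + of_nat m) M * h m) g"
  proof (induction M)
    case (Suc M)
    then obtain g where g: "cut_plane_extension (\<lambda>m. pochhammer (c + of_nat m) M * h m) g" by blast
    have "(\<lambda>m. pochhammer (c + of_nat m) (Suc M) * h m) =
        (\<lambda>m. ((c + of_nat M) + of_nat m) * (pochhammer (c + of_nat m) M * h m))"
      by (auto simp: pochhammer_Suc algebra_simps)
    with cut_plane_extension_times_linear[OF g, of "c + of_nat M"] show ?case by metis
  qed (use assms in auto)
  then show ?thesis using that by blast
qed

lemma cut_plane_extension_cmult:
  assumes "cut_plane_extension h f"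
  shows "cut_plane_extension (\<lambda>m. c * h m) (\<lambda>z. c * f z)"
  unfolding cut_plane_extension_def mult.assoc
proof (intro conjI allI impI)
  show "(\<lambda>z. c * f z) holomorphic_on cut_plane"
    using assms by (intro holomorphic_intros) (simp add: cut_plane_extension_def)
  show "(\<lambda>m. c * (h m * z ^ m)) sums (c * f z)" if "norm z < 1" for z
    using assms that by (intro sums_mult) (simp add: cut_plane_extension_def)
qed

text \<open>The quotient \<open>(b)_m / (c)_m\<close> is the \<open>m\<close>-th moment of a Beta distribution, so the new function
  is an average of \<open>f\<close> along rays.\<close>

lemma cut_plane_extension_beta:
  assumes h: "cut_plane_extension h f" and bc: "Re b > 0" "Re b < Re c"
  shows "cut_plane_extension (\<lambda>m. h m * (pochhammer b m / pochhammer c m))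
           (\<lambda>z. beta_mean b (c - b) f (\<lambda>_. 1) z 0)"
  unfolding cut_plane_extension_def
proof (intro conjI allI impI)
  have "0 \<in> cut_plane" by (auto simp: cut_plane_def)
  then show "(\<lambda>z. beta_mean b (c - b) f (\<lambda>_. 1) z 0) holomorphic_on cut_plane"
    using h bc by - (rule beta_mean_holomorphic_left, auto simp: cut_plane_extension_def)
  fix z :: complex assume z: "norm z < 1"
  \<comment> \<open>\<open>q\<close> is the coefficient sequence of the constant 1, so only the terms with \<open>l = 0\<close> remain.\<close>
  define q where "q l = (if l = 0 then 1 else 0 :: complex)" for l :: nat
  have q: "cut_plane_extension q (\<lambda>_. 1)"
    using powser_sums_if[of 0] unfolding cut_plane_extension_def q_def
    by (auto simp: if_distrib cong: if_cong)
  have "((\<lambda>(m, l). h m * q l * (pochhammer b m * pochhammer (c - b) l / pochhammer (b + (c - b))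
      (m + l)) * z ^ m * 0 ^ l)
           has_sum beta_mean b (c - b) f (\<lambda>_. 1) z 0) UNIV"
    using bc z by (intro beta_mean_has_sum h q) auto
  also have "?this \<longleftrightarrow> ((\<lambda>(m, l). h m * (pochhammer b m / pochhammer c m) * z ^ m)
           has_sum beta_mean b (c - b) f (\<lambda>_. 1) z 0) (range (\<lambda>m. (m, 0::nat)))"
    by (rule has_sum_cong_neutral) (auto simp: q_def)
  also have "\<dots> \<longleftrightarrow> ((\<lambda>m. h m * (pochhammer b m / pochhammer c m) * z ^ m)
           has_sum beta_mean b (c - b) f (\<lambda>_. 1) z 0) UNIV"
    by (subst has_sum_reindex) (auto simp: inj_on_def o_def)
  finally show "(\<lambda>m. h m * (pochhammer b m / pochhammer c m) * z ^ m) sums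
                  beta_mean b (c - b) f (\<lambda>_. 1) z 0"
    by (rule has_sum_imp_sums)
qed

definition hyp_coeff :: "complex \<Rightarrow> complex \<Rightarrow> complex \<Rightarrow> nat \<Rightarrow> complex" where
  "hyp_coeff a b c m = pochhammer a m * pochhammer b m / (pochhammer c m * fact m)"

lemma pochhammer_nonzero: "pochhammer c m \<noteq> 0" if "Re c > 0"
proof
  assume "pochhammer c m = 0"
  then obtain k where "c = - of_nat k" unfolding pochhammer_eq_0_iff by blast
  with that show False by simp
qed

text \<open>The moment argument handles the factor \<open>(b)_m / (c)_m\<close> only if \<open>0 < Re b < Re c\<close>. In general
  \<open>b + N\<close> is written as \<open>\<beta> + M\<close>: dropping the first \<open>N\<close> coefficients replaces \<open>b\<close> and \<open>c\<close> by
  \<open>b + N\<close> and \<open>c + N\<close>, and \<open>(\<beta> + M)_m\<close> differs from \<open>(\<beta>)_m\<close> only by a polynomial in \<open>m\<close>,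
  which an Euler operator produces. Now \<open>M\<close> and then \<open>N\<close> can be taken so large that
  \<open>0 < Re \<beta> < Re (c + N)\<close>.\<close>

lemma ex_cut_plane_extension_hyp:
  assumes c: "Re c > 0"
  shows "\<exists>f. cut_plane_extension (hyp_coeff a b c) f"
proof -
  \<comment> \<open>\<open>M\<close> ensures \<open>Re \<beta> < Re (c + N)\<close>, and then \<open>N\<close> ensures \<open>Re \<beta> > 0\<close>.\<close>
  obtain M :: nat where M: "Re b - Re c < real M" using reals_Archimedean2 by blast
  obtain N :: nat where N: "real M - Re b < real N" using reals_Archimedean2 by blast
  define \<beta> where "\<beta> = b + of_nat N - of_nat M"
  have \<beta>: "Re \<beta> > 0" "Re \<beta> < Re (c + of_nat N)" using M N by (auto simp: \<beta>_def)
  obtain f1 where f1: "cut_plane_extension (\<lambda>m. pochhammer a (m + N) / fact (m + N)) f1"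
    using cut_plane_extension_shift[OF cut_plane_extension_binomial] by blast
  obtain f2 where f2: "cut_plane_extension (\<lambda>m. pochhammer (\<beta> + of_nat m) M *
      (pochhammer a (m + N) / fact (m + N) * (pochhammer \<beta> m / pochhammer (c + of_nat N) m))) f2"
    using cut_plane_extension_times_pochhammer[OF cut_plane_extension_beta[OF f1 \<beta>]] by blast
  have "cut_plane_extension (\<lambda>m. pochhammer b N / (pochhammer c N * pochhammer \<beta> M) *
      (pochhammer (\<beta> + of_nat m) M *
      (pochhammer a (m + N) / fact (m + N) * (pochhammer \<beta> m / pochhammer (c + of_nat N) m))))
      (\<lambda>z. pochhammer b N / (pochhammer c N * pochhammer \<beta> M) * f2 z)"
    by (rule cut_plane_extension_cmult[OF f2])
  also have "(\<lambda>m. pochhammer b N / (pochhammer c N * pochhammer \<beta> M) * (pochhammer (\<beta> + of_nat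
      m) M *
      (pochhammer a (m + N) / fact (m + N) * (pochhammer \<beta> m / pochhammer (c + of_nat N) m))))
      = (\<lambda>m. hyp_coeff a b c (m + N))"
  proof
    fix m
    have nz: "pochhammer \<beta> M \<noteq> 0" using \<beta>(1) by (rule pochhammer_nonzero)
    have "pochhammer \<beta> m * pochhammer (\<beta> + of_nat m) M = pochhammer \<beta> (M + m)"
      by (simp add: pochhammer_product' add.commute[of M m])
    also have "\<dots> = pochhammer \<beta> M * pochhammer (b + of_nat N) m"
      by (simp add: pochhammer_product' \<beta>_def)
    finally have 1: "pochhammer \<beta> m * pochhammer (\<beta> + of_nat m) M = pochhammer \<beta> M * pochhammer
        (b + of_nat N) m" .
    have 2: "pochhammer b (m + N) = pochhammer b N * pochhammer (b + of_nat N) m"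
      "pochhammer c (m + N) = pochhammer c N * pochhammer (c + of_nat N) m"
      by (simp_all add: pochhammer_product' add.commute[of m N])
    have "pochhammer b N / (pochhammer c N * pochhammer \<beta> M) * (pochhammer (\<beta> + of_nat m) M *
      (pochhammer a (m + N) / fact (m + N) * (pochhammer \<beta> m / pochhammer (c + of_nat N) m))) =
      pochhammer b N * pochhammer a (m + N) * (pochhammer \<beta> m * pochhammer (\<beta> + of_nat m) M) /
      (pochhammer \<beta> M * (pochhammer c N * pochhammer (c + of_nat N) m * fact (m + N)))"
      by (simp only: times_divide_eq_left times_divide_eq_right divide_divide_eq_left mult_ac)
    also have "\<dots> = pochhammer \<beta> M * (pochhammer a (m + N) * pochhammer b (m + N)) /
                     (pochhammer \<beta> M * (pochhammer c (m + N) * fact (m + N)))"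
      unfolding 1 2 by (simp only: mult_ac)
    also have "\<dots> = hyp_coeff a b c (m + N)"
      unfolding hyp_coeff_def by (rule nonzero_mult_divide_mult_cancel_left[OF nz])
    finally show "pochhammer b N / (pochhammer c N * pochhammer \<beta> M) * (pochhammer (\<beta> + of_nat
        m) M *
      (pochhammer a (m + N) / fact (m + N) * (pochhammer \<beta> m / pochhammer (c + of_nat N) m))) =
          hyp_coeff a b c (m + N)" .
  qed
  finally have *: "cut_plane_extension (\<lambda>m. hyp_coeff a b c (m + N))
      (\<lambda>z. pochhammer b N / (pochhammer c N * pochhammer \<beta> M) * f2 z)" .
  from cut_plane_extension_unshift[OF *] obtain f where "cut_plane_extension (hyp_coeff a b c) f" .
  then show ?thesis by (rule exI[of _ f])
qed

text \<open>The Gauss function on the cut plane, where the choice is unique by the identity theorem;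
  meaningful for \<open>Re c > 0\<close>.\<close>

definition hyp2F1 :: "complex \<Rightarrow> complex \<Rightarrow> complex \<Rightarrow> complex \<Rightarrow> complex" where
  "hyp2F1 a b c = (SOME f. cut_plane_extension (hyp_coeff a b c) f)"

lemma cut_plane_extension_hyp2F1:
  "Re c > 0 \<Longrightarrow> cut_plane_extension (hyp_coeff a b c) (hyp2F1 a b c)"
  unfolding hyp2F1_def by (rule someI_ex[OF ex_cut_plane_extension_hyp])

text \<open>Splitting \<open>c\<close> as \<open>g + g'\<close> expresses \<open>F3\<close> by two Gauss functions with lower parameters \<open>g\<close> and
  \<open>g'\<close>. With \<open>g = g' = c / 2\<close> this continues \<open>F3\<close> for every
  \<open>c\<close> with \<open>Re c > 0\<close>.\<close>

lemma appell_F3_continuation_beta_mean: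
  assumes "Re g > 0" "Re g' > 0"
  shows "appell_F3_continuation a a' b b' (g + g') (beta_mean g g' (hyp2F1 a b g) (hyp2F1 a' b'
      g'))"
  unfolding appell_F3_continuation_def
proof (intro conjI ballI allI impI)
  note ext = cut_plane_extension_hyp2F1[OF assms(1), of a b] cut_plane_extension_hyp2F1[OF
      assms(2), of a' b']
  note hol = ext[unfolded cut_plane_extension_def, THEN conjunct1]
  show "continuous_on (cut_plane \<times> cut_plane) (\<lambda>(X, Y). beta_mean g g' (hyp2F1 a b g) (hyp2F1 a'
      b' g') X Y)"
    by (intro beta_mean_continuous assms hol)
  show "(\<lambda>X. beta_mean g g' (hyp2F1 a b g) (hyp2F1 a' b' g') X Y) holomorphic_on cut_plane" if
      "Y \<in> cut_plane" for Y
    by (intro beta_mean_holomorphic_left assms hol that)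
  show "(\<lambda>Y. beta_mean g g' (hyp2F1 a b g) (hyp2F1 a' b' g') X Y) holomorphic_on cut_plane" if
      "X \<in> cut_plane" for X
    by (intro beta_mean_holomorphic_right assms hol that)
  fix X Y :: complex assume XY: "norm X < 1" "norm Y < 1"
  have "((\<lambda>(m, l). hyp_coeff a b g m * hyp_coeff a' b' g' l *
      (pochhammer g m * pochhammer g' l / pochhammer (g + g') (m + l)) * X ^ m * Y ^ l)
           has_sum beta_mean g g' (hyp2F1 a b g) (hyp2F1 a' b' g') X Y) UNIV"
    by (intro beta_mean_has_sum assms ext XY)
  also have "(\<lambda>(m, l). hyp_coeff a b g m * hyp_coeff a' b' g' l *
      (pochhammer g m * pochhammer g' l / pochhammer (g + g') (m + l)) * X ^ m * Y ^ l) =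
     (\<lambda>(m, l). pochhammer a m * pochhammer a' l * pochhammer b m * pochhammer b' l /
        (pochhammer (g + g') (m + l) * fact m * fact l) * X ^ m * Y ^ l)"
    using pochhammer_nonzero[OF assms(1)] pochhammer_nonzero[OF assms(2)] by (simp add:
        hyp_coeff_def fun_eq_iff mult_ac)
  finally show "beta_mean g g' (hyp2F1 a b g) (hyp2F1 a' b' g') X Y = appell_F3_series a a' b b'
      (g + g') X Y"
    unfolding appell_F3_series_def by (rule infsumI[symmetric])
qed

lemma appell_F3_eq_beta_mean:
  assumes "Re g > 0" "Re g' > 0" "X \<in> cut_plane" "Y \<in> cut_plane"
  shows "appell_F3 a a' b b' (g + g') X Y = beta_mean g g' (hyp2F1 a b g) (hyp2F1 a' b' g') X Y"
proof -
  note F = appell_F3_continuation_beta_mean[OF assms(1,2), of a a' b b']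
  have "appell_F3_continuation a a' b b' (g + g') (appell_F3 a a' b b' (g + g'))"
    unfolding appell_F3_def by (rule someI[of "appell_F3_continuation a a' b b' (g + g')", OF F])
  from appell_F3_continuation_unique[OF this F assms(3,4)] show ?thesis .
qed

section \<open>Pfaff's transformation\<close>

text \<open>Crude geometric growth is enough for convergence near 0, which is all that Pfaff's
  transformation needs before analytic continuation.\<close>

lemma norm_pochhammer_ratio_le:
  assumes "Re c > 0"
  shows "norm (pochhammer (c - b) m / pochhammer c m) \<le> (1 + norm b / Re c) ^ m"
proof (induction m)
  case (Suc m)
  have pos: "Re c \<le> norm (c + of_nat m)" using complex_Re_le_cmod[of "c + of_nat m"] by simp
  then have pos': "norm (c + of_nat m) > 0" using assms by linarith
  have "norm (c - b + of_nat m) \<le> norm (c + of_nat m) + norm b"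
    using norm_triangle_ineq4[of "c + of_nat m" b] by (simp add: algebra_simps)
  also have "norm b = Re c * (norm b / Re c)" using assms by simp
  also have "\<dots> \<le> norm (c + of_nat m) * (norm b / Re c)"
    using pos assms by (intro mult_right_mono) auto
  finally have "norm (c - b + of_nat m) \<le> (1 + norm b / Re c) * norm (c + of_nat m)"
    by (simp add: algebra_simps)
  then have "norm (c - b + of_nat m) / norm (c + of_nat m) \<le> 1 + norm b / Re c"
    using pos' by (simp add: pos_divide_le_eq)
  then have "norm (pochhammer (c - b) m / pochhammer c m) * (norm (c - b + of_nat m) / norm (c +
      of_nat m))
      \<le> (1 + norm b / Re c) ^ m * (1 + norm b / Re c)"
    using assms by (intro mult_mono Suc) auto
  then show ?case by (simp add: pochhammer_Suc norm_mult norm_divide mult_ac)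
qed auto

lemma norm_pochhammer_fact_le:
  "norm (pochhammer a m / fact m :: complex) \<le> (1 + norm a) ^ m"
proof (induction m)
  case (Suc m)
  have "norm (a + of_nat m) \<le> norm a + real m" using norm_triangle_ineq[of a "of_nat m"] by simp
  also have "\<dots> \<le> (1 + norm a) * real (Suc m)" by (simp add: algebra_simps)
  finally have "norm (a + of_nat m) / real (Suc m) \<le> 1 + norm a" by (simp add: pos_divide_le_eq)
  then have "norm (pochhammer a m / fact m) * (norm (a + of_nat m) / real (Suc m)) \<le> (1 + norm
      a) ^ m * (1 + norm a)"
    by (intro mult_mono Suc) auto
  moreover have "norm (pochhammer a (Suc m) / fact (Suc m)) = norm (pochhammer a m / fact m) *
      (norm (a + of_nat m) / real (Suc m))"
    by (simp add: pochhammer_Suc norm_mult norm_divide del: of_nat_Suc)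
  ultimately show ?case by (simp add: mult_ac)
qed auto

lemma hyp2F1_sums: "Re c > 0 \<Longrightarrow> norm z < 1 \<Longrightarrow> (\<lambda>m. hyp_coeff a b c m * z ^ m) sums hyp2F1 a b c z"
  using cut_plane_extension_hyp2F1 by (simp add: cut_plane_extension_def)

lemma hyp2F1_holomorphic: "Re c > 0 \<Longrightarrow> hyp2F1 a b c holomorphic_on cut_plane"
  using cut_plane_extension_hyp2F1 by (simp add: cut_plane_extension_def)

text \<open>The Chu-Vandermonde identity, in the form of the coefficient comparison behind Pfaff's
  transformation.\<close>

lemma pochhammer_binomial_transform:
  assumes "Re c > 0"
  shows "(\<Sum>m\<le>n. pochhammer a n / (fact m * fact (n - m)) * (- 1) ^ m * (pochhammer (c - b) m /
      pochhammer c m))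
           = hyp_coeff a b c n"
proof -
  have "(\<Sum>k=0..n. (pochhammer (c - b) k * pochhammer (- (of_nat n)) k) / (of_nat (fact k) *
      pochhammer c k))
      = pochhammer (c - (c - b)) n / pochhammer c n"
    using assms by (intro Vandermonde_pochhammer) auto
  then have V: "(\<Sum>k\<le>n. (pochhammer (c - b) k * pochhammer (- (of_nat n)) k) / (fact k *
      pochhammer c k))
      = pochhammer b n / pochhammer c n"
    by (simp add: atMost_atLeast0)
  have "pochhammer a n / (fact m * fact (n - m)) * (- 1) ^ m * (pochhammer (c - b) m /
      pochhammer c m)
      = pochhammer a n / fact n * ((pochhammer (c - b) m * pochhammer (- (of_nat n)) m) / (fact
          m * pochhammer c m))"
    if "m \<le> n" for m
  proof -
    have "pochhammer (- of_nat n :: complex) m = (- 1) ^ m * pochhammer (of_nat n - of_nat m + 1) m"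
      by (simp add: pochhammer_minus)
    also have "pochhammer (of_nat n - of_nat m + 1 :: complex) m = (of_nat n gchoose m) * fact m"
      by (simp add: gbinomial_pochhammer')
    also have "\<dots> = of_nat (n choose m) * fact m" by (simp add: binomial_gbinomial)
    also have "(of_nat (n choose m) :: complex) = fact n / (fact m * fact (n - m))"
      using that by (rule binomial_fact)
    finally have p: "pochhammer (- of_nat n :: complex) m = (- 1) ^ m * (fact n / fact (n - m))"
        by simp
    show ?thesis unfolding p by (simp add: mult_ac)
  qed
  then have "(\<Sum>m\<le>n. pochhammer a n / (fact m * fact (n - m)) * (- 1) ^ m * (pochhammer (c - b) m
      / pochhammer c m))
     = pochhammer a n / fact n * (\<Sum>m\<le>n. (pochhammer (c - b) m * pochhammer (- (of_nat n)) m) /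
         (fact m * pochhammer c m))"
    unfolding sum_distrib_left by (intro sum.cong) auto
  also have "\<dots> = hyp_coeff a b c n" unfolding V by (simp add: hyp_coeff_def)
  finally show ?thesis .
qed

lemma powr_diff_nat: "z \<noteq> 0 \<Longrightarrow> z powr (- a - of_nat m) = z powr (- a) / z ^ m" for z a :: complex
  using powr_diff[of z "- a" "of_nat m"] by (simp add: powr_nat)

text \<open>Expanding \<open>(1 - z) powr (- a - m)\<close> by the binomial series turns the right-hand side into a
  double series. It converges absolutely near 0, and summing it along the diagonals \<open>m + k = n\<close>
  gives the left-hand side by the Chu-Vandermonde identity.\<close>

lemma hyp2F1_pfaff_near_0:
  assumes c: "Re c > 0"
  obtains r where "r > 0" "r \<le> 1/2"
    "\<And>z. norm z < r \<Longrightarrow> hyp2F1 a b c z = (1 - z) powr (- a) * hyp2F1 a (c - b) c (z / (z - 1))"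
proof -
  define K where "K = 1 + norm a"
  define H where "H = 1 + norm b / Re c"
  have KH: "K \<ge> 1" "H \<ge> 1" using c by (auto simp: K_def H_def)
  \<comment> \<open>In the double series the binomial coefficient \<open>(m + k) choose m\<close> contributes at most
     \<open>2 ^ (m + k)\<close>, so below this radius it is dominated by a product of two geometric series.\<close>
  define r where "r = 1 / (2 * K * H)"
  have KH1: "K * H \<ge> 1" using KH mult_mono[of 1 K 1 H] by simp
  have r: "r > 0" "r \<le> 1 / 2" using KH KH1 by (auto simp: r_def field_simps)
  have "hyp2F1 a b c z = (1 - z) powr (- a) * hyp2F1 a (c - b) c (z / (z - 1))" if z: "norm z <
      r" for z
  proof -
    have z1: "norm z < 1" "z \<noteq> 1" using z r by auto
    define h where "h m = pochhammer (c - b) m / pochhammer c m" for m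
    define T where "T = (\<lambda>(m, k). pochhammer a (m + k) / (fact m * fact k) * (- 1) ^ m * h m * z
        ^ (m + k))"
    have T_bound: "norm (T (m, k)) \<le> (2 * K * H * norm z) ^ m * (2 * K * norm z) ^ k" for m k
    proof -
      have binom: "(fact (m + k) :: complex) / (fact m * fact k) = of_nat ((m + k) choose m)"
        by (subst binomial_fact) auto
      have "T (m, k) = of_nat ((m + k) choose m) * (pochhammer a (m + k) / fact (m + k)) * (- 1)
          ^ m * h m * z ^ (m + k)"
        by (simp add: T_def flip: binom)
      then have "norm (T (m, k)) = real ((m + k) choose m) * norm (pochhammer a (m + k) / fact
          (m + k)) * norm (h m) * norm z ^ (m + k)"
        by (simp only: norm_mult norm_power norm_minus_cancel norm_one power_one mult_1_right
            norm_of_nat)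
      also have "\<dots> \<le> 2 ^ (m + k) * K ^ (m + k) * H ^ m * norm z ^ (m + k)"
      proof (intro mult_mono)
        have "real ((m + k) choose m) \<le> real (2 ^ (m + k))"
          by (rule of_nat_mono[OF binomial_le_pow2])
        then show "real ((m + k) choose m) \<le> 2 ^ (m + k)" by simp
        show "norm (pochhammer a (m + k) / fact (m + k)) \<le> K ^ (m + k)"
          unfolding K_def by (rule norm_pochhammer_fact_le)
        show "norm (h m) \<le> H ^ m"
          unfolding H_def h_def by (rule norm_pochhammer_ratio_le[OF c])
      qed (use KH in auto)
      also have "\<dots> = (2 * K * H * norm z) ^ m * (2 * K * norm z) ^ k"
        by (simp add: power_add power_mult_distrib)
      finally show ?thesis .
    qed
    have x1: "2 * K * H * norm z < 1" using z KH by (simp add: r_def field_simps)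
    have "2 * K * norm z * 1 \<le> 2 * K * norm z * H" using KH by (intro mult_left_mono) auto
    then have x2: "2 * K * norm z < 1" using x1 by (simp add: mult_ac)
    have summ: "T summable_on UNIV"
    proof (rule abs_summable_summable)
      have "(\<lambda>(m, k). (2 * K * H * norm z) ^ m * (2 * K * norm z) ^ k) summable_on UNIV"
        using x1 x2 KH by (intro summable_on_times_nat summable_geometric) auto
      then show "(\<lambda>x. norm (T x)) summable_on UNIV"
        by (rule Infinite_Sum.summable_on_comparison_test) (use T_bound in auto)
    qed
    have inner: "((\<lambda>k. T (m, k)) has_sum (1 - z) powr (- a) * (hyp_coeff a (c - b) c m * (z / (z
        - 1)) ^ m)) UNIV" for m
    proof -
      have "(\<lambda>k. pochhammer (a + of_nat m) k / fact k * z ^ k) sums (1 - z) powr (- (a + of_nat m))"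
        using cut_plane_extension_binomial[of "a + of_nat m"] z1 unfolding
            cut_plane_extension_def by blast
      moreover have "summable (\<lambda>k. norm (pochhammer (a + of_nat m) k / fact k * z ^ k))"
        by (rule cut_plane_extension_norm_summable[OF cut_plane_extension_binomial z1(1)])
      ultimately have "((\<lambda>k. pochhammer (a + of_nat m) k / fact k * z ^ k) has_sum (1 - z) powr
          (- (a + of_nat m))) UNIV"
        by (intro norm_summable_imp_has_sum)
      then have "((\<lambda>k. pochhammer a m / fact m * (- 1) ^ m * h m * z ^ m * (pochhammer (a +
          of_nat m) k / fact k * z ^ k))
           has_sum pochhammer a m / fact m * (- 1) ^ m * h m * z ^ m * (1 - z) powr (- (a +
               of_nat m))) UNIV"
        by (rule has_sum_cmult_right)
      also have "(\<lambda>k. pochhammer a m / fact m * (- 1) ^ m * h m * z ^ m * (pochhammer (a +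
          of_nat m) k / fact k * z ^ k)) = (\<lambda>k. T (m, k))"
        by (auto simp: T_def pochhammer_product' power_add fun_eq_iff)
      also have "pochhammer a m / fact m * (- 1) ^ m * h m * z ^ m * (1 - z) powr (- (a + of_nat
          m)) =
          (1 - z) powr (- a) * (hyp_coeff a (c - b) c m * (z / (z - 1)) ^ m)"
      proof -
        have "z / (z - 1) = (- z) / (1 - z)" by (metis minus_diff_eq minus_divide_divide
            minus_minus)
        then have "z / (z - 1) = (- 1) * z / (1 - z)" by (simp only: mult_minus1)
        then have "(z / (z - 1)) ^ m = (- 1) ^ m * z ^ m / (1 - z) ^ m"
          by (simp only: power_divide power_mult_distrib)
        moreover have "(1 - z) powr (- (a + of_nat m)) = (1 - z) powr (- a) / (1 - z) ^ m"
          using powr_diff_nat[of "1 - z" a m] z1 by simp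
        ultimately show ?thesis by (simp add: hyp_coeff_def h_def mult_ac)
      qed
      finally show ?thesis .
    qed
    have zz: "norm (z / (z - 1)) < 1"
    proof -
      have "norm (z - 1) \<ge> 1 - norm z" using norm_triangle_ineq2[of 1 z] by (simp add:
          norm_minus_commute)
      then have "norm z < norm (z - 1)" using z r by linarith
      then show ?thesis using z1 by (simp add: norm_divide)
    qed
    have "((\<lambda>m. (1 - z) powr (- a) * (hyp_coeff a (c - b) c m * (z / (z - 1)) ^ m)) has_sum
        (1 - z) powr (- a) * hyp2F1 a (c - b) c (z / (z - 1))) UNIV"
      using hyp2F1_sums[OF c zz] cut_plane_extension_norm_summable[OF
          cut_plane_extension_hyp2F1[OF c] zz]
      by (intro has_sum_cmult_right norm_summable_imp_has_sum)
    then have sum1: "(T has_sum (1 - z) powr (- a) * hyp2F1 a (c - b) c (z / (z - 1))) (UNIV \<times>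
        UNIV)"
      using summ by (intro has_sum_SigmaI[OF inner]) auto
    also have "?this \<longleftrightarrow> ((\<lambda>(n, m). T (m, n - m)) has_sum (1 - z) powr (- a) * hyp2F1 a (c - b) c
        (z / (z - 1))) (SIGMA n:UNIV. {..n})"
      by (rule has_sum_reindex_bij_witness[of _ "\<lambda>(n, m). (m, n - m)" "\<lambda>(m, k). (m + k, m)"]) auto
    finally have "((\<lambda>n. hyp_coeff a b c n * z ^ n) has_sum (1 - z) powr (- a) * hyp2F1 a (c - b)
        c (z / (z - 1))) UNIV"
    proof (rule has_sum_SigmaD)
      fix n
      have "(\<Sum>m\<le>n. T (m, n - m)) =
          (\<Sum>m\<le>n. pochhammer a n / (fact m * fact (n - m)) * (- 1) ^ m * (pochhammer (c - b) m /
              pochhammer c m)) * z ^ n"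
        unfolding sum_distrib_right by (intro sum.cong) (auto simp: T_def h_def)
      also have "\<dots> = hyp_coeff a b c n * z ^ n" unfolding pochhammer_binomial_transform[OF c] ..
      finally show "((\<lambda>m. case (n, m) of (n, m) \<Rightarrow> T (m, n - m)) has_sum hyp_coeff a b c n * z ^
          n) {..n}"
        by (intro has_sum_finiteI) auto
    qed
    then show ?thesis using hyp2F1_sums[OF c z1(1)] has_sum_imp_sums sums_unique2 by blast
  qed
  then show ?thesis using that r by blast
qed

text \<open>On the half plane \<open>Re z < 1/2\<close> the point \<open>z / (z - 1)\<close> lies in the unit disc, so both
    sides are
  holomorphic there and the local identity propagates.\<close>

lemma hyp2F1_pfaff:
  assumes c: "Re c > 0" and z: "Re z < 1/2"
  shows "hyp2F1 a b c z = (1 - z) powr (- a) * hyp2F1 a (c - b) c (z / (z - 1))"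
proof -
  obtain r where r: "r > 0" "r \<le> 1/2"
    "\<And>z. norm z < r \<Longrightarrow> hyp2F1 a b c z = (1 - z) powr (- a) * hyp2F1 a (c - b) c (z / (z - 1))"
    using hyp2F1_pfaff_near_0[OF c, of a b] by metis
  define S where "S = {z. Re z < 1/2}"
  have S_cut: "w \<in> cut_plane" if "w \<in> S" for w
    using that by (auto simp: S_def cut_plane_def)
  have S_ball: "norm (w / (w - 1)) < 1" if "w \<in> S" for w
  proof -
    have "(norm w)\<^sup>2 < (norm (w - 1))\<^sup>2"
      using that unfolding cmod_power2 by (simp add: S_def power2_eq_square algebra_simps)
    then have "norm w < norm (w - 1)" by (rule power2_less_imp_less) simp
    moreover have "w \<noteq> 1" using that by (auto simp: S_def)
    ultimately show ?thesis by (simp add: norm_divide)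
  qed
  show ?thesis
  proof (rule analytic_continuation_open[where s = "ball 0 r" and s' = S and f = "hyp2F1 a b c"
        and g = "\<lambda>z. (1 - z) powr (- a) * hyp2F1 a (c - b) c (z / (z - 1))"])
    show "open S" "connected S" unfolding S_def
      by (rule open_halfspace_Re_lt, rule convex_connected[OF convex_halfspace_Re_lt])
    show "ball 0 r \<subseteq> S"
    proof
      fix w :: complex assume "w \<in> ball 0 r"
      then have "Re w < 1/2" using r(2) abs_Re_le_cmod[of w] by simp
      then show "w \<in> S" by (simp add: S_def)
    qed
    show "hyp2F1 a b c holomorphic_on S"
      using hyp2F1_holomorphic[OF c] by (rule holomorphic_on_subset) (use S_cut in auto)
    have "(\<lambda>z. z / (z - 1)) holomorphic_on S"
      by (intro holomorphic_intros) (auto simp: S_def)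
    moreover have "(\<lambda>z. z / (z - 1)) ` S \<subseteq> cut_plane"
      using S_ball unit_ball_subset_cut_plane by (force simp: subset_iff)
    ultimately have "(\<lambda>z. hyp2F1 a (c - b) c (z / (z - 1))) holomorphic_on S"
      using holomorphic_on_compose_gen[OF _ hyp2F1_holomorphic[OF c], unfolded o_def] by blast
    moreover have "1 - w \<notin> \<real>\<^sub>\<le>\<^sub>0" if "w \<in> S" for w
      using that by (auto simp: S_def complex_nonpos_Reals_iff)
    ultimately show "(\<lambda>z. (1 - z) powr (- a) * hyp2F1 a (c - b) c (z / (z - 1))) holomorphic_on S"
      by (intro holomorphic_intros) auto
  qed (use r z in \<open>auto simp: S_def\<close>)
qed

text \<open>The instance \<open>z = 1 - 1/s\<close>, where \<open>z / (z - 1) = 1 - s\<close>: it rewrites a Gauss function on the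
  negative axis by its series on the unit interval.\<close>

lemma hyp2F1_pfaff_real:
  assumes c: "Re c > 0" and s: "0 < s" "s < (1::real)"
  shows "hyp2F1 a b c (of_real (1 - 1 / s)) = of_real s powr a * hyp2F1 a (c - b) c (of_real (1
      - s))"
proof -
  define z where "z = complex_of_real (1 - 1 / s)"
  have "Re z < 1/2" using s by (simp add: z_def field_simps)
  from hyp2F1_pfaff[OF c this, of a b] have "hyp2F1 a b c z = (1 - z) powr (- a) * hyp2F1 a (c -
      b) c (z / (z - 1))" .
  moreover have "1 - z = of_real (inverse s)" by (simp add: z_def inverse_eq_divide)
  moreover have "complex_of_real (inverse s) powr (- a) = of_real s powr a"
    using s by (simp add: powr_def Ln_of_real ln_inverse del: of_real_inverse)
  moreover have "z / (z - 1) = of_real (1 - s)"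
  proof -
    have "z / (z - 1) = of_real ((1 - 1 / s) / ((1 - 1 / s) - 1))" by (simp add: z_def)
    also have "(1 - 1 / s) / ((1 - 1 / s) - 1) = 1 - s" using s by (simp add: field_simps)
    finally show ?thesis .
  qed
  ultimately show ?thesis unfolding z_def by (simp only:)
qed

section \<open>Gauss's summation theorem\<close>

lemma norm_exp_times_ln: "n > 0 \<Longrightarrow> norm (exp (z * of_real (ln (real n)))) = real n powr Re z"
  by (simp add: powr_def)

text \<open>The growth of Pochhammer symbols is read off from the convergence of Gauss's product for
  the reciprocal Gamma function.\<close>

lemma pochhammer_Suc_bound:
  obtains C :: real where "C > 0" "\<And>n. n > 0 \<Longrightarrow> norm (pochhammer z (Suc n) :: complex) \<le> C * fact
      n * real n powr Re z"
proof -
  have "Bseq (rGamma_series z)"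
    using rGamma_series_LIMSEQ[of z] by (intro convergent_imp_Bseq convergentI)
  then obtain C where C: "C > 0" "\<And>n. norm (rGamma_series z n) \<le> C" by (auto elim!: BseqE)
  have "norm (pochhammer z (Suc n)) \<le> C * fact n * real n powr Re z" if n: "n > 0" for n
  proof -
    have "norm (rGamma_series z n) = norm (pochhammer z (Suc n)) / (fact n * real n powr Re z)"
      using norm_exp_times_ln[OF n, of z] by (simp add: rGamma_series_def norm_divide norm_mult)
    then have "norm (pochhammer z (Suc n)) / (fact n * real n powr Re z) \<le> C" using C(2)[of n]
        by simp
    moreover have "fact n * real n powr Re z > 0" using n by simp
    ultimately show ?thesis by (simp add: pos_divide_le_eq mult_ac)
  qed
  then show ?thesis using C(1) that by blast
qed

lemma pochhammer_Suc_lower_bound: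
  fixes r :: real
  assumes r: "r > 0"
  obtains C :: real where "C > 0" "\<And>n. n > 0 \<Longrightarrow> fact n * real n powr r \<le> C * pochhammer r (Suc n)"
proof -
  have "Bseq (Gamma_series r)"
    using Gamma_series_LIMSEQ[of r] by (intro convergent_imp_Bseq convergentI)
  then obtain C where C: "C > 0" "\<And>n. norm (Gamma_series r n) \<le> C" by (auto elim!: BseqE)
  have "fact n * real n powr r \<le> C * pochhammer r (Suc n)" if n: "n > 0" for n
  proof -
    have p: "pochhammer r (Suc n) > 0" using r by (rule pochhammer_pos)
    have "Gamma_series r n = fact n * real n powr r / pochhammer r (Suc n)"
      using n by (simp add: Gamma_series_def powr_def)
    then have "fact n * real n powr r / pochhammer r (Suc n) \<le> C"
      using C(2)[of n] abs_of_pos[OF p] by simp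
    then show ?thesis using p by (simp add: pos_divide_le_eq)
  qed
  then show ?thesis using C(1) that by blast
qed

text \<open>Bounds the Gauss coefficients with lower parameter \<open>c\<close> for \<open>r = Re c > 0\<close>, because \<open>(Re
    c)_m\<close> is
  at most the absolute value of \<open>(c)_m\<close>; unlike the latter it can be compared for different \<open>r\<close>.\<close>

definition gauss_majorant :: "complex \<Rightarrow> complex \<Rightarrow> real \<Rightarrow> nat \<Rightarrow> real" where
  "gauss_majorant a b r m = norm (pochhammer a m) * norm (pochhammer b m) / (pochhammer r m *
      fact m)"

lemma gauss_majorant_nonneg: "r > 0 \<Longrightarrow> gauss_majorant a b r m \<ge> 0"
  unfolding gauss_majorant_def using pochhammer_pos[of r m] by (intro divide_nonneg_nonneg
      mult_nonneg_nonneg) auto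

lemma gauss_majorant_bound:
  assumes r: "r > 0"
  obtains C :: real where "C \<ge> 0" "\<And>n. n > 0 \<Longrightarrow> gauss_majorant a b r (Suc n) \<le> C * real n powr
      (Re a + Re b - r - 1)"
proof -
  obtain A where A: "A > 0" "\<And>n. n > 0 \<Longrightarrow> norm (pochhammer a (Suc n)) \<le> A * fact n * real n powr
      Re a"
    using pochhammer_Suc_bound[of a] by metis
  obtain B where B: "B > 0" "\<And>n. n > 0 \<Longrightarrow> norm (pochhammer b (Suc n)) \<le> B * fact n * real n powr
      Re b"
    using pochhammer_Suc_bound[of b] by metis
  obtain R where R: "R > 0" "\<And>n. n > 0 \<Longrightarrow> fact n * real n powr r \<le> R * pochhammer r (Suc n)"
    using pochhammer_Suc_lower_bound[OF r] by metis
  have "gauss_majorant a b r (Suc n) \<le> A * B * R * real n powr (Re a + Re b - r - 1)" if n: "n >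
      0" for n
  proof -
    have pr: "pochhammer r (Suc n) > 0" using r by (rule pochhammer_pos)
    have Pos: "fact n * real n powr r > 0" using n by simp
    have "gauss_majorant a b r (Suc n) \<le> (A * fact n * real n powr Re a) * (B * fact n * real n
        powr Re b) / (pochhammer r (Suc n) * fact (Suc n))"
      unfolding gauss_majorant_def using A B n pr by (intro divide_right_mono mult_mono) auto
    also have "\<dots> \<le> (A * fact n * real n powr Re a) * (B * fact n * real n powr Re b) / ((fact n
        * real n powr r) / R * (fact n * real n))"
    proof (rule divide_left_mono)
      have "fact n * real n powr r / R \<le> pochhammer r (Suc n)"
        using R n by (simp add: pos_divide_le_eq mult.commute)
      moreover have "fact n * real n \<le> (fact (Suc n) :: real)" by (simp add: algebra_simps)
      ultimately show "(fact n * real n powr r) / R * (fact n * real n) \<le> pochhammer r (Suc n) *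
          fact (Suc n)"
        using pr by (intro mult_mono) auto
    qed (use A B R n pr in auto)
    also have "\<dots> = A * B * R * (real n powr Re a * real n powr Re b / (real n powr r * real n
        powr 1))"
      using n by simp
    also have "real n powr Re a * real n powr Re b / (real n powr r * real n powr 1) = real n
        powr (Re a + Re b - r - 1)"
      by (simp only: powr_add powr_diff divide_divide_eq_left)
    finally show ?thesis .
  qed
  then show ?thesis using A(1) B(1) R(1) that[of "A * B * R"] by auto
qed

text \<open>The terms are of order \<open>n powr (Re a + Re b - r - 1)\<close>.\<close>

lemma summable_gauss_majorant:
  assumes r: "r > 0" "r > Re a + Re b"
  shows "summable (gauss_majorant a b r)"
proof -
  obtain C where C: "C \<ge> 0" "\<And>n. n > 0 \<Longrightarrow> gauss_majorant a b r (Suc n) \<le> C * real n powr (Re a +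
      Re b - r - 1)"
    using gauss_majorant_bound[OF r(1)] by metis
  have "summable (\<lambda>n. gauss_majorant a b r (Suc n))"
  proof (rule summable_comparison_test'[where N = 1])
    show "summable (\<lambda>n. C * real n powr (Re a + Re b - r - 1))"
      using r by (intro summable_mult) (simp add: summable_real_powr_iff)
    show "norm (gauss_majorant a b r (Suc n)) \<le> C * real n powr (Re a + Re b - r - 1)" if "n \<ge>
        1" for n
      using C(2)[of n] that gauss_majorant_nonneg[OF r(1), of a b "Suc n"] by simp
  qed
  then show ?thesis by (simp only: summable_Suc_iff)
qed

lemma gauss_majorant_times_n:
  assumes r: "r > 0" "r > Re a + Re b"
  shows "(\<lambda>n. real n * gauss_majorant a b r n) \<longlonglongrightarrow> 0"
proof -
  obtain C where C: "C \<ge> 0" "\<And>n. n > 0 \<Longrightarrow> gauss_majorant a b r (Suc n) \<le> C * real n powr (Re a +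
      Re b - r - 1)"
    using gauss_majorant_bound[OF r(1)] by metis
  have "(\<lambda>n. real (Suc n) * gauss_majorant a b r (Suc n)) \<longlonglongrightarrow> 0"
  proof (rule tendsto_sandwich[where f = "\<lambda>_. 0" and h = "\<lambda>n. 2 * C * real n powr (Re a + Re b -
      r)"])
    show "\<forall>\<^sub>F n in sequentially. 0 \<le> real (Suc n) * gauss_majorant a b r (Suc n)"
      using gauss_majorant_nonneg[OF r(1)] by (intro always_eventually allI mult_nonneg_nonneg) auto
    show "\<forall>\<^sub>F n in sequentially. real (Suc n) * gauss_majorant a b r (Suc n) \<le> 2 * C * real n
        powr (Re a + Re b - r)"
      using eventually_gt_at_top[of 0]
    proof eventually_elim
      case (elim n)
      have "real (Suc n) * gauss_majorant a b r (Suc n) \<le> (2 * real n) * (C * real n powr (Re a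
          + Re b - r - 1))"
        using elim C gauss_majorant_nonneg[OF r(1)] by (intro mult_mono C(2)) auto
      also have "\<dots> = 2 * C * (real n powr 1 * real n powr (Re a + Re b - r - 1))" using elim by simp
      also have "\<dots> = 2 * C * real n powr (Re a + Re b - r)" by (simp only: powr_add[symmetric])
          (simp add: algebra_simps)
      finally show ?case .
    qed
    have "(\<lambda>n. real n powr (Re a + Re b - r)) \<longlonglongrightarrow> 0"
      using r by (intro tendsto_neg_powr filterlim_real_sequentially) auto
    from tendsto_mult_left[OF this, of "2 * C"] show "(\<lambda>n. 2 * C * real n powr (Re a + Re b -
        r)) \<longlonglongrightarrow> 0" by simp
  qed auto
  then show ?thesis by (rule LIMSEQ_imp_Suc)
qed

lemma pochhammer_Re_le_norm:
  assumes "Re c > 0"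
  shows "pochhammer (Re c) m \<le> norm (pochhammer c m)"
proof (induction m)
  case (Suc m)
  have "Re c + real m \<le> norm (c + of_nat m)" using complex_Re_le_cmod[of "c + of_nat m"] by simp
  then show ?case using Suc assms pochhammer_pos[of "Re c" m]
    by (auto simp: pochhammer_Suc norm_mult intro!: mult_mono)
qed auto

lemma norm_hyp_coeff_le:
  assumes "Re c > 0"
  shows "norm (hyp_coeff a b c m) \<le> gauss_majorant a b (Re c) m"
  unfolding hyp_coeff_def gauss_majorant_def norm_divide norm_mult
  using assms pochhammer_Re_le_norm[OF assms, of m] pochhammer_pos[of "Re c" m]
      pochhammer_nonzero[OF assms, of m]
  by (intro divide_left_mono) (auto intro!: mult_pos_pos)

lemma summable_hyp_coeff:
  assumes "Re c > 0" "Re c > Re a + Re b"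
  shows "summable (hyp_coeff a b c)"
  by (rule summable_comparison_test'[OF summable_gauss_majorant[OF assms]]) (rule
      norm_hyp_coeff_le[OF assms(1)])

lemma hyp_coeff_plus1:
  assumes "Re c > 0"
  shows "(c + of_nat m) * hyp_coeff a b (c + 1) m = c * hyp_coeff a b c m"
proof -
  have "pochhammer c m * (c + of_nat m) = c * pochhammer (c + 1) m"
    by (metis pochhammer_Suc pochhammer_rec)
  moreover have "pochhammer c m \<noteq> 0" "pochhammer (c + 1) m \<noteq> 0" using assms by (auto intro!:
      pochhammer_nonzero)
  ultimately show ?thesis by (simp add: hyp_coeff_def frac_eq_eq mult_ac)
qed

lemma hyp_coeff_Suc:
  assumes "Re c > 0"
  shows "of_nat (Suc m) * (c + of_nat m) * hyp_coeff a b c (Suc m) = (a + of_nat m) * (b +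
      of_nat m) * hyp_coeff a b c m"
proof -
  have "Re (c + of_nat m) > 0" using assms by simp
  then have "c + of_nat m \<noteq> 0" by (metis less_irrefl zero_complex.simps(1))
  moreover have "pochhammer c m \<noteq> 0" by (rule pochhammer_nonzero[OF assms])
  moreover have "of_nat (Suc m) \<noteq> (0::complex)" by (rule of_nat_neq_0)
  ultimately show ?thesis by (simp add: hyp_coeff_def pochhammer_Suc del: of_nat_Suc)
qed

text \<open>The difference of the two sides telescopes termwise, with potential \<open>- c * m * t m\<close>; the
  potential vanishes at infinity because \<open>Re (c - a - b) > 0\<close>.\<close>

lemma hyp_coeff_sum_contiguous:
  assumes c: "Re c > 0" "Re c > Re a + Re b"
  shows "c * (c - a - b) * (\<Sum>m. hyp_coeff a b c m) = (c - a) * (c - b) * (\<Sum>m. hyp_coeff a b (c +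
      1) m)"
proof -
  define t where "t = hyp_coeff a b c"
  define t' where "t' = hyp_coeff a b (c + 1)"
  define U where "U m = - c * (of_nat m * t m)" for m
  have "c * (c - a - b) * t m - (c - a) * (c - b) * t' m = U (Suc m) - U m" for m
  proof -
    have nz: "c + of_nat m \<noteq> 0" using c by (auto simp: complex_eq_iff)
    have 1: "(c + of_nat m) * t' m = c * t m" unfolding t_def t'_def by (rule hyp_coeff_plus1[OF
        c(1)])
    have 2: "of_nat (Suc m) * (c + of_nat m) * t (Suc m) = (a + of_nat m) * (b + of_nat m) * t m"
      unfolding t_def by (rule hyp_coeff_Suc[OF c(1)])
    have "(c + of_nat m) * (c * (c - a - b) * t m - (c - a) * (c - b) * t' m) =
        c * (c - a - b) * (c + of_nat m) * t m - (c - a) * (c - b) * ((c + of_nat m) * t' m)"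
      by (simp only: algebra_simps)
    also have "\<dots> = - c * ((a + of_nat m) * (b + of_nat m) * t m) + c * of_nat m * (c + of_nat m)
        * t m"
      unfolding 1 by (simp add: algebra_simps)
    also have "\<dots> = (c + of_nat m) * (U (Suc m) - U m)"
      unfolding 2[symmetric] U_def by (simp add: algebra_simps)
    finally show ?thesis using nz by (simp only: mult_cancel_left) simp
  qed
  moreover have "(\<lambda>m. U (Suc m) - U m) sums (0 - U 0)"
  proof (rule telescope_sums)
    have "(\<lambda>n. real n * norm (t n)) \<longlonglongrightarrow> 0"
    proof (rule tendsto_sandwich[OF _ _ tendsto_const gauss_majorant_times_n[OF c]])
      show "\<forall>\<^sub>F n in sequentially. 0 \<le> real n * norm (t n)" by simp
      show "\<forall>\<^sub>F n in sequentially. real n * norm (t n) \<le> real n * gauss_majorant a b (Re c) n"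
        unfolding t_def by (intro always_eventually allI mult_left_mono norm_hyp_coeff_le c) auto
    qed
    then have "(\<lambda>n. of_nat n * t n) \<longlonglongrightarrow> 0"
      by (subst tendsto_norm_zero_iff[symmetric]) (simp add: norm_mult)
    from tendsto_mult_left[OF this, of "- c"] have "(\<lambda>n. - c * (of_nat n * t n)) \<longlonglongrightarrow> 0" by simp
    then show "U \<longlonglongrightarrow> 0" unfolding U_def .
  qed
  ultimately have "(\<lambda>m. c * (c - a - b) * t m - (c - a) * (c - b) * t' m) sums 0"
    by (simp add: U_def)
  moreover have "(\<lambda>m. c * (c - a - b) * t m - (c - a) * (c - b) * t' m) sums
      (c * (c - a - b) * (\<Sum>m. t m) - (c - a) * (c - b) * (\<Sum>m. t' m))"
    unfolding t_def t'_def using c by (intro sums_diff sums_mult summable_sums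
        summable_hyp_coeff) auto
  ultimately show ?thesis unfolding t_def t'_def using sums_unique2 by fastforce
qed

lemma hyp_coeff_sum_shift:
  assumes c: "Re c > 0" "Re c > Re a + Re b"
  shows "pochhammer c n * pochhammer (c - a - b) n * (\<Sum>m. hyp_coeff a b c m)
     = pochhammer (c - a) n * pochhammer (c - b) n * (\<Sum>m. hyp_coeff a b (c + of_nat n) m)"
proof (induction n)
  case (Suc n)
  have "(c + of_nat n) * (c + of_nat n - a - b) * (\<Sum>m. hyp_coeff a b (c + of_nat n) m) =
     (c + of_nat n - a) * (c + of_nat n - b) * (\<Sum>m. hyp_coeff a b (c + of_nat n + 1) m)"
    using c by (intro hyp_coeff_sum_contiguous) auto
  then have S: "(c + of_nat n) * (c - a - b + of_nat n) * (\<Sum>m. hyp_coeff a b (c + of_nat n) m) =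
     (c - a + of_nat n) * (c - b + of_nat n) * (\<Sum>m. hyp_coeff a b (c + of_nat (Suc n)) m)"
    by (simp add: algebra_simps)
  have "pochhammer c (Suc n) * pochhammer (c - a - b) (Suc n) * (\<Sum>m. hyp_coeff a b c m) =
     (c + of_nat n) * (c - a - b + of_nat n) * (pochhammer c n * pochhammer (c - a - b) n * (\<Sum>m.
         hyp_coeff a b c m))"
    by (simp only: pochhammer_Suc mult_ac)
  also have "\<dots> = pochhammer (c - a) n * pochhammer (c - b) n *
      ((c + of_nat n) * (c - a - b + of_nat n) * (\<Sum>m. hyp_coeff a b (c + of_nat n) m))"
    unfolding Suc by (simp only: mult_ac)
  also have "\<dots> = pochhammer (c - a) (Suc n) * pochhammer (c - b) (Suc n) * (\<Sum>m. hyp_coeff a b (c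
      + of_nat (Suc n)) m)"
    unfolding S by (simp only: pochhammer_Suc mult_ac)
  finally show ?case .
qed simp

text \<open>All terms but the first are at most \<open>r / (r + n)\<close> times those of a fixed convergent series,
  where \<open>r = Re c\<close>.\<close>

lemma hyp_coeff_sum_shift_LIMSEQ:
  assumes c: "Re c > 0" "Re c > Re a + Re b"
  shows "(\<lambda>n. \<Sum>m. hyp_coeff a b (c + of_nat n) m) \<longlonglongrightarrow> 1"
proof -
  define r where "r = Re c"
  have r: "r > 0" "r > Re a + Re b" using c by (simp_all add: r_def)
  define C where "C = (\<Sum>m. gauss_majorant a b r (Suc m))"
  have sumC: "summable (\<lambda>m. gauss_majorant a b r (Suc m))"
    using summable_gauss_majorant[OF r] by (simp only: summable_Suc_iff)
  have bd: "norm ((\<Sum>m. hyp_coeff a b (c + of_nat n) m) - 1) \<le> r * C / (r + real n)" for n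
  proof -
    have cn: "Re (c + of_nat n) > 0" "Re (c + of_nat n) > Re a + Re b" using c by auto
    have poch: "(r + real n) / r * pochhammer r (Suc m) \<le> pochhammer (r + real n) (Suc m)" for m
    proof (induction m)
      case 0
      then show ?case using r by simp
    next
      case (Suc m)
      have "(r + real n) / r * pochhammer r (Suc m) * (r + real (Suc m)) \<le> pochhammer (r + real
          n) (Suc m) * (r + real n + real (Suc m))"
        using r pochhammer_pos[of r "Suc m"] pochhammer_pos[of "r + real n" "Suc m"] by (intro
            mult_mono Suc) auto
      then show ?case by (subst (1 2) pochhammer_Suc) (simp add: mult_ac)
    qed
    have term_bd: "norm (hyp_coeff a b (c + of_nat n) (Suc m)) \<le> r / (r + real n) *
        gauss_majorant a b r (Suc m)" for m
    proof -
      have "norm (hyp_coeff a b (c + of_nat n) (Suc m)) \<le> gauss_majorant a b (r + real n) (Suc m)"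
        using norm_hyp_coeff_le[OF cn(1), of a b "Suc m"] by (simp add: r_def)
      also have "\<dots> \<le> norm (pochhammer a (Suc m)) * norm (pochhammer b (Suc m)) / ((r + real n) /
          r * pochhammer r (Suc m) * fact (Suc m))"
        unfolding gauss_majorant_def using poch[of m] r pochhammer_pos[of r "Suc m"]
            pochhammer_pos[of "r + real n" "Suc m"]
        by (intro divide_left_mono mult_right_mono) (auto intro!: mult_pos_pos divide_pos_pos
            add_pos_nonneg)
      also have "\<dots> = r / (r + real n) * gauss_majorant a b r (Suc m)"
        using r unfolding gauss_majorant_def by (simp add: divide_simps)
      finally show ?thesis .
    qed
    have "(\<Sum>m. hyp_coeff a b (c + of_nat n) m) = hyp_coeff a b (c + of_nat n) 0 + (\<Sum>m. hyp_coeff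
        a b (c + of_nat n) (Suc m))"
      using suminf_split_head[OF summable_hyp_coeff[OF cn]] by (simp add: algebra_simps)
    then have "(\<Sum>m. hyp_coeff a b (c + of_nat n) m) - 1 = (\<Sum>m. hyp_coeff a b (c + of_nat n) (Suc
        m))"
      by (simp add: hyp_coeff_def)
    also have "norm \<dots> \<le> (\<Sum>m. r / (r + real n) * gauss_majorant a b r (Suc m))"
      by (rule norm_suminf_le[OF term_bd summable_mult[OF sumC]])
    also have "\<dots> = r * C / (r + real n)"
      unfolding C_def by (subst suminf_mult[OF sumC]) simp
    finally show ?thesis .
  qed
  have "(\<lambda>n. r * C / (r + real n)) \<longlonglongrightarrow> 0"
    by (rule real_tendsto_divide_at_top[OF tendsto_const
          filterlim_tendsto_add_at_top[OF tendsto_const filterlim_real_sequentially]])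
  then have "(\<lambda>n. (\<Sum>m. hyp_coeff a b (c + of_nat n) m) - 1) \<longlonglongrightarrow> 0"
    by (rule Lim_null_comparison[rotated]) (use bd in auto)
  then show ?thesis by (simp add: LIM_zero_iff)
qed

text \<open>Iterating the contiguous relation moves the sum to \<open>c + n\<close>, where it tends to 1, and leaves a
  quotient of Pochhammer symbols whose limit is Gauss's product for the four Gamma factors; the
  powers of \<open>n\<close> cancel because \<open>c + (c - a - b) = (c - a) + (c - b)\<close>.\<close>

theorem gauss_sum:
  assumes c: "Re c > 0" "Re c > Re a + Re b"
  shows "hyp_coeff a b c sums (Gamma c * Gamma (c - a - b) * rGamma (c - a) * rGamma (c - b))"
proof -
  define S where "S = (\<Sum>m. hyp_coeff a b c m)"
  have "rGamma_series c n * rGamma_series (c - a - b) n * S =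
        rGamma_series (c - a) n * rGamma_series (c - b) n * (\<Sum>m. hyp_coeff a b (c + of_nat (Suc
            n)) m)" for n
  proof -
    define L where "L = complex_of_real (ln (real n))"
    have "exp (c * L) * exp ((c - a - b) * L) = exp ((c - a) * L) * exp ((c - b) * L)"
      unfolding exp_add[symmetric] by (simp add: algebra_simps)
    then have E: "(fact n * exp (c * L)) * (fact n * exp ((c - a - b) * L)) = (fact n * exp ((c
        - a) * L)) * (fact n * exp ((c - b) * L))"
      by (simp only: mult_ac)
    have "rGamma_series c n * rGamma_series (c - a - b) n * S =
       pochhammer c (Suc n) * pochhammer (c - a - b) (Suc n) * S / ((fact n * exp (c * L)) *
           (fact n * exp ((c - a - b) * L)))"
      unfolding rGamma_series_def L_def Suc_eq_plus1
      by (simp only: times_divide_eq_left times_divide_eq_right divide_divide_eq_left mult_ac)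
    also have "\<dots> = pochhammer (c - a) (Suc n) * pochhammer (c - b) (Suc n) * (\<Sum>m. hyp_coeff a b
        (c + of_nat (Suc n)) m) /
        ((fact n * exp ((c - a) * L)) * (fact n * exp ((c - b) * L)))"
      unfolding E S_def hyp_coeff_sum_shift[OF c] ..
    also have "\<dots> = rGamma_series (c - a) n * rGamma_series (c - b) n * (\<Sum>m. hyp_coeff a b (c +
        of_nat (Suc n)) m)"
      unfolding rGamma_series_def L_def Suc_eq_plus1
      by (simp only: times_divide_eq_left times_divide_eq_right divide_divide_eq_left mult_ac)
    finally show ?thesis .
  qed
  moreover have "(\<lambda>n. rGamma_series c n * rGamma_series (c - a - b) n * S) \<longlonglongrightarrow> rGamma c * rGamma
      (c - a - b) * S"
    by (intro tendsto_intros)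
  moreover have "(\<lambda>n. rGamma_series (c - a) n * rGamma_series (c - b) n * (\<Sum>m. hyp_coeff a b (c
      + of_nat (Suc n)) m))
      \<longlonglongrightarrow> rGamma (c - a) * rGamma (c - b) * 1"
    by (intro tendsto_mult rGamma_series_LIMSEQ LIMSEQ_Suc[OF hyp_coeff_sum_shift_LIMSEQ[OF c]])
  ultimately have "rGamma c * rGamma (c - a - b) * S = rGamma (c - a) * rGamma (c - b)"
    using LIMSEQ_unique by fastforce
  moreover have "rGamma c \<noteq> 0" "rGamma (c - a - b) \<noteq> 0"
    using Re_pos_not_nonpos_Int[of c] Re_pos_not_nonpos_Int[of "c - a - b"] c by (auto simp:
        rGamma_eq_zero_iff)
  ultimately have "S = Gamma c * Gamma (c - a - b) * rGamma (c - a) * rGamma (c - b)"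
    by (simp add: Gamma_def field_simps)
  then show ?thesis using summable_sums[OF summable_hyp_coeff[OF c]] by (simp add: S_def)
qed

section \<open>Mellin transforms of kernels on the unit interval\<close>

text \<open>Absolute convergence and value of the Mellin transform in one statement. Only the values of
  the function on the open unit interval matter.\<close>

definition has_mellin :: "(real \<Rightarrow> complex) \<Rightarrow> complex \<Rightarrow> complex \<Rightarrow> bool" where
  "has_mellin k \<rho> I \<longleftrightarrow>
     has_bochner_integral lborel (\<lambda>s. indicator {0<..<1} s *\<^sub>R (of_real s powr (\<rho> - 1) * k s)) I"

text \<open>The reciprocal Gamma factor is included because it makes the Mellin transform a pure quotient
  of Gamma functions.\<close>

definition hyp_kernel :: "complex \<Rightarrow> complex \<Rightarrow> complex \<Rightarrow> complex \<Rightarrow> real \<Rightarrow> complex" where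
  "hyp_kernel a b g \<sigma> s =
     of_real s powr \<sigma> * of_real (1 - s) powr (g - 1) * rGamma g * hyp2F1 a b g (of_real (1 - s))"

text \<open>Integrating the series in \<open>1 - s\<close> term by term against the Beta weight gives a Gauss
    series at 1
  with lower parameter \<open>\<rho> + \<sigma> + g\<close>. The hypotheses ask just for the convergence of that
  series and of the Beta integrals, so the formula holds up to the first pole of its numerator.\<close>

lemma has_mellin_hyp_kernel:
  assumes g: "Re g > 0" and x: "Re (\<rho> + \<sigma>) > 0" and conv: "Re (\<rho> + \<sigma> + g - a - b) > 0"
  shows "has_mellin (hyp_kernel a b g \<sigma>) \<rho>
     (Gamma (\<rho> + \<sigma>) * Gamma (\<rho> + \<sigma> + g - a - b) * rGamma (\<rho> + \<sigma> + g - a) * rGamma (\<rho> + \<sigma> + g - b))"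
proof -
  define X where "X = \<rho> + \<sigma>"
  define T where "T m s = rGamma g * hyp_coeff a b g m * beta_weight X (g + of_nat m) s" for m s
  have X: "Re X > 0" using x by (simp add: X_def)
  have Xg: "Re (X + g) > 0" "Re (X + g) > Re a + Re b" using conv x g by (auto simp: X_def)
  have int_T: "integrable lborel (T m)" for m
    unfolding T_def using X g by (intro integrable_mult_right integrable_beta_weight) auto
  have pointwise: "summable (\<lambda>m. norm (T m s)) \<and>
      (\<Sum>m. T m s) = indicator {0<..<1} s *\<^sub>R (of_real s powr (\<rho> - 1) * hyp_kernel a b g \<sigma> s)" for s
  proof (cases "s \<in> {0<..<1}")
    case True
    have T: "T m s = rGamma g * beta_weight X g s * (hyp_coeff a b g m * of_real (1 - s) ^ m)" for m
      using beta_weight_times_power[of X g s 0 m] by (simp add: T_def mult_ac del: of_real_diff)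
    have z: "norm (complex_of_real (1 - s)) < 1" using True by (simp del: of_real_diff)
    have "summable (\<lambda>m. norm (rGamma g * beta_weight X g s) * norm (hyp_coeff a b g m * of_real
        (1 - s) ^ m))"
      by (intro summable_mult cut_plane_extension_norm_summable[OF cut_plane_extension_hyp2F1[OF
          g] z])
    moreover have "(\<lambda>m. T m s) sums (rGamma g * beta_weight X g s * hyp2F1 a b g (of_real (1 - s)))"
      unfolding T by (intro sums_mult hyp2F1_sums g z)
    moreover have "rGamma g * beta_weight X g s * hyp2F1 a b g (of_real (1 - s)) =
        indicator {0<..<1} s *\<^sub>R (of_real s powr (\<rho> - 1) * hyp_kernel a b g \<sigma> s)"
    proof -
      have "of_real s powr (X - 1) = of_real s powr (\<rho> - 1) * of_real s powr \<sigma>"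
        unfolding X_def powr_add[symmetric] by (simp add: algebra_simps)
      then show ?thesis using True by (simp add: beta_weight_def hyp_kernel_def)
    qed
    ultimately show ?thesis by (simp add: T norm_mult sums_iff)
  qed (simp add: T_def beta_weight_def)
  have bound: "(\<integral>s. norm (T m s) \<partial>lborel) \<le> norm (rGamma g) * Beta (Re X) (Re g) *
      gauss_majorant a b (Re (X + g)) m" for m
  proof -
    have nn: "Re g \<notin> \<int>\<^sub>\<le>\<^sub>0" "Re X \<notin> \<int>\<^sub>\<le>\<^sub>0" "Re X + Re g \<notin> \<int>\<^sub>\<le>\<^sub>0"
      using g X by (auto elim!: nonpos_Ints_cases)
    have pos: "pochhammer (Re g) m > 0" "pochhammer (Re X + Re g) m > 0" using g X by (auto
        intro!: pochhammer_pos)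
    have B0: "Beta (Re X) (Re g) \<ge> 0"
      using g X by (auto simp: Beta_def intro!: divide_nonneg_nonneg mult_nonneg_nonneg
          less_imp_le[OF Gamma_real_pos])
    have "(\<integral>s. norm (T m s) \<partial>lborel) = norm (rGamma g) * norm (hyp_coeff a b g m) * Beta (Re X)
        (Re g + real m)"
      using integral_norm_beta_weight[of X "g + of_nat m"] X g by (simp add: T_def norm_mult)
    also have "Beta (Re X) (Re g + real m) = Beta (Re X) (Re g) * (pochhammer (Re g) m /
        pochhammer (Re X + Re g) m)"
      using pochhammer_Gamma[OF nn(1), of m] pochhammer_Gamma[OF nn(3), of m] nn
      by (simp add: Beta_def Gamma_eq_zero_iff add_ac)
    also have "norm (rGamma g) * norm (hyp_coeff a b g m) * (Beta (Re X) (Re g) * (pochhammer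
        (Re g) m / pochhammer (Re X + Re g) m))
       \<le> norm (rGamma g) * gauss_majorant a b (Re g) m * (Beta (Re X) (Re g) * (pochhammer (Re
           g) m / pochhammer (Re X + Re g) m))"
      using B0 pos by (intro mult_right_mono mult_left_mono norm_hyp_coeff_le g) auto
    also have "\<dots> = norm (rGamma g) * Beta (Re X) (Re g) * gauss_majorant a b (Re (X + g)) m"
      using pos unfolding gauss_majorant_def by (simp add: mult_ac)
    finally show ?thesis .
  qed
  have sum_int: "summable (\<lambda>m. \<integral>s. norm (T m s) \<partial>lborel)"
    by (rule summable_comparison_test'[OF summable_mult[OF summable_gauss_majorant[OF Xg]]])
        (use bound in auto)
  have AE_summ: "AE s in lborel. summable (\<lambda>m. norm (T m s))" using pointwise by (intro AE_I2) auto
  have "integrable lborel (\<lambda>s. \<Sum>m. T m s)" and sums: "(\<lambda>m. \<integral>s. T m s \<partial>lborel) sums (\<integral>s. (\<Sum>m. T m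
      s) \<partial>lborel)"
    by (rule integrable_suminf[OF int_T AE_summ sum_int], rule sums_integral[OF int_T AE_summ
        sum_int])
  moreover have "(\<integral>s. T m s \<partial>lborel) = rGamma g * Beta X g * hyp_coeff a b (X + g) m" for m
  proof -
    have "(\<integral>s. T m s \<partial>lborel) = rGamma g * hyp_coeff a b g m * Beta X (g + of_nat m)"
      using integral_beta_weight[of X "g + of_nat m"] X g by (simp add: T_def)
    also have "Beta X (g + of_nat m) = Beta X g * (pochhammer g m / pochhammer (X + g) m)"
      using Beta_shift[of X g 0 m] X g Xg(1) Re_pos_not_nonpos_Int by simp
    also have "rGamma g * hyp_coeff a b g m * (Beta X g * (pochhammer g m / pochhammer (X + g)
        m)) = rGamma g * Beta X g * hyp_coeff a b (X + g) m"
      using pochhammer_nonzero[OF g, of m] by (simp add: hyp_coeff_def mult_ac)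
    finally show ?thesis .
  qed
  moreover have "(\<lambda>m. rGamma g * Beta X g * hyp_coeff a b (X + g) m) sums
     (rGamma g * Beta X g * (Gamma (X + g) * Gamma (X + g - a - b) * rGamma (X + g - a) * rGamma
         (X + g - b)))"
    by (intro sums_mult gauss_sum Xg)
  ultimately have "has_bochner_integral lborel (\<lambda>s. \<Sum>m. T m s)
     (rGamma g * Beta X g * (Gamma (X + g) * Gamma (X + g - a - b) * rGamma (X + g - a) * rGamma
         (X + g - b)))"
    using sums_unique2 by (simp add: has_bochner_integral_iff) blast
  moreover have "rGamma g * Beta X g * (Gamma (X + g) * Gamma (X + g - a - b) * rGamma (X + g -
      a) * rGamma (X + g - b)) =
     Gamma X * Gamma (X + g - a - b) * rGamma (X + g - a) * rGamma (X + g - b)"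
  proof -
    have "Gamma g \<noteq> 0" "Gamma (X + g) \<noteq> 0" using Re_pos_not_nonpos_Int[OF g]
        Re_pos_not_nonpos_Int[OF Xg(1)]
      by (simp_all add: Gamma_eq_zero_iff)
    then have "rGamma g * Beta X g * Gamma (X + g) = Gamma X"
      by (simp add: Beta_def rGamma_inverse_Gamma)
    then show ?thesis by (metis mult.assoc)
  qed
  ultimately have "has_bochner_integral lborel (\<lambda>s. \<Sum>m. T m s)
      (Gamma X * Gamma (X + g - a - b) * rGamma (X + g - a) * rGamma (X + g - b))"
    by (simp only:)
  then show ?thesis unfolding has_mellin_def X_def[symmetric] using pointwise by simp
qed

text \<open>Convolution on the multiplicative group of positive reals, for functions regarded as supported
  in \<open>(0, 1)\<close>: then only \<open>s < r < 1\<close> contributes.\<close>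

definition mult_conv :: "(real \<Rightarrow> complex) \<Rightarrow> (real \<Rightarrow> complex) \<Rightarrow> real \<Rightarrow> complex" where
  "mult_conv f g s = (\<integral>r. indicator {s<..<1} r *\<^sub>R (f r * g (s / r) / of_real r) \<partial>lborel)"

text \<open>Fubini's theorem and the substitution \<open>s = r v\<close>.\<close>

lemma has_bochner_integral_mult_conv:
  fixes F G :: "real \<Rightarrow> complex"
  assumes F: "integrable lborel F" and G: "integrable lborel G" and supp: "\<And>r. r \<le> 0 \<Longrightarrow> F r = 0"
  shows "has_bochner_integral lborel (\<lambda>s. \<integral>r. F r * G (s / r) / of_real r \<partial>lborel)
           (integral\<^sup>L lborel F * integral\<^sup>L lborel G)"
proof -
  have [measurable]: "F \<in> borel_measurable borel" "G \<in> borel_measurable borel" using F G by auto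
  define \<Phi> where "\<Phi> = (\<lambda>(r, s). F r * G (s / r) / of_real r)"
  have meas: "\<Phi> \<in> borel_measurable (lborel \<Otimes>\<^sub>M lborel)" unfolding \<Phi>_def by measurable
  have int_inner: "integrable lborel (\<lambda>s. \<Phi> (r, s))" for r
  proof (cases "r > 0")
    case True
    then have "integrable lborel (\<lambda>s. G (0 + (1 / r) * s))"
      by (intro lborel_integrable_real_affine[OF G]) simp
    then show ?thesis by (simp add: \<Phi>_def)
  qed (simp add: \<Phi>_def supp)
  have scale: "(\<integral>s. H (s / r) / r \<partial>lborel) = (\<integral>s. H s \<partial>lborel)" if "r > 0" for H :: "real \<Rightarrow>
      real" and r
    using lborel_integral_real_affine[of "1 / r" H 0] that by (simp add: mult.commute)
  have scalec: "(\<integral>s. H (s / r) / of_real r \<partial>lborel) = (\<integral>s. H s \<partial>lborel)" if "r > 0" for H ::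
      "real \<Rightarrow> complex" and r
    using lborel_integral_real_affine[of "1 / r" H 0] that by (simp add: scaleR_conv_of_real
        mult.commute)
  have inner_norm: "(\<integral>s. norm (\<Phi> (r, s)) \<partial>lborel) = norm (F r) * (\<integral>s. norm (G s) \<partial>lborel)" for r
  proof (cases "r > 0")
    case True
    have "(\<integral>s. norm (\<Phi> (r, s)) \<partial>lborel) = norm (F r) * (\<integral>s. norm (G (s / r)) / r \<partial>lborel)"
      using True by (simp add: \<Phi>_def norm_mult norm_divide flip: times_divide_eq_right)
    then show ?thesis by (simp only: scale[OF True, of "\<lambda>s. norm (G s)"])
  qed (simp add: \<Phi>_def supp)
  have inner: "(\<integral>s. \<Phi> (r, s) \<partial>lborel) = F r * integral\<^sup>L lborel G" for r
  proof (cases "r > 0")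
    case True
    have "(\<integral>s. \<Phi> (r, s) \<partial>lborel) = F r * (\<integral>s. G (s / r) / of_real r \<partial>lborel)"
      by (simp add: \<Phi>_def flip: times_divide_eq_right)
    then show ?thesis by (simp only: scalec[OF True, of G])
  qed (simp add: \<Phi>_def supp)
  have int: "integrable (lborel \<Otimes>\<^sub>M lborel) \<Phi>"
  proof (rule lborel_pair.Fubini_integrable[OF meas])
    show "integrable lborel (\<lambda>r. \<integral>s. norm (\<Phi> (r, s)) \<partial>lborel)"
      unfolding inner_norm using F by (intro integrable_mult_left integrable_norm)
  qed (use int_inner in auto)
  then have int': "integrable (lborel \<Otimes>\<^sub>M lborel) (\<lambda>(r, s). F r * G (s / r) / of_real r)" by
      (simp add: \<Phi>_def)
  have "integrable lborel (\<lambda>s. \<integral>r. F r * G (s / r) / of_real r \<partial>lborel)"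
    by (rule lborel_pair.integrable_snd[OF int'])
  moreover have "(\<integral>s. (\<integral>r. F r * G (s / r) / of_real r \<partial>lborel) \<partial>lborel) = integral\<^sup>L (lborel
      \<Otimes>\<^sub>M lborel) \<Phi>"
    using lborel_pair.integral_snd[OF int'] by (simp add: \<Phi>_def)
  moreover have "integral\<^sup>L (lborel \<Otimes>\<^sub>M lborel) \<Phi> = integral\<^sup>L lborel F * integral\<^sup>L lborel G"
    using lborel_pair.integral_fst'[OF int] by (simp add: inner)
  ultimately show ?thesis by (simp add: has_bochner_integral_iff)
qed

lemma has_mellin_mult_conv:
  assumes f: "has_mellin f \<rho> I" and g: "has_mellin g \<rho> J"
  shows "has_mellin (mult_conv f g) \<rho> (I * J)"
proof -
  define F where "F s = indicator {0<..<1} s *\<^sub>R (of_real s powr (\<rho> - 1) * f s)" for s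
  define G where "G s = indicator {0<..<1} s *\<^sub>R (of_real s powr (\<rho> - 1) * g s)" for s
  have FG: "integrable lborel F" "integrable lborel G" "integral\<^sup>L lborel F = I" "integral\<^sup>L
      lborel G = J"
    using f g by (simp_all add: has_mellin_def has_bochner_integral_iff F_def[abs_def]
        G_def[abs_def])
  have eq: "(\<integral>r. F r * G (s / r) / of_real r \<partial>lborel) =
      indicator {0<..<1} s *\<^sub>R (of_real s powr (\<rho> - 1) * mult_conv f g s)" for s
  proof (cases "s \<in> {0<..<1}")
    case True
    have eqr: "F r * G (s / r) / of_real r = of_real s powr (\<rho> - 1) * (indicator {s<..<1} r *\<^sub>R
        (f r * g (s / r) / of_real r))" for r
    proof (cases "r \<in> {s<..<1}")
      case r: True
      then have "s / r \<in> {0<..<1}" "r \<in> {0<..<1}" using True by auto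
      moreover have "of_real s powr (\<rho> - 1) = of_real r powr (\<rho> - 1) * of_real (s / r) powr (\<rho> - 1)"
        using r True powr_times_real[of "of_real r" "of_real (s / r)" "\<rho> - 1"] by simp
      ultimately show ?thesis using r by (simp add: F_def G_def del: of_real_divide)
    next
      case False
      then have "F r * G (s / r) = 0" using True by (auto simp: F_def G_def indicator_def
          field_simps)
      with False show ?thesis by simp
    qed
    have "(\<integral>r. F r * G (s / r) / of_real r \<partial>lborel) = of_real s powr (\<rho> - 1) * mult_conv f g s"
      unfolding mult_conv_def eqr by (rule integral_mult_right_zero)
    then show ?thesis using True by simp
  next
    case False
    have "F r * G (s / r) = 0" for r using False by (auto simp: F_def G_def indicator_def
        field_simps)
    then have "(\<integral>r. F r * G (s / r) / of_real r \<partial>lborel) = 0" by (simp only:) simp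
    then show ?thesis using False by simp
  qed
  have "has_bochner_integral lborel (\<lambda>s. \<integral>r. F r * G (s / r) / of_real r \<partial>lborel) (I * J)"
    using has_bochner_integral_mult_conv[OF FG(1,2)] FG(3,4) by (simp add: F_def)
  then show ?thesis unfolding has_mellin_def eq .
qed

text \<open>By Weierstrass approximation, vanishing moments force the integral against every continuous
  function to vanish. Piecewise linear functions decrease to indicators of half-lines, which
  generate the Borel sets.\<close>

lemma moments_zero_imp_AE_zero:
  fixes h :: "real \<Rightarrow> complex"
  assumes h: "integrable lborel h" and supp: "\<And>s. s \<notin> {0<..<1} \<Longrightarrow> h s = 0"
    and mom: "\<And>n. (\<integral>s. of_real s ^ n * h s \<partial>lborel) = 0"
  shows "AE s in lborel. h s = 0"
proof -
  have [measurable]: "h \<in> borel_measurable borel" using h by auto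
  have int_bd: "integrable lborel (\<lambda>s. of_real (\<phi> s) * h s)"
    if "\<phi> \<in> borel_measurable borel" "\<And>s. s \<in> {0<..<1} \<Longrightarrow> \<bar>\<phi> s\<bar> \<le> M" for \<phi> and M :: real
  proof (rule Bochner_Integration.integrable_bound)
    show "integrable lborel (\<lambda>s. M * norm (h s))" using h by (intro integrable_mult_right
        integrable_norm)
    show "AE s in lborel. norm (of_real (\<phi> s) * h s) \<le> norm (M * norm (h s))"
    proof (rule AE_I2)
      fix s
      show "norm (of_real (\<phi> s) * h s) \<le> norm (M * norm (h s))"
        by (cases "s \<in> {0<..<1}") (use that(2)[of s] supp in \<open>auto simp: norm_mult intro!:
            mult_right_mono\<close>)
    qed
  qed (use that in measurable)
  have poly: "(\<integral>s. of_real (\<Sum>i\<le>n. a i * s ^ i) * h s \<partial>lborel) = 0" for a :: "nat \<Rightarrow> real" and n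
  proof -
    have "integrable lborel (\<lambda>s. of_real (s ^ i) * h s)" for i
      by (rule int_bd[where M = 1]) (auto simp: power_le_one)
    then have "(\<integral>s. (\<Sum>i\<le>n. of_real (a i) * (of_real s ^ i * h s)) \<partial>lborel) = 0"
      using mom by (subst Bochner_Integration.integral_sum) auto
    then show ?thesis by (simp add: sum_distrib_left sum_distrib_right mult_ac)
  qed
  have cont: "(\<integral>s. of_real (\<phi> s) * h s \<partial>lborel) = 0" if \<phi>: "continuous_on UNIV \<phi>" for \<phi> :: "real
      \<Rightarrow> real"
  proof -
    have bd: "norm (\<integral>s. of_real (\<phi> s) * h s \<partial>lborel) \<le> e * (\<integral>s. norm (h s) \<partial>lborel)" if e: "e >
        0" for e
    proof -
      obtain p where p: "real_polynomial_function p" "\<And>s. s \<in> {0..1} \<Longrightarrow> \<bar>\<phi> s - p s\<bar> < e"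
        using Stone_Weierstrass_real_polynomial_function[of "{0..1}" \<phi> e] \<phi> e
            continuous_on_subset by blast
      obtain a n where pa: "p = (\<lambda>s. \<Sum>i\<le>n. a i * s ^ i)" using p(1)
          real_polynomial_function_iff_sum by blast
      have [measurable]: "\<phi> \<in> borel_measurable borel" using \<phi> by (rule
          borel_measurable_continuous_onI)
      have [measurable]: "p \<in> borel_measurable borel" unfolding pa by measurable
      have "\<exists>M. \<forall>s\<in>{0..1}. \<bar>\<phi> s\<bar> \<le> M"
        using compact_imp_bounded[OF compact_continuous_image[OF continuous_on_subset[OF \<phi>]
            compact_Icc[of 0 1]]]
        by (auto simp: bounded_iff)
      then obtain M where M: "\<forall>s\<in>{0..1}. \<bar>\<phi> s\<bar> \<le> M" ..
      have i1: "integrable lborel (\<lambda>s. of_real (\<phi> s) * h s)" by (rule int_bd[where M = M]) (use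
          M in auto)
      have i2: "integrable lborel (\<lambda>s. of_real (\<phi> s - p s) * h s)"
        by (rule int_bd[where M = e]) (use p(2) in \<open>auto intro: less_imp_le\<close>)
      have "integrable lborel (\<lambda>s. of_real (\<phi> s) * h s - of_real (\<phi> s - p s) * h s)" by (intro
          Bochner_Integration.integrable_diff i1 i2)
      then have i3: "integrable lborel (\<lambda>s. of_real (p s) * h s)" by (simp add: algebra_simps)
      have "(\<integral>s. of_real (\<phi> s - p s) * h s \<partial>lborel) = (\<integral>s. of_real (\<phi> s) * h s \<partial>lborel) - (\<integral>s.
          of_real (p s) * h s \<partial>lborel)"
        by (subst Bochner_Integration.integral_diff[symmetric, OF i1 i3]) (simp add: algebra_simps)
      also have "(\<integral>s. of_real (p s) * h s \<partial>lborel) = 0" unfolding pa by (rule poly)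
      finally have "norm (\<integral>s. of_real (\<phi> s) * h s \<partial>lborel) \<le> (\<integral>s. norm (of_real (\<phi> s - p s) * h
          s) \<partial>lborel)"
        using integral_norm_bound[of lborel "\<lambda>s. of_real (\<phi> s - p s) * h s"] by simp
      also have "\<dots> \<le> (\<integral>s. e * norm (h s) \<partial>lborel)"
      proof (intro integral_mono integrable_norm i2 integrable_mult_right h)
        fix s
        show "norm (of_real (\<phi> s - p s) * h s) \<le> e * norm (h s)"
        proof (cases "s \<in> {0<..<1}")
          case True
          then have "\<bar>\<phi> s - p s\<bar> \<le> e" using p(2)[of s] by auto
          then show ?thesis by (simp add: norm_mult mult_right_mono del: of_real_diff)
        qed (simp add: supp)
      qed
      finally show ?thesis by simp
    qed
    have "norm (\<integral>s. of_real (\<phi> s) * h s \<partial>lborel) \<le> 0 + e" if "e > 0" for e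
    proof -
      define N where "N = (\<integral>s. norm (h s) \<partial>lborel)"
      have N: "N \<ge> 0" by (simp add: N_def)
      have "norm (\<integral>s. of_real (\<phi> s) * h s \<partial>lborel) \<le> (e / (N + 1)) * N"
        unfolding N_def by (rule bd) (use that N in \<open>auto simp: N_def intro!: divide_pos_pos
            add_nonneg_pos\<close>)
      also have "\<dots> \<le> e" using that N by (simp add: field_simps)
      finally show ?thesis by simp
    qed
    then have "norm (\<integral>s. of_real (\<phi> s) * h s \<partial>lborel) \<le> 0" by (rule field_le_epsilon)
    then show ?thesis by simp
  qed
  have half: "(\<integral>s. indicator {..a} s *\<^sub>R h s \<partial>lborel) = 0" for a
  proof -
    \<comment> \<open>equal to 1 up to \<open>a\<close>, then linear down to 0 at \<open>a + 1/n\<close>\<close>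
    define \<phi> where "\<phi> n s = max 0 (min 1 (1 - real n * (s - a)))" for n s
    have "(\<lambda>n. \<integral>s. of_real (\<phi> n s) * h s \<partial>lborel) \<longlonglongrightarrow> (\<integral>s. indicator {..a} s *\<^sub>R h s \<partial>lborel)"
    proof (rule integral_dominated_convergence[where w = "\<lambda>s. norm (h s)"])
      show "AE s in lborel. (\<lambda>n. of_real (\<phi> n s) * h s) \<longlonglongrightarrow> indicator {..a} s *\<^sub>R h s"
      proof (rule AE_I2)
        fix s
        have "(\<lambda>n. \<phi> n s) \<longlonglongrightarrow> indicator {..a} s"
        proof (cases "s \<le> a")
          case True
          then have "\<phi> n s = 1" for n by (simp add: \<phi>_def mult_nonneg_nonpos)
          then show ?thesis using True by simp
        next
          case False
          have "filterlim (\<lambda>n. (s - a) * real n) at_top sequentially"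
            using False by (intro filterlim_tendsto_pos_mult_at_top[OF tendsto_const _
                filterlim_real_sequentially]) auto
          then have "\<forall>\<^sub>F n in sequentially. (s - a) * real n \<ge> 1" by (simp add: filterlim_at_top)
          then have "\<forall>\<^sub>F n in sequentially. \<phi> n s = 0"
            by eventually_elim (auto simp: \<phi>_def mult.commute)
          then show ?thesis using False by (simp add: tendsto_eventually)
        qed
        then have "(\<lambda>n. of_real (\<phi> n s) * h s) \<longlonglongrightarrow> of_real (indicator {..a} s) * h s" by (intro
            tendsto_intros)
        then show "(\<lambda>n. of_real (\<phi> n s) * h s) \<longlonglongrightarrow> indicator {..a} s *\<^sub>R h s" by (simp add:
            scaleR_conv_of_real)
      qed
      show "AE s in lborel. norm (of_real (\<phi> n s) * h s) \<le> norm (h s)" for n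
        by (intro AE_I2) (auto simp: norm_mult \<phi>_def intro!: mult_left_le_one_le)
      show "(\<lambda>s. of_real (\<phi> n s) * h s) \<in> borel_measurable lborel" for n unfolding \<phi>_def by
          measurable
    qed (use h in auto)
    moreover have "(\<integral>s. of_real (\<phi> n s) * h s \<partial>lborel) = 0" for n
      unfolding \<phi>_def by (intro cont continuous_intros)
    ultimately show ?thesis using LIMSEQ_unique[OF tendsto_const] by fastforce
  qed
  have tot: "(\<integral>s. h s \<partial>lborel) = 0" using mom[of 0] by simp
  show ?thesis
  proof (rule sigma_finite_measure.density_zero[OF lborel.sigma_finite_measure_axioms h])
    fix A :: "real set" assume "A \<in> sets lborel"
    then have A: "A \<in> sigma_sets UNIV (range (\<lambda>a. {..a::real}))"
      by (simp add: borel_eq_atMost)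
    have stable: "Int_stable (range (\<lambda>a. {..a::real}))"
      by (auto simp: Int_stable_def)
    have sub: "range (\<lambda>a. {..a::real}) \<subseteq> Pow UNIV" by simp
    from stable sub A show "set_lebesgue_integral lborel A h = 0"
    proof (induction rule: sigma_sets_induct_disjoint)
      case (basic A)
      then show ?case using half by (auto simp: set_lebesgue_integral_def)
    next
      case empty
      then show ?case by (simp add: set_lebesgue_integral_def)
    next
      case (compl A)
      have A: "A \<in> sets borel" using compl(1) by (simp add: borel_eq_atMost)
      have "(\<integral>s. indicator A s *\<^sub>R h s \<partial>lborel) = 0" using compl(2) by (simp add:
          set_lebesgue_integral_def)
      moreover have "(\<integral>s. indicator (UNIV - A) s *\<^sub>R h s \<partial>lborel) = (\<integral>s. h s - indicator A s *\<^sub>R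
          h s \<partial>lborel)"
        by (intro Bochner_Integration.integral_cong) (auto simp: indicator_def)
      moreover have "integrable lborel (\<lambda>s. indicator A s *\<^sub>R h s)" using A h by (intro
          integrable_mult_indicator) auto
      ultimately show ?case using h tot by (simp add: set_lebesgue_integral_def)
    next
      case (union A)
      have A: "A i \<in> sets lborel" for i using union(2) by (auto simp: borel_eq_atMost)
      have "set_lebesgue_integral lborel (\<Union>i. A i) h = (\<Sum>i. set_lebesgue_integral lborel (A i) h)"
      proof (rule lebesgue_integral_countable_add[OF A])
        show "set_integrable lborel (\<Union>i. A i) h" unfolding set_integrable_def
          using A h by (intro integrable_mult_indicator) auto
      qed (use union(1) in \<open>auto simp: disjoint_family_on_def\<close>)
      then show ?case using union(3) by simp
    qed
  qed
qed

lemma has_mellin_unique_AE: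
  assumes f: "\<And>n::nat. has_mellin f (\<rho> + of_nat n) (I n)" and g: "\<And>n::nat. has_mellin g (\<rho> +
      of_nat n) (I n)"
  shows "AE s in lborel. s \<in> {0<..<1} \<longrightarrow> f s = g s"
proof -
  define h where "h s = indicator {0<..<1} s *\<^sub>R (of_real s powr (\<rho> - 1) * f s) - indicator
      {0<..<1} s *\<^sub>R (of_real s powr (\<rho> - 1) * g s)" for s
  have int: "integrable lborel (\<lambda>s. indicator {0<..<1} s *\<^sub>R (of_real s powr (\<rho> - 1) * k s))"
    if "\<And>n::nat. has_mellin k (\<rho> + of_nat n) (I n)" for k
    using that[of 0] by (simp add: has_mellin_def has_bochner_integral_iff)
  have shift: "of_real s ^ n * (indicator {0<..<1} s *\<^sub>R (of_real s powr (\<rho> - 1) * k s)) =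
      indicator {0<..<1} s *\<^sub>R (of_real s powr (\<rho> + of_nat n - 1) * k s)" for s n and k :: "real
          \<Rightarrow> complex"
  proof (cases "s \<in> {0<..<1}")
    case True
    then have "of_real s powr (\<rho> + of_nat n - 1) = of_real s powr (\<rho> - 1) * of_real s ^ n"
      using powr_add[of "of_real s" "\<rho> - 1" "of_nat n"] by (simp add: powr_nat algebra_simps)
    with True show ?thesis by simp
  qed simp
  have "AE s in lborel. h s = 0"
  proof (rule moments_zero_imp_AE_zero)
    show "integrable lborel h" unfolding h_def by (intro Bochner_Integration.integrable_diff int
        f g)
    show "h s = 0" if "s \<notin> {0<..<1}" for s using that by (simp add: h_def)
    show "(\<integral>s. of_real s ^ n * h s \<partial>lborel) = 0" for n
      unfolding h_def right_diff_distrib shift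
      using f[of n] g[of n] by (simp add: has_mellin_def has_bochner_integral_iff)
  qed
  then show ?thesis
  proof eventually_elim
    case (elim s)
    then show ?case by (auto simp: h_def)
  qed
qed

text \<open>How a Mellin transform known only far to the right is extended: if another function has
  the same transform there and is known to be transformable at \<open>\<sigma>\<close>, the two functions agree almost
  everywhere, so the transform at \<open>\<sigma>\<close> is shared too.\<close>

lemma has_mellin_transfer:
  assumes f: "\<And>n::nat. has_mellin f (\<rho> + of_nat n) (I n)" and g: "\<And>n::nat. has_mellin g (\<rho> +
      of_nat n) (I n)"
    and gJ: "has_mellin g \<sigma> J"
  shows "has_mellin f \<sigma> J"
proof -
  have AE: "AE s in lborel. indicator {0<..<1} s *\<^sub>R (of_real s powr (\<sigma> - 1) * f s) = indicator
      {0<..<1} s *\<^sub>R (of_real s powr (\<sigma> - 1) * g s)"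
    using has_mellin_unique_AE[OF f g] by eventually_elim (auto simp: indicator_def)
  have m: "(\<lambda>s. indicator {0<..<1} s *\<^sub>R (of_real s powr (\<rho> - 1) * f s)) \<in> borel_measurable borel"
    using f[of 0] by (auto simp: has_mellin_def has_bochner_integral_iff)
  have "(\<lambda>s. (indicator {0<..<1} s *\<^sub>R (of_real s powr (\<sigma> - \<rho>))) * (indicator {0<..<1} s *\<^sub>R
      (of_real s powr (\<rho> - 1) * f s))) \<in> borel_measurable borel"
    by (intro borel_measurable_times m borel_measurable_continuous_on_indicator)
       (auto intro!: continuous_intros simp: complex_nonpos_Reals_iff)
  also have "(\<lambda>s. (indicator {0<..<1} s *\<^sub>R (of_real s powr (\<sigma> - \<rho>))) * (indicator {0<..<1} s
      *\<^sub>R (of_real s powr (\<rho> - 1) * f s)))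
     = (\<lambda>s. indicator {0<..<1} s *\<^sub>R (of_real s powr (\<sigma> - 1) * f s))"
  proof
    fix s :: real
    have "of_real s powr (\<sigma> - \<rho>) * of_real s powr (\<rho> - 1) = of_real s powr (\<sigma> - 1)"
      by (simp flip: powr_add)
    then show "(indicator {0<..<1} s *\<^sub>R (of_real s powr (\<sigma> - \<rho>))) * (indicator {0<..<1} s *\<^sub>R
        (of_real s powr (\<rho> - 1) * f s))
       = indicator {0<..<1} s *\<^sub>R (of_real s powr (\<sigma> - 1) * f s)"
      by (simp add: indicator_def flip: mult.assoc)
  qed
  finally have mf: "(\<lambda>s. indicator {0<..<1} s *\<^sub>R (of_real s powr (\<sigma> - 1) * f s)) \<in>
      borel_measurable lborel" by simp
  have mg: "(\<lambda>s. indicator {0<..<1} s *\<^sub>R (of_real s powr (\<sigma> - 1) * g s)) \<in> borel_measurable lborel"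
    using gJ by (auto simp: has_mellin_def has_bochner_integral_iff)
  have "has_bochner_integral lborel (\<lambda>s. indicator {0<..<1} s *\<^sub>R (of_real s powr (\<sigma> - 1) * f s)) J"
    using has_bochner_integral_cong_AE[OF mf mg AE] gJ by (simp add: has_mellin_def)
  then show ?thesis by (simp add: has_mellin_def)
qed

section \<open>The Mellin transform of the Appell kernel\<close>

text \<open>The parameters of \<open>hyp_kernel\<close> are solved for so that the transform has the Gamma factors
  \<open>\<rho> + \<alpha>\<close>, \<open>\<rho> + \<alpha>'\<close> above and \<open>\<rho> + \<beta>\<close>, \<open>\<rho> + \<beta>'\<close> below.\<close>

definition gamma_kernel :: "complex \<Rightarrow> complex \<Rightarrow> complex \<Rightarrow> complex \<Rightarrow> real \<Rightarrow> complex" where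
  "gamma_kernel \<alpha> \<alpha>' \<beta> \<beta>' = hyp_kernel (\<beta>' - \<alpha>') (\<beta> - \<alpha>') (\<beta> + \<beta>' - \<alpha> - \<alpha>') \<alpha>"

lemma has_mellin_gamma_kernel:
  assumes "Re (\<beta> + \<beta>' - \<alpha> - \<alpha>') > 0" "Re (\<rho> + \<alpha>) > 0" "Re (\<rho> + \<alpha>') > 0"
  shows "has_mellin (gamma_kernel \<alpha> \<alpha>' \<beta> \<beta>') \<rho>
           (Gamma (\<rho> + \<alpha>) * Gamma (\<rho> + \<alpha>') * rGamma (\<rho> + \<beta>) * rGamma (\<rho> + \<beta>'))"
proof -
  have "\<rho> + \<alpha> + (\<beta> + \<beta>' - \<alpha> - \<alpha>') - (\<beta>' - \<alpha>') - (\<beta> - \<alpha>') = \<rho> + \<alpha>'"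
    "\<rho> + \<alpha> + (\<beta> + \<beta>' - \<alpha> - \<alpha>') - (\<beta>' - \<alpha>') = \<rho> + \<beta>"
    "\<rho> + \<alpha> + (\<beta> + \<beta>' - \<alpha> - \<alpha>') - (\<beta> - \<alpha>') = \<rho> + \<beta>'"
    by (simp_all add: algebra_simps)
  with has_mellin_hyp_kernel[OF assms(1,2), of "\<beta>' - \<alpha>'" "\<beta> - \<alpha>'"] assms(3)
  show ?thesis by (simp add: gamma_kernel_def)
qed

definition gamma_ratio3 :: "complex \<Rightarrow> complex \<Rightarrow> complex \<Rightarrow> complex \<Rightarrow> complex \<Rightarrow> complex \<Rightarrow> complex
    \<Rightarrow> complex" where
  "gamma_ratio3 \<alpha>1 \<alpha>2 \<alpha>3 \<beta>1 \<beta>2 \<beta>3 \<rho> =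
     Gamma (\<rho> + \<alpha>1) * Gamma (\<rho> + \<alpha>2) * Gamma (\<rho> + \<alpha>3) *
     rGamma (\<rho> + \<beta>1) * rGamma (\<rho> + \<beta>2) * rGamma (\<rho> + \<beta>3)"

text \<open>Two kernels of the previous kind are convolved, with an intermediate parameter \<open>\<kappa>\<close> whose Gamma
  factors cancel in the product of the transforms. Each kernel needs its lower parameters to
  exceed the upper ones in sum, which confines \<open>Re \<kappa>\<close> to an interval; and for the transform to
  exist on the whole half plane where the three Gamma factors above are pole free, \<open>Re \<kappa>\<close> must not
  lie below the least of the \<open>Re \<alpha>\<close>. Pairing \<open>\<kappa>\<close> and the smallest \<open>\<alpha>\<close> with the two largest \<open>\<beta>\<close>
  makes this possible (all in terms of real parts): the mean of these two is at least the mean of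
  all \<open>\<beta>\<close>, hence more than the mean of the \<open>\<alpha>\<close>, hence more than the smallest \<open>\<alpha>\<close>.\<close>

lemma ex_gamma_ratio3_kernel_ordered:
  assumes pos: "Re (\<alpha>1 + \<alpha>2 + \<alpha>3) < Re (\<beta>1 + \<beta>2 + \<beta>3)"
    and \<alpha>: "Re \<alpha>3 \<le> Re \<alpha>1" "Re \<alpha>3 \<le> Re \<alpha>2" and \<beta>: "Re \<beta>1 \<le> Re \<beta>2" "Re \<beta>1 \<le> Re \<beta>3"
  obtains k where "\<And>\<rho>. Re (\<rho> + \<alpha>1) > 0 \<Longrightarrow> Re (\<rho> + \<alpha>2) > 0 \<Longrightarrow> Re (\<rho> + \<alpha>3) > 0 \<Longrightarrow>
    has_mellin k \<rho> (gamma_ratio3 \<alpha>1 \<alpha>2 \<alpha>3 \<beta>1 \<beta>2 \<beta>3 \<rho>)"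
proof -
  \<comment> \<open>\<open>lo < hi\<close> is where the assumptions on the order of the parameters enter; any real part
     strictly between would do for \<open>\<kappa>\<close>.\<close>
  define lo where "lo = max (Re \<alpha>3) (Re (\<alpha>1 + \<alpha>2 - \<beta>1))"
  define hi where "hi = Re (\<beta>2 + \<beta>3 - \<alpha>3)"
  have "lo < hi" using pos \<alpha> \<beta> by (auto simp: lo_def hi_def)
  define \<kappa> where "\<kappa> = complex_of_real ((lo + hi) / 2)"
  have \<kappa>: "Re \<kappa> > Re \<alpha>3" "Re \<kappa> > Re (\<alpha>1 + \<alpha>2 - \<beta>1)" "Re \<kappa> < Re (\<beta>2 + \<beta>3 - \<alpha>3)"
    using \<open>lo < hi\<close> by (auto simp: \<kappa>_def lo_def hi_def)
  show ?thesis
  proof (rule that[of "mult_conv (gamma_kernel \<alpha>3 \<kappa> \<beta>2 \<beta>3) (gamma_kernel \<alpha>1 \<alpha>2 \<beta>1 \<kappa>)"])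
    fix \<rho> assume \<rho>: "Re (\<rho> + \<alpha>1) > 0" "Re (\<rho> + \<alpha>2) > 0" "Re (\<rho> + \<alpha>3) > 0"
    have \<rho>\<kappa>: "Re (\<rho> + \<kappa>) > 0" using \<rho>(3) \<kappa>(1) by simp
    have "has_mellin (mult_conv (gamma_kernel \<alpha>3 \<kappa> \<beta>2 \<beta>3) (gamma_kernel \<alpha>1 \<alpha>2 \<beta>1 \<kappa>)) \<rho>
      ((Gamma (\<rho> + \<alpha>3) * Gamma (\<rho> + \<kappa>) * rGamma (\<rho> + \<beta>2) * rGamma (\<rho> + \<beta>3)) *
       (Gamma (\<rho> + \<alpha>1) * Gamma (\<rho> + \<alpha>2) * rGamma (\<rho> + \<beta>1) * rGamma (\<rho> + \<kappa>)))"
      using \<rho> \<rho>\<kappa> \<kappa> by (intro has_mellin_mult_conv has_mellin_gamma_kernel) auto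
    moreover have "Gamma (\<rho> + \<kappa>) * rGamma (\<rho> + \<kappa>) = 1"
      using Re_pos_not_nonpos_Int[OF \<rho>\<kappa>] by (simp add: rGamma_inverse_Gamma Gamma_eq_zero_iff)
    then have "(Gamma (\<rho> + \<alpha>3) * Gamma (\<rho> + \<kappa>) * rGamma (\<rho> + \<beta>2) * rGamma (\<rho> + \<beta>3)) *
       (Gamma (\<rho> + \<alpha>1) * Gamma (\<rho> + \<alpha>2) * rGamma (\<rho> + \<beta>1) * rGamma (\<rho> + \<kappa>)) =
       gamma_ratio3 \<alpha>1 \<alpha>2 \<alpha>3 \<beta>1 \<beta>2 \<beta>3 \<rho>"
      unfolding gamma_ratio3_def by algebra
    ultimately show "has_mellin (mult_conv (gamma_kernel \<alpha>3 \<kappa> \<beta>2 \<beta>3) (gamma_kernel \<alpha>1 \<alpha>2 \<beta>1 \<kappa>)) \<rho>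
        (gamma_ratio3 \<alpha>1 \<alpha>2 \<alpha>3 \<beta>1 \<beta>2 \<beta>3 \<rho>)" by simp
  qed
qed

lemma ex_gamma_ratio3_kernel_upper_ordered:
  assumes pos: "Re (\<alpha>1 + \<alpha>2 + \<alpha>3) < Re (\<beta>1 + \<beta>2 + \<beta>3)"
    and \<alpha>: "Re \<alpha>3 \<le> Re \<alpha>1" "Re \<alpha>3 \<le> Re \<alpha>2"
  obtains k where "\<And>\<rho>. Re (\<rho> + \<alpha>1) > 0 \<Longrightarrow> Re (\<rho> + \<alpha>2) > 0 \<Longrightarrow> Re (\<rho> + \<alpha>3) > 0 \<Longrightarrow>
    has_mellin k \<rho> (gamma_ratio3 \<alpha>1 \<alpha>2 \<alpha>3 \<beta>1 \<beta>2 \<beta>3 \<rho>)"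
proof -
  consider "Re \<beta>1 \<le> Re \<beta>2" "Re \<beta>1 \<le> Re \<beta>3" | "Re \<beta>2 \<le> Re \<beta>1" "Re \<beta>2 \<le> Re \<beta>3" | "Re \<beta>3 \<le> Re \<beta>1"
      "Re \<beta>3 \<le> Re \<beta>2"
    by linarith
  then show ?thesis
  proof cases
    case 1
    show ?thesis by (rule ex_gamma_ratio3_kernel_ordered[OF pos \<alpha> 1], rule that)
  next
    case 2
    have "Re (\<alpha>1 + \<alpha>2 + \<alpha>3) < Re (\<beta>2 + \<beta>1 + \<beta>3)" using pos by simp
    from ex_gamma_ratio3_kernel_ordered[OF this \<alpha> 2] obtain k where
      k: "\<And>\<rho>. Re (\<rho> + \<alpha>1) > 0 \<Longrightarrow> Re (\<rho> + \<alpha>2) > 0 \<Longrightarrow> Re (\<rho> + \<alpha>3) > 0 \<Longrightarrow>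
            has_mellin k \<rho> (gamma_ratio3 \<alpha>1 \<alpha>2 \<alpha>3 \<beta>2 \<beta>1 \<beta>3 \<rho>)" by blast
    moreover have "gamma_ratio3 \<alpha>1 \<alpha>2 \<alpha>3 \<beta>2 \<beta>1 \<beta>3 = gamma_ratio3 \<alpha>1 \<alpha>2 \<alpha>3 \<beta>1 \<beta>2 \<beta>3"
      by (auto simp: gamma_ratio3_def mult_ac)
    ultimately show ?thesis using that by metis
  next
    case 3
    have "Re (\<alpha>1 + \<alpha>2 + \<alpha>3) < Re (\<beta>3 + \<beta>1 + \<beta>2)" using pos by simp
    from ex_gamma_ratio3_kernel_ordered[OF this \<alpha> 3] obtain k where
      k: "\<And>\<rho>. Re (\<rho> + \<alpha>1) > 0 \<Longrightarrow> Re (\<rho> + \<alpha>2) > 0 \<Longrightarrow> Re (\<rho> + \<alpha>3) > 0 \<Longrightarrow>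
            has_mellin k \<rho> (gamma_ratio3 \<alpha>1 \<alpha>2 \<alpha>3 \<beta>3 \<beta>1 \<beta>2 \<rho>)" by blast
    moreover have "gamma_ratio3 \<alpha>1 \<alpha>2 \<alpha>3 \<beta>3 \<beta>1 \<beta>2 = gamma_ratio3 \<alpha>1 \<alpha>2 \<alpha>3 \<beta>1 \<beta>2 \<beta>3"
      by (auto simp: gamma_ratio3_def mult_ac)
    ultimately show ?thesis using that by metis
  qed
qed

text \<open>The ordering is no restriction, as the quotient of Gamma functions is symmetric in the
    upper and
  in the lower parameters.\<close>

lemma ex_gamma_ratio3_kernel:
  assumes pos: "Re (\<alpha>1 + \<alpha>2 + \<alpha>3) < Re (\<beta>1 + \<beta>2 + \<beta>3)"
  obtains k where "\<And>\<rho>. Re (\<rho> + \<alpha>1) > 0 \<Longrightarrow> Re (\<rho> + \<alpha>2) > 0 \<Longrightarrow> Re (\<rho> + \<alpha>3) > 0 \<Longrightarrow>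
    has_mellin k \<rho> (gamma_ratio3 \<alpha>1 \<alpha>2 \<alpha>3 \<beta>1 \<beta>2 \<beta>3 \<rho>)"
proof -
  consider "Re \<alpha>1 \<le> Re \<alpha>2" "Re \<alpha>1 \<le> Re \<alpha>3" | "Re \<alpha>2 \<le> Re \<alpha>1" "Re \<alpha>2 \<le> Re \<alpha>3" | "Re \<alpha>3 \<le> Re \<alpha>1"
      "Re \<alpha>3 \<le> Re \<alpha>2"
    by linarith
  then show ?thesis
  proof cases
    case 1
    have "Re (\<alpha>2 + \<alpha>3 + \<alpha>1) < Re (\<beta>1 + \<beta>2 + \<beta>3)" using pos by simp
    from ex_gamma_ratio3_kernel_upper_ordered[OF this 1] obtain k where
      k: "\<And>\<rho>. Re (\<rho> + \<alpha>2) > 0 \<Longrightarrow> Re (\<rho> + \<alpha>3) > 0 \<Longrightarrow> Re (\<rho> + \<alpha>1) > 0 \<Longrightarrow>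
            has_mellin k \<rho> (gamma_ratio3 \<alpha>2 \<alpha>3 \<alpha>1 \<beta>1 \<beta>2 \<beta>3 \<rho>)" by blast
    moreover have "gamma_ratio3 \<alpha>2 \<alpha>3 \<alpha>1 \<beta>1 \<beta>2 \<beta>3 = gamma_ratio3 \<alpha>1 \<alpha>2 \<alpha>3 \<beta>1 \<beta>2 \<beta>3"
      by (auto simp: gamma_ratio3_def mult_ac)
    ultimately show ?thesis using that by metis
  next
    case 2
    have "Re (\<alpha>1 + \<alpha>3 + \<alpha>2) < Re (\<beta>1 + \<beta>2 + \<beta>3)" using pos by simp
    from ex_gamma_ratio3_kernel_upper_ordered[OF this 2] obtain k where
      k: "\<And>\<rho>. Re (\<rho> + \<alpha>1) > 0 \<Longrightarrow> Re (\<rho> + \<alpha>3) > 0 \<Longrightarrow> Re (\<rho> + \<alpha>2) > 0 \<Longrightarrow>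
            has_mellin k \<rho> (gamma_ratio3 \<alpha>1 \<alpha>3 \<alpha>2 \<beta>1 \<beta>2 \<beta>3 \<rho>)" by blast
    moreover have "gamma_ratio3 \<alpha>1 \<alpha>3 \<alpha>2 \<beta>1 \<beta>2 \<beta>3 = gamma_ratio3 \<alpha>1 \<alpha>2 \<alpha>3 \<beta>1 \<beta>2 \<beta>3"
      by (auto simp: gamma_ratio3_def mult_ac)
    ultimately show ?thesis using that by metis
  next
    case 3
    show ?thesis by (rule ex_gamma_ratio3_kernel_upper_ordered[OF pos 3], rule that)
  qed
qed

text \<open>The kernel of the Marichev-Saigo-Maeda integral in the scaled variable \<open>s = t / x\<close>.\<close>

definition appell_kernel :: "complex \<Rightarrow> complex \<Rightarrow> complex \<Rightarrow> complex \<Rightarrow> complex \<Rightarrow> real \<Rightarrow> complex" where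
  "appell_kernel a a' b b' c s = of_real s powr (- a') * of_real (1 - s) powr (c - 1) * rGamma c *
     appell_F3 a a' b b' c (of_real (1 - s)) (of_real (1 - 1 / s))"

lemma of_real_powr_exp: "x > 0 \<Longrightarrow> complex_of_real x powr z = exp (z * of_real (ln x))"
  by (simp add: powr_def Ln_of_real)

text \<open>On the curve \<open>X = 1 - s\<close>, \<open>Y = 1 - 1/s\<close> the substitution \<open>r = 1 - u X\<close> gives
  \<open>u X = 1 - r\<close> and \<open>(1 - u) Y = 1 - 1 / (s / r)\<close>. So the two factors of the Beta mean become a
  function of \<open>r\<close> and, by Pfaff's transformation, a function of \<open>s / r\<close>; all remaining powers
  combine exactly to a multiplicative convolution.\<close>

lemma appell_kernel_eq_mult_conv:
  assumes g: "Re g > 0" "Re g' > 0" and s: "0 < s" "s < 1"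
  shows "appell_kernel a a' b b' (g + g') s =
     mult_conv (hyp_kernel a b g (g' - a')) (hyp_kernel a' (g' - b') g' 0) s"
proof -
  define f1 where "f1 = hyp2F1 a b g"
  define f2 where "f2 = hyp2F1 a' b' g'"
  define K where "K = of_real s powr (- a') * of_real (1 - s) powr (g + g' - 1) * rGamma g *
      rGamma g'"
  have cut: "complex_of_real r \<in> cut_plane" if "r < 1" for r using that by (auto simp:
      cut_plane_def)
  have "appell_F3 a a' b b' (g + g') (of_real (1 - s)) (of_real (1 - 1 / s)) =
     beta_mean g g' f1 f2 (of_real (1 - s)) (of_real (1 - 1 / s))"
    unfolding f1_def f2_def using s by (intro appell_F3_eq_beta_mean g cut) (auto simp: field_simps)
  then have "appell_kernel a a' b b' (g + g') s = of_real s powr (- a') * of_real (1 - s) powr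
      (g + g' - 1) *
     (rGamma (g + g') / Beta g g') *
     (\<integral>u. beta_weight g g' u * (f1 (of_real u * of_real (1 - s)) * f2 (of_real (1 - u) * of_real
         (1 - 1 / s))) \<partial>lborel)"
    by (simp add: appell_kernel_def beta_mean_def)
  also have "rGamma (g + g') / Beta g g' = rGamma g * rGamma g'"
  proof -
    have "Gamma (g + g') \<noteq> 0" using g Re_pos_not_nonpos_Int[of "g + g'"] by (simp add:
        Gamma_eq_zero_iff)
    then show ?thesis by (simp add: Beta_def rGamma_inverse_Gamma field_simps)
  qed
  also have "of_real s powr (- a') * of_real (1 - s) powr (g + g' - 1) * (rGamma g * rGamma g') *
     (\<integral>u. beta_weight g g' u * (f1 (of_real u * of_real (1 - s)) * f2 (of_real (1 - u) * of_real
         (1 - 1 / s))) \<partial>lborel)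
    = (\<integral>u. K * (beta_weight g g' u * (f1 (of_real u * of_real (1 - s)) * f2 (of_real (1 - u) *
        of_real (1 - 1 / s)))) \<partial>lborel)"
    by (subst integral_mult_right_zero) (simp add: K_def)
  also have "\<dots> = (\<integral>u. of_real (1 - s) * (indicator {s<..<1} (1 + - (1 - s) * u) *\<^sub>R
      (hyp_kernel a b g (g' - a') (1 + - (1 - s) * u) * hyp_kernel a' (g' - b') g' 0 (s / (1 + -
          (1 - s) * u)) / of_real (1 + - (1 - s) * u))) \<partial>lborel)"
  proof (rule Bochner_Integration.integral_cong[OF refl])
    fix u :: real
    define r where "r = 1 + - (1 - s) * u"
    show "K * (beta_weight g g' u * (f1 (of_real u * of_real (1 - s)) * f2 (of_real (1 - u) *
        of_real (1 - 1 / s)))) =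
      of_real (1 - s) * (indicator {s<..<1} (1 + - (1 - s) * u) *\<^sub>R
      (hyp_kernel a b g (g' - a') (1 + - (1 - s) * u) * hyp_kernel a' (g' - b') g' 0 (s / (1 + -
          (1 - s) * u)) / of_real (1 + - (1 - s) * u)))"
      unfolding r_def[symmetric]
    proof (cases "u \<in> {0<..<1}")
      case True
      have u: "0 < u" "u < 1" using True by auto
      have "r = 1 - (1 - s) * u" by (simp add: r_def algebra_simps)
      then have r1: "r < 1" using mult_pos_pos[of "1 - s" u] u s by simp
      have rs_eq: "r - s = (1 - s) * (1 - u)" by (simp add: r_def algebra_simps)
      have rs: "s < r" using rs_eq mult_pos_pos[of "1 - s" "1 - u"] u s by linarith
      have r0: "0 < r" using rs s by simp
      have e1: "1 - r = (1 - s) * u" by (simp add: r_def algebra_simps)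
      have e2: "1 - s / r = (1 - s) * (1 - u) / r" using r0 rs_eq by (simp add: field_simps)
      have e3: "1 - 1 / (s / r) = (1 - u) * (1 - 1 / s)"
        using s r0 by (simp add: r_def field_simps)
      \<comment> \<open>All bases are positive reals, so powers become exponentials of logarithms and the
          identity of
         the two integrands is one between sums of exponents.\<close>
      define A B C R S where "A = complex_of_real (ln (1 - s))" and "B = complex_of_real (ln u)"
        and "C = complex_of_real (ln (1 - u))" and "R = complex_of_real (ln r)" and "S =
            complex_of_real (ln s)"
      have f2: "hyp2F1 a' (g' - b') g' (of_real (1 - s / r)) = of_real (s / r) powr (- a') * f2
          (of_real ((1 - u) * (1 - 1 / s)))"
      proof -
        have sr: "0 < s / r" "s / r < 1" using s r0 rs by auto
        have F: "f2 (of_real (1 - 1 / (s / r))) = of_real (s / r) powr a' * hyp2F1 a' (g' - b')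
            g' (of_real (1 - s / r))"
          unfolding f2_def by (rule hyp2F1_pfaff_real[OF g(2) sr])
        have one: "complex_of_real (s / r) powr a' * of_real (s / r) powr (- a') = 1"
          using sr by (simp add: of_real_powr_exp exp_minus del: of_real_divide)
        have "of_real (s / r) powr (- a') * f2 (of_real ((1 - u) * (1 - 1 / s))) =
            (complex_of_real (s / r) powr a' * of_real (s / r) powr (- a')) * hyp2F1 a' (g' -
                b') g' (of_real (1 - s / r))"
          unfolding F[unfolded e3] by (simp only: mult_ac)
        then show ?thesis unfolding one by simp
      qed
      have k1: "hyp_kernel a b g (g' - a') r = exp ((g' - a') * R) * exp ((g - 1) * (A + B)) *
          rGamma g * f1 (of_real u * of_real (1 - s))"
      proof -
        have "complex_of_real (1 - r) powr (g - 1) = exp ((g - 1) * (A + B))"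
          unfolding e1 using s u by (subst of_real_powr_exp) (auto simp: ln_mult A_def B_def)
        moreover have "complex_of_real (1 - r) = of_real u * of_real (1 - s)" by (simp add: e1
            mult.commute del: of_real_diff)
        ultimately show ?thesis using r0 by (simp only: hyp_kernel_def of_real_powr_exp f1_def
            R_def)
      qed
      have k2: "hyp_kernel a' (g' - b') g' 0 (s / r) = exp ((g' - 1) * (A + C - R)) * rGamma g'
          * exp (- a' * (S - R)) * f2 (of_real (1 - u) * of_real (1 - 1 / s))"
      proof -
        have "complex_of_real (1 - s / r) powr (g' - 1) = exp ((g' - 1) * (A + C - R))"
          unfolding e2 using s u r0 by (subst of_real_powr_exp) (auto simp: ln_mult ln_div A_def
              C_def R_def)
        moreover have "complex_of_real (s / r) powr (- a') = exp (- a' * (S - R))"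
          using s r0 by (subst of_real_powr_exp) (auto simp: ln_div S_def R_def)
        moreover have "complex_of_real (s / r) powr 0 = 1" using s r0 by simp
        ultimately show ?thesis unfolding hyp_kernel_def f2 by (simp only: of_real_mult mult_1
            mult.assoc)
      qed
      have r_exp: "complex_of_real r = exp R" and s_exp: "complex_of_real (1 - s) = exp A"
        using r0 s by (simp_all add: R_def A_def exp_of_real del: of_real_diff)
      have w: "beta_weight g g' u = exp ((g - 1) * B) * exp ((g' - 1) * C)"
        using u by (simp add: beta_weight_def of_real_powr_exp B_def C_def del: of_real_diff)
      have K: "K = exp (- a' * S) * exp ((g + g' - 1) * A) * rGamma g * rGamma g'"
        unfolding K_def using s by (simp only: of_real_powr_exp S_def A_def diff_gt_0_iff_gt)
      have ex: "exp (- a' * S) * exp ((g + g' - 1) * A) * (exp ((g - 1) * B) * exp ((g' - 1) * C)) =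
         exp A * (exp ((g' - a') * R) * exp ((g - 1) * (A + B)) * (exp ((g' - 1) * (A + C - R))
             * exp (- a' * (S - R))) / exp R)"
        unfolding exp_diff[symmetric] exp_add[symmetric] by (simp add: algebra_simps)
      have ind: "indicator {s<..<1} r = (1 :: real)" using rs r1 by simp
      define f1u f2u where "f1u = f1 (of_real u * of_real (1 - s))" and "f2u = f2 (of_real (1 -
          u) * of_real (1 - 1 / s))"
      have "K * (beta_weight g g' u * (f1u * f2u)) =
         (exp (- a' * S) * exp ((g + g' - 1) * A) * (exp ((g - 1) * B) * exp ((g' - 1) * C))) *
             (rGamma g * rGamma g' * f1u * f2u)"
        unfolding K w by (simp only: mult_ac)
      also have "\<dots> = of_real (1 - s) * (indicator {s<..<1} r *\<^sub>R (hyp_kernel a b g (g' - a') r *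
          hyp_kernel a' (g' - b') g' 0 (s / r) / of_real r))"
        unfolding ex k1 k2 f1u_def[symmetric] f2u_def[symmetric] unfolding r_exp s_exp ind
        by (simp only: scaleR_one times_divide_eq_left times_divide_eq_right mult_ac)
      finally show "K * (beta_weight g g' u * (f1 (of_real u * of_real (1 - s)) * f2 (of_real (1
          - u) * of_real (1 - 1 / s)))) =
         of_real (1 - s) * (indicator {s<..<1} r *\<^sub>R (hyp_kernel a b g (g' - a') r * hyp_kernel
             a' (g' - b') g' 0 (s / r) / of_real r))"
        unfolding f1u_def f2u_def .
    next
      case False
      have "r \<notin> {s<..<1}"
      proof
        assume "r \<in> {s<..<1}"
        then have "(1 - s) * u > 0" "(1 - s) * (1 - u) > 0" by (auto simp: r_def algebra_simps)
        then have "u > 0" "u < 1" using s by (auto simp: zero_less_mult_iff)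
        then show False using False by simp
      qed
      then show "K * (beta_weight g g' u * (f1 (of_real u * of_real (1 - s)) * f2 (of_real (1 -
          u) * of_real (1 - 1 / s)))) =
         of_real (1 - s) * (indicator {s<..<1} r *\<^sub>R (hyp_kernel a b g (g' - a') r * hyp_kernel
             a' (g' - b') g' 0 (s / r) / of_real r))"
        using False by (simp add: beta_weight_def)
    qed
  qed
  also have "\<dots> = mult_conv (hyp_kernel a b g (g' - a')) (hyp_kernel a' (g' - b') g' 0) s"
  proof -
    define H where "H r = indicator {s<..<1} r *\<^sub>R (hyp_kernel a b g (g' - a') r * hyp_kernel a'
        (g' - b') g' 0 (s / r) / of_real r)" for r
    have "(\<integral>r. H r \<partial>lborel) = \<bar>- (1 - s)\<bar> *\<^sub>R (\<integral>u. H (1 + - (1 - s) * u) \<partial>lborel)"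
      using s by (intro lborel_integral_real_affine) simp
    also have "\<dots> = of_real (1 - s) * (\<integral>u. H (1 + - (1 - s) * u) \<partial>lborel)"
      using s by (simp only: abs_minus_cancel abs_of_pos diff_gt_0_iff_gt scaleR_conv_of_real)
    also have "\<dots> = (\<integral>u. of_real (1 - s) * H (1 + - (1 - s) * u) \<partial>lborel)"
      by (rule integral_mult_right_zero[symmetric])
    finally show ?thesis unfolding H_def mult_conv_def ..
  qed
  finally show ?thesis .
qed

lemma has_mellin_cong:
  assumes "\<And>s. 0 < s \<Longrightarrow> s < 1 \<Longrightarrow> f s = g s"
  shows "has_mellin f \<rho> I \<longleftrightarrow> has_mellin g \<rho> I"
proof -
  have "(\<lambda>s. indicator {0<..<1} s *\<^sub>R (of_real s powr (\<rho> - 1) * f s)) =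
        (\<lambda>s. indicator {0<..<1} s *\<^sub>R (of_real s powr (\<rho> - 1) * g s))"
  proof
    fix s
    show "indicator {0<..<1} s *\<^sub>R (of_real s powr (\<rho> - 1) * f s) =
          indicator {0<..<1} s *\<^sub>R (of_real s powr (\<rho> - 1) * g s)"
      using assms[of s] by (cases "s \<in> {0<..<1}") simp_all
  qed
  then show ?thesis by (simp only: has_mellin_def)
qed

text \<open>The convolution formula has the spurious Gamma factor with argument \<open>\<rho> + g - a'\<close>. It
    cancels in
  the product, but its pole restricts the range of convergence, so the formula is obtained
  only far to the right. There the kernel is identified with the one of
  \<open>ex_gamma_ratio3_kernel\<close>, which is transformable on the full half plane.\<close>

theorem has_mellin_appell_kernel:
  assumes c: "Re c > 0" and \<rho>: "Re \<rho> > 0" "Re (\<rho> + (b' - a')) > 0" "Re (\<rho> + (c - a - a' - b)) > 0"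
  shows "has_mellin (appell_kernel a a' b b' c) \<rho>
           (gamma_ratio3 0 (b' - a') (c - a - a' - b) b' (c - a - a') (c - a' - b) \<rho>)"
proof -
  \<comment> \<open>Any splitting of \<open>c\<close> into two parts with positive real part would serve.\<close>
  define g where "g = c / 2"
  have g: "Re g > 0" "c = g + g" using c by (simp_all add: g_def)
  define \<Phi> where "\<Phi> = gamma_ratio3 0 (b' - a') (c - a - a' - b) b' (c - a - a') (c - a' - b)"
  have "Re (0 + (b' - a') + (c - a - a' - b)) < Re (b' + (c - a - a') + (c - a' - b))" using c
      by simp
  from ex_gamma_ratio3_kernel[OF this] obtain k where
    "\<And>\<rho>. Re (\<rho> + 0) > 0 \<Longrightarrow> Re (\<rho> + (b' - a')) > 0 \<Longrightarrow> Re (\<rho> + (c - a - a' - b)) > 0 \<Longrightarrow>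
       has_mellin k \<rho> (gamma_ratio3 0 (b' - a') (c - a - a' - b) b' (c - a - a') (c - a' - b) \<rho>)"
    by blast
  then have k: "\<And>\<rho>. Re \<rho> > 0 \<Longrightarrow> Re (\<rho> + (b' - a')) > 0 \<Longrightarrow> Re (\<rho> + (c - a - a' - b)) > 0 \<Longrightarrow>
       has_mellin k \<rho> (\<Phi> \<rho>)"
    by (simp add: \<Phi>_def)
  \<comment> \<open>far enough to the right for all Gamma factors, the spurious one included\<close>
  define \<rho>0 where "\<rho>0 = complex_of_real (1 + \<bar>Re (b' - a')\<bar> + \<bar>Re (c - a - a' - b)\<bar> + \<bar>Re (g -
      a')\<bar>)"
  have \<rho>0: "Re (\<rho>0 + of_nat n) > 0" "Re (\<rho>0 + of_nat n + (b' - a')) > 0" "Re (\<rho>0 + of_nat n + (c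
      - a - a' - b)) > 0"
    "Re (\<rho>0 + of_nat n + (g - a')) > 0" for n
    unfolding \<rho>0_def by auto
  have F3: "has_mellin (appell_kernel a a' b b' c) (\<rho>0 + of_nat n) (\<Phi> (\<rho>0 + of_nat n))" for n
  proof -
    define \<sigma> where "\<sigma> = \<rho>0 + of_nat n"
    note \<sigma> = \<rho>0[of n, folded \<sigma>_def]
    have eqs: "\<sigma> + (g - a') + g - a - b = \<sigma> + (c - a - a' - b)" "\<sigma> + (g - a') + g - a = \<sigma> + (c -
        a - a')"
      "\<sigma> + (g - a') + g - b = \<sigma> + (c - a' - b)"
      "\<sigma> + 0 + g - a' - (g - b') = \<sigma> + (b' - a')" "\<sigma> + 0 + g - a' = \<sigma> + (g - a')" "\<sigma> + 0 + g -
          (g - b') = \<sigma> + b'"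
      "\<sigma> + (c - a - a') - b = \<sigma> + (c - a - a' - b)" "\<sigma> + (g - a') - (g - b') = \<sigma> + (b' - a')"
      unfolding g(2) by (simp_all add: algebra_simps)
    have "has_mellin (mult_conv (hyp_kernel a b g (g - a')) (hyp_kernel a' (g - b') g 0)) \<sigma>
       ((Gamma (\<sigma> + (g - a')) * Gamma (\<sigma> + (g - a') + g - a - b) * rGamma (\<sigma> + (g - a') + g - a)
           * rGamma (\<sigma> + (g - a') + g - b)) *
        (Gamma (\<sigma> + 0) * Gamma (\<sigma> + 0 + g - a' - (g - b')) * rGamma (\<sigma> + 0 + g - a') * rGamma (\<sigma>
            + 0 + g - (g - b'))))"
      by (intro has_mellin_mult_conv has_mellin_hyp_kernel g(1)) (unfold eqs, use \<sigma> in auto)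
    moreover have "Gamma (\<sigma> + (g - a')) * rGamma (\<sigma> + (g - a')) = 1"
      using Re_pos_not_nonpos_Int[OF \<sigma>(4)] by (simp add: rGamma_inverse_Gamma Gamma_eq_zero_iff)
    then have "(Gamma (\<sigma> + (g - a')) * Gamma (\<sigma> + (g - a') + g - a - b) * rGamma (\<sigma> + (g - a') +
        g - a) * rGamma (\<sigma> + (g - a') + g - b)) *
        (Gamma (\<sigma> + 0) * Gamma (\<sigma> + 0 + g - a' - (g - b')) * rGamma (\<sigma> + 0 + g - a') * rGamma (\<sigma>
            + 0 + g - (g - b'))) = \<Phi> \<sigma>"
      unfolding eqs \<Phi>_def gamma_ratio3_def by algebra
    ultimately have "has_mellin (mult_conv (hyp_kernel a b g (g - a')) (hyp_kernel a' (g - b') g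
        0)) \<sigma> (\<Phi> \<sigma>)" by simp
    moreover have "appell_kernel a a' b b' c s = mult_conv (hyp_kernel a b g (g - a'))
        (hyp_kernel a' (g - b') g 0) s"
      if "0 < s" "s < 1" for s
      unfolding g(2) using g(1) that by (rule appell_kernel_eq_mult_conv[OF g(1)])
    ultimately show ?thesis unfolding \<sigma>_def[symmetric] using has_mellin_cong by blast
  qed
  have "has_mellin (appell_kernel a a' b b' c) \<rho> (\<Phi> \<rho>)"
  proof (rule has_mellin_transfer[OF F3])
    show "has_mellin k (\<rho>0 + of_nat n) (\<Phi> (\<rho>0 + of_nat n))" for n using \<rho>0 by (intro k) auto
    show "has_mellin k \<rho> (\<Phi> \<rho>)" using \<rho> by (intro k) auto
  qed
  then show ?thesis by (simp only: \<Phi>_def)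
qed

section \<open>Powers under the fractional operators, and the theorem\<close>

text \<open>The factor that a power \<open>t powr (\<rho> - 1)\<close> acquires under the Marichev-Saigo-Maeda integral.\<close>

abbreviation MSM_gamma :: "complex \<Rightarrow> complex \<Rightarrow> complex \<Rightarrow> complex \<Rightarrow> complex \<Rightarrow> complex \<Rightarrow> complex"
    where
  "MSM_gamma a a' b b' c \<equiv> gamma_ratio3 0 (b' - a') (c - a - a' - b) b' (c - a - a') (c - a' - b)"

lemma of_real_powr_mult:
  "x > 0 \<Longrightarrow> y > 0 \<Longrightarrow> complex_of_real (x * y) powr z = of_real x powr z * of_real y powr z"
  using powr_times_real[of "of_real x" "of_real y" z] by simp

lemma has_bochner_integral_MSM_powr:
  assumes c: "Re c > 0" and \<rho>: "Re \<rho> > 0" "Re (\<rho> + (b' - a')) > 0" "Re (\<rho> + (c - a - a' - b)) > 0"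
    and x: "x > 0"
  shows "has_bochner_integral lborel (\<lambda>t. indicator {0<..<x} t *\<^sub>R
       (of_real (x - t) powr (c - 1) * of_real t powr (- a') *
        appell_F3 a a' b b' c (of_real (1 - t / x)) (of_real (1 - x / t)) * of_real t powr (\<rho> - 1)))
     (Gamma c * of_real x powr (\<rho> + c - a' - 1) * MSM_gamma a a' b b' c \<rho>)"
proof -
  define H where "H s = indicator {0<..<1} s *\<^sub>R (of_real s powr (\<rho> - 1) * appell_kernel a a' b
      b' c s)" for s
  \<comment> \<open>the powers of \<open>x\<close> split off by \<open>t = x s\<close>\<close>
  define K where "K = Gamma c * of_real x powr (c - 1) * of_real x powr (- a') * of_real x powr
      (\<rho> - 1)"
  have H: "integrable lborel H" "integral\<^sup>L lborel H = MSM_gamma a a' b b' c \<rho>"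
    using has_mellin_appell_kernel[OF c \<rho>] by (auto simp: has_mellin_def
        has_bochner_integral_iff H_def[abs_def])
  have int: "integrable lborel (\<lambda>t. H (t / x))"
    using lborel_integrable_real_affine[OF H(1), of "1 / x" 0] x by simp
  have "integral\<^sup>L lborel H = (1 / x) *\<^sub>R (\<integral>t. H (t / x) \<partial>lborel)"
    using lborel_integral_real_affine[of "1 / x" H 0] x by simp
  then have val: "(\<integral>t. H (t / x) \<partial>lborel) = of_real x * MSM_gamma a a' b b' c \<rho>"
    using x H(2) by (simp add: scaleR_conv_of_real field_simps)
  have G0: "Gamma c \<noteq> 0" using Re_pos_not_nonpos_Int[OF c] by (simp add: Gamma_eq_zero_iff)
  have eq: "indicator {0<..<x} t *\<^sub>R
       (of_real (x - t) powr (c - 1) * of_real t powr (- a') *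
        appell_F3 a a' b b' c (of_real (1 - t / x)) (of_real (1 - x / t)) * of_real t powr (\<rho> -
            1)) = K * H (t / x)" for t
  proof (cases "t \<in> {0<..<x}")
    case True
    define s where "s = t / x"
    have s: "0 < s" "s < 1" "t = x * s" using True x by (auto simp: s_def)
    have e: "x - t = x * (1 - s)" "x / t = 1 / s" using x s(1) unfolding s(3) by (simp_all add:
        algebra_simps)
    have m1: "complex_of_real (x * (1 - s)) powr z = of_real x powr z * of_real (1 - s) powr z"
        for z
      using s by (intro of_real_powr_mult x) simp
    have m2: "complex_of_real (x * s) powr z = of_real x powr z * of_real s powr z" for z
      using s by (intro of_real_powr_mult x) simp
    have GG: "Gamma c * rGamma c = 1" using G0 by (simp add: rGamma_inverse_Gamma)
    have "K * H s = Gamma c * rGamma c * (of_real x powr (c - 1) * of_real (1 - s) powr (c - 1)) *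
       (of_real x powr (- a') * of_real s powr (- a')) *
        appell_F3 a a' b b' c (of_real (1 - s)) (of_real (1 - 1 / s)) * (of_real x powr (\<rho> - 1)
            * of_real s powr (\<rho> - 1))"
      using s by (simp add: K_def H_def appell_kernel_def mult_ac del: of_real_diff of_real_divide)
    also have "\<dots> = of_real (x - t) powr (c - 1) * of_real t powr (- a') *
        appell_F3 a a' b b' c (of_real (1 - s)) (of_real (1 - 1 / s)) * of_real t powr (\<rho> - 1)"
      unfolding e(1) unfolding s(3) m1 m2 GG by (simp only: mult_1)
    finally show ?thesis using True unfolding s_def[symmetric] e(2) by simp
  next
    case False
    then have "t / x \<notin> {0<..<1}" using x by (auto simp: field_simps)
    then show ?thesis using False by (simp add: H_def)
  qed
  have "has_bochner_integral lborel (\<lambda>t. K * H (t / x)) (K * (of_real x * MSM_gamma a a' b b' c \<rho>))"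
    using int val by (simp add: has_bochner_integral_iff)
  moreover have "K * (of_real x * MSM_gamma a a' b b' c \<rho>) = Gamma c * of_real x powr (\<rho> + c -
      a' - 1) * MSM_gamma a a' b b' c \<rho>"
  proof -
    have "of_real x powr (\<rho> + c - a' - 1) = of_real x powr ((c - 1) + (- a') + (\<rho> - 1) + 1)" by
        (simp add: algebra_simps)
    also have "\<dots> = of_real x powr (c - 1) * of_real x powr (- a') * of_real x powr (\<rho> - 1) *
        of_real x"
    proof -
      have "complex_of_real x powr 1 = of_real x" using x by simp
      then show ?thesis by (simp only: powr_add)
    qed
    finally show ?thesis by (simp add: K_def mult_ac)
  qed
  ultimately show ?thesis unfolding eq by simp
qed

lemma MSM_integral_powr_sum:
  assumes c: "Re c > 0" and \<tau>: "Re \<tau> > 0" "Re (\<tau> + (b' - a')) > 0" "Re (\<tau> + (c - a - a' - b)) > 0"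
    and x: "x > 0" and f: "\<And>t. t > 0 \<Longrightarrow> f t = (\<Sum>j\<le>n. C j * of_real t powr (\<tau> + of_nat j - 1))"
  shows "MSM_integral a a' b b' c f x =
    (\<Sum>j\<le>n. C j * MSM_gamma a a' b b' c (\<tau> + of_nat j) * of_real x powr (\<tau> + of_nat j + c - a -
        a' - 1))"
proof -
  define g where "g \<rho> t = indicator {0<..<x} t *\<^sub>R
       (of_real (x - t) powr (c - 1) * of_real t powr (- a') *
        appell_F3 a a' b b' c (of_real (1 - t / x)) (of_real (1 - x / t)) * of_real t powr (\<rho> -
            1))" for \<rho> t
  have g: "has_bochner_integral lborel (g (\<tau> + of_nat j)) (Gamma c * of_real x powr (\<tau> + of_nat
      j + c - a' - 1) * MSM_gamma a a' b b' c (\<tau> + of_nat j))" for j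
    unfolding g_def using \<tau> by (intro has_bochner_integral_MSM_powr c x) auto
  have "indicator {0<..<x} t *\<^sub>R (of_real (x - t) powr (c - 1) * of_real t powr (- a') *
        appell_F3 a a' b b' c (of_real (1 - t / x)) (of_real (1 - x / t)) * f t) = (\<Sum>j\<le>n. C j *
            g (\<tau> + of_nat j) t)" for t
  proof (cases "t \<in> {0<..<x}")
    case True
    then show ?thesis by (simp add: f g_def sum_distrib_left sum_distrib_right mult_ac)
  qed (simp add: g_def)
  then have "(LINT t:{0<..<x}|lborel. of_real (x - t) powr (c - 1) * of_real t powr (- a') *
        appell_F3 a a' b b' c (of_real (1 - t / x)) (of_real (1 - x / t)) * f t) = (\<integral>t. (\<Sum>j\<le>n. C
            j * g (\<tau> + of_nat j) t) \<partial>lborel)"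
    unfolding set_lebesgue_integral_def by (simp only:)
  also have "\<dots> = (\<Sum>j\<le>n. C j * (Gamma c * of_real x powr (\<tau> + of_nat j + c - a' - 1) * MSM_gamma
      a a' b b' c (\<tau> + of_nat j)))"
    using g by (subst Bochner_Integration.integral_sum) (auto simp: has_bochner_integral_iff)
  finally have I: "(LINT t:{0<..<x}|lborel. of_real (x - t) powr (c - 1) * of_real t powr (- a') *
        appell_F3 a a' b b' c (of_real (1 - t / x)) (of_real (1 - x / t)) * f t) =
        (\<Sum>j\<le>n. C j * (Gamma c * of_real x powr (\<tau> + of_nat j + c - a' - 1) * MSM_gamma a a' b b'
            c (\<tau> + of_nat j)))" .
  have G0: "Gamma c \<noteq> 0" using Re_pos_not_nonpos_Int[OF c] by (simp add: Gamma_eq_zero_iff)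
  show ?thesis unfolding MSM_integral_def I sum_distrib_left
  proof (rule sum.cong[OF refl])
    fix j
    have "of_real x powr (\<tau> + of_nat j + c - a - a' - 1) = of_real x powr (- a + (\<tau> + of_nat j +
        c - a' - 1))"
      by (simp add: algebra_simps)
    also have "\<dots> = of_real x powr (- a) * of_real x powr (\<tau> + of_nat j + c - a' - 1)" by (rule
        powr_add)
    finally show "of_real x powr (- a) / Gamma c * (C j * (Gamma c * of_real x powr (\<tau> + of_nat
        j + c - a' - 1) * MSM_gamma a a' b b' c (\<tau> + of_nat j)))
       = C j * MSM_gamma a a' b b' c (\<tau> + of_nat j) * of_real x powr (\<tau> + of_nat j + c - a - a'
           - 1)"
      using G0 by (simp add: mult_ac)
  qed
qed

lemma has_vector_derivative_of_real_powr:
  fixes w :: complex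
  assumes "x > 0"
  shows "((\<lambda>x. of_real x powr w) has_vector_derivative (w * of_real x powr (w - 1))) (at x)"
proof -
  have "((\<lambda>z :: complex. z powr w) has_field_derivative (w * of_real x powr (w - 1))) (at
      (of_real x))"
    using assms by (intro has_field_derivative_powr) (auto simp: complex_nonpos_Reals_iff)
  then show ?thesis by (rule has_vector_derivative_real_field)
qed

text \<open>The counter \<open>k - i\<close> keeps the exponents in the form in which each derivative extends the
  Pochhammer symbol at its lower end.\<close>

lemma iterated_derivative_powr_sum:
  fixes E s :: "nat \<Rightarrow> complex"
  assumes g: "\<And>x::real. x > 0 \<Longrightarrow> g x = (\<Sum>j\<le>n. E j * of_real x powr (s j + of_nat k - 1))"
    and "i \<le> k" "x > 0"
  shows "((\<lambda>g x. vector_derivative g (at x)) ^^ i) g x =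
    (\<Sum>j\<le>n. E j * pochhammer (s j + of_nat (k - i)) i * of_real x powr (s j + of_nat (k - i) - 1))"
  using assms(2,3)
proof (induction i arbitrary: x)
  case 0
  then show ?case using g by simp
next
  case (Suc i)
  define G where "G = (\<lambda>x. \<Sum>j\<le>n. E j * pochhammer (s j + of_nat (k - i)) i * of_real x powr (s j
      + of_nat (k - i) - 1))"
  have "(G has_vector_derivative (\<Sum>j\<le>n. E j * pochhammer (s j + of_nat (k - i)) i *
          ((s j + of_nat (k - i) - 1) * of_real x powr (s j + of_nat (k - i) - 1 - 1)))) (at x)"
    unfolding G_def using Suc.prems
    by (intro has_vector_derivative_sum has_vector_derivative_mult_right
        has_vector_derivative_of_real_powr) auto
  then have "(((\<lambda>g x. vector_derivative g (at x)) ^^ i) g has_vector_derivative (\<Sum>j\<le>n. E j *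
      pochhammer (s j + of_nat (k - i)) i *
          ((s j + of_nat (k - i) - 1) * of_real x powr (s j + of_nat (k - i) - 1 - 1)))) (at x)"
    by (rule has_vector_derivative_transform_within_open[where S = "{0<..}"]) (use Suc in \<open>auto
        simp: G_def\<close>)
  then have "((\<lambda>g x. vector_derivative g (at x)) ^^ Suc i) g x = (\<Sum>j\<le>n. E j * pochhammer (s j +
      of_nat (k - i)) i *
          ((s j + of_nat (k - i) - 1) * of_real x powr (s j + of_nat (k - i) - 1 - 1)))"
    by (simp add: vector_derivative_at)
  also have "\<dots> = (\<Sum>j\<le>n. E j * pochhammer (s j + of_nat (k - Suc i)) (Suc i) * of_real x powr (s
      j + of_nat (k - Suc i) - 1))"
  proof (rule sum.cong[OF refl])
    fix j
    have "k - i = Suc (k - Suc i)" using Suc.prems by simp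
    then have e: "s j + of_nat (k - i) = s j + of_nat (k - Suc i) + 1" by simp
    show "E j * pochhammer (s j + of_nat (k - i)) i * ((s j + of_nat (k - i) - 1) * of_real x
        powr (s j + of_nat (k - i) - 1 - 1)) =
      E j * pochhammer (s j + of_nat (k - Suc i)) (Suc i) * of_real x powr (s j + of_nat (k -
          Suc i) - 1)"
      unfolding e pochhammer_rec by (simp add: mult_ac)
  qed
  finally show ?case .
qed

text \<open>The coefficients of the Jacobi type polynomial, apart from signs, as a hypergeometric
    term; this
  is where the parameters \<open>1 + n - p\<close>, \<open>- n\<close> and \<open>q + 1\<close> come from.\<close>

lemma jacobi_type_M_coeff:
  fixes p q :: complex
  assumes q: "\<And>j::nat. j \<ge> 1 \<Longrightarrow> q \<noteq> - of_nat j" and j: "j \<le> n"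
  shows "fact n * ((p - of_nat n - 1) gchoose j) * ((q + of_nat n) gchoose (n - j)) =
    Gamma (q + of_nat n + 1) / Gamma (q + 1) *
      (pochhammer (1 + of_nat n - p) j * pochhammer (- of_nat n) j / (pochhammer (q + 1) j *
          fact j))"
proof -
  have q1: "q + 1 \<notin> \<int>\<^sub>\<le>\<^sub>0"
  proof
    assume "q + 1 \<in> \<int>\<^sub>\<le>\<^sub>0"
    then obtain m where m: "q + 1 = - of_nat m" by (elim nonpos_Ints_cases')
    have "q = (q + 1) - 1" by simp
    also have "\<dots> = - of_nat (Suc m)" unfolding m by simp
    finally have "q = - of_nat (Suc m)" .
    with q[of "Suc m"] show False by simp
  qed
  have P: "pochhammer (q + 1) n = Gamma (q + of_nat n + 1) / Gamma (q + 1)"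
    using pochhammer_Gamma[OF q1, of n] by (simp add: add_ac)
  have nz: "pochhammer (q + 1) j \<noteq> 0"
    using q1 by (auto simp: pochhammer_eq_0_iff)
  have A: "(p - of_nat n - 1) gchoose j = (- 1) ^ j * pochhammer (1 + of_nat n - p) j / fact j"
    by (simp add: gbinomial_pochhammer algebra_simps)
  have q_shift: "q + of_nat n - of_nat (n - j) + 1 = q + 1 + of_nat j" using j by (simp add:
      of_nat_diff)
  have B: "(q + of_nat n) gchoose (n - j) = pochhammer (q + 1 + of_nat j) (n - j) / fact (n - j)"
    unfolding gbinomial_pochhammer' q_shift ..
  have C: "pochhammer (q + 1) n = pochhammer (q + 1) j * pochhammer (q + 1 + of_nat j) (n - j)"
    using j by (rule pochhammer_product)
  have "pochhammer (- of_nat n :: complex) j = (- 1) ^ j * pochhammer (of_nat n - of_nat j + 1) j"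
    by (simp add: pochhammer_minus)
  also have "pochhammer (of_nat n - of_nat j + 1 :: complex) j = (of_nat n gchoose j) * fact j"
    by (simp add: gbinomial_pochhammer')
  also have "\<dots> = of_nat (n choose j) * fact j" by (simp add: binomial_gbinomial)
  also have "(of_nat (n choose j) :: complex) = fact n / (fact j * fact (n - j))"
    using j by (rule binomial_fact)
  finally have D: "pochhammer (- of_nat n :: complex) j = (- 1) ^ j * (fact n / fact (n - j))"
      by simp
  show ?thesis
    unfolding P[symmetric] C A B D using nz by (simp add: mult_ac)
qed

lemma hypergeometric_F_terminating:
  assumes "- of_nat n \<in> set as"
  shows "hypergeometric_F as cs z =
     (\<Sum>k\<le>n. (\<Prod>a\<leftarrow>as. pochhammer a k) / (\<Prod>c\<leftarrow>cs. pochhammer c k) * (z ^ k / fact k))"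
proof -
  have "(\<Prod>a\<leftarrow>as. pochhammer a k) = 0" if "k > n" for k
    using assms pochhammer_of_nat_eq_0_lemma[OF that, where 'a = complex]
    by (auto simp: prod_list_zero_iff image_iff)
  then show ?thesis unfolding hypergeometric_F_series by (intro suminf_finite) auto
qed

lemma Gamma_plus_nat: "z \<notin> \<int>\<^sub>\<le>\<^sub>0 \<Longrightarrow> Gamma (z + of_nat j) = pochhammer z j * (Gamma z :: complex)"
  using pochhammer_Gamma[of z j] by (simp add: Gamma_eq_zero_iff)

lemma rGamma_plus_nat:
  assumes "z \<notin> \<int>\<^sub>\<le>\<^sub>0"
  shows "rGamma (z + of_nat j) = rGamma (z :: complex) / pochhammer z j"
proof -
  have "pochhammer z j \<noteq> 0" using assms by (auto simp: pochhammer_eq_0_iff)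
  then show ?thesis using pochhammer_rGamma[of z j] by simp
qed

theorem theorem3:
  fixes n :: nat
    and p q \<delta> \<delta>' \<mu> \<mu>' \<epsilon> \<tau> :: complex
    and x :: real
  assumes "\<forall>j::nat. j \<ge> 1 \<longrightarrow> q \<noteq> - of_nat j"
    and "Re \<epsilon> > 0"
    and "Re \<tau> > Max {0, Re (- \<delta> + \<mu>), Re (- \<delta> - \<delta>' - \<mu>' + \<epsilon>)}"
    and "\<tau> - \<mu> \<notin> \<int>\<^sub>\<le>\<^sub>0"
    and "\<tau> + \<delta> + \<delta>' - \<epsilon> \<notin> \<int>\<^sub>\<le>\<^sub>0"
    and "\<tau> + \<delta> + \<mu>' - \<epsilon> \<notin> \<int>\<^sub>\<le>\<^sub>0"
    and "x > 0"
  shows "MSM_derivative \<delta> \<delta>' \<mu> \<mu>' \<epsilon>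
           (\<lambda>t. of_real t powr (\<tau> - 1) * jacobi_type_M n p q (of_real t)) x =
         (-1) ^ n * Gamma (q + of_nat n + 1) * Gamma \<tau> * Gamma (\<tau> + \<delta> - \<mu>) *
           Gamma (\<tau> + \<delta> + \<delta>' + \<mu>' - \<epsilon>) /
         (Gamma (q + 1) * Gamma (\<tau> - \<mu>) * Gamma (\<tau> + \<delta> + \<delta>' - \<epsilon>) *
           Gamma (\<tau> + \<delta> + \<mu>' - \<epsilon>)) *
         of_real x powr (\<delta> + \<delta>' - \<epsilon> + \<tau> - 1) *
         hypergeometric_F
           [1 + of_nat n - p, - of_nat n, \<tau>, - \<mu> + \<delta> + \<tau>, \<delta> + \<delta>' + \<mu>' - \<epsilon> + \<tau>]
           [q + 1, - \<mu> + \<tau>, \<delta> + \<delta>' - \<epsilon> + \<tau>, \<delta> + \<mu>' - \<epsilon> + \<tau>]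
           (- of_real x)"
proof -
  \<comment> \<open>\<open>k\<close> exceeds \<open>Re \<epsilon>\<close>, so the order \<open>c\<close> of the inner integral has positive real part.\<close>
  define k where "k = nat \<lfloor>Re \<epsilon>\<rfloor> + 1"
  define c where "c = - \<epsilon> + of_nat k"
  have c: "Re c > 0" using assms(2) unfolding c_def k_def by simp linarith
  have \<tau>: "Re \<tau> > 0" "Re (\<tau> + \<delta> - \<mu>) > 0" "Re (\<tau> + \<delta> + \<delta>' + \<mu>' - \<epsilon>) > 0"
    using assms(3) by auto
  define C where "C j = (- 1) ^ n * fact n * (((p - of_nat n - 1) gchoose j) * ((q + of_nat n) gchoose (n - j)) * (- 1) ^ j)" for j
  have f: "of_real t powr (\<tau> - 1) * jacobi_type_M n p q (of_real t) = (\<Sum>j\<le>n. C j * of_real t powr (\<tau> + of_nat j - 1))"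
    if "t > 0" for t
  proof -
    have "of_real t powr (\<tau> + of_nat j - 1) = of_real t powr (\<tau> - 1) * of_real t ^ j" for j
      using powr_add[of "of_real t" "\<tau> - 1" "of_nat j"] that by (simp add: powr_nat algebra_simps)
    moreover have "(- complex_of_real t) ^ j = (- 1) ^ j * of_real t ^ j" for j by (rule power_minus)
    ultimately show ?thesis
      by (simp only: jacobi_type_M_def C_def sum_distrib_left atMost_atLeast0 mult_ac)
  qed
  \<comment> \<open>After the inner integral the exponents of \<open>x\<close> are \<open>s j + k - 1\<close>, and \<open>k\<close> derivatives bring
     them down to \<open>s j - 1\<close>.\<close>
  define s where "s j = \<tau> + of_nat j + \<delta> + \<delta>' - \<epsilon>" for j :: nat
  define R where "R j = MSM_gamma (- \<delta>') (- \<delta>) (- \<mu>' + of_nat k) (- \<mu>) c (\<tau> + of_nat j)" for j :: nat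
  have I: "MSM_integral (- \<delta>') (- \<delta>) (- \<mu>' + of_nat k) (- \<mu>) c
      (\<lambda>t. of_real t powr (\<tau> - 1) * jacobi_type_M n p q (of_real t)) y =
      (\<Sum>j\<le>n. C j * R j * of_real y powr (s j + of_nat k - 1))" if "y > 0" for y
  proof -
    have e: "\<tau> + of_nat j + c - (- \<delta>') - (- \<delta>) - 1 = s j + of_nat k - 1" for j
      by (simp add: c_def s_def)
    show ?thesis
      unfolding R_def e[symmetric] 
      by (rule MSM_integral_powr_sum[OF c \<tau>(1) _ _ that f]) (use \<tau> in \<open>auto simp: c_def\<close>)
  qed
  have "MSM_derivative \<delta> \<delta>' \<mu> \<mu>' \<epsilon> (\<lambda>t. of_real t powr (\<tau> - 1) * jacobi_type_M n p q (of_real t)) x =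
     (\<Sum>j\<le>n. C j * R j * pochhammer (s j + of_nat (k - k)) k * of_real x powr (s j + of_nat (k - k) - 1))"
    unfolding MSM_derivative_def Let_def k_def[symmetric] c_def[symmetric]
    by (rule iterated_derivative_powr_sum[OF I]) (use assms in auto)
  also have "\<dots> = (\<Sum>j\<le>n. C j * (R j * pochhammer (s j) k) * of_real x powr (s j - 1))" by (simp add: mult.assoc)
  also have "\<dots> = (\<Sum>j\<le>n.
     (-1) ^ n * Gamma (q + of_nat n + 1) * Gamma \<tau> * Gamma (\<tau> + \<delta> - \<mu>) *
           Gamma (\<tau> + \<delta> + \<delta>' + \<mu>' - \<epsilon>) /
         (Gamma (q + 1) * Gamma (\<tau> - \<mu>) * Gamma (\<tau> + \<delta> + \<delta>' - \<epsilon>) *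
           Gamma (\<tau> + \<delta> + \<mu>' - \<epsilon>)) *
         of_real x powr (\<delta> + \<delta>' - \<epsilon> + \<tau> - 1) *
     ((\<Prod>a\<leftarrow>[1 + of_nat n - p, - of_nat n, \<tau>, - \<mu> + \<delta> + \<tau>, \<delta> + \<delta>' + \<mu>' - \<epsilon> + \<tau>]. pochhammer a j) /
      (\<Prod>c\<leftarrow>[q + 1, - \<mu> + \<tau>, \<delta> + \<delta>' - \<epsilon> + \<tau>, \<delta> + \<mu>' - \<epsilon> + \<tau>]. pochhammer c j) * ((- of_real x) ^ j / fact j)))"
  proof (rule sum.cong[OF refl])
    fix j assume j: "j \<in> {..n}"
    define u1 u2 u3 v1 v2 v3 where "u1 = \<tau>" and "u2 = \<tau> + \<delta> - \<mu>" and "u3 = \<tau> + \<delta> + \<delta>' + \<mu>' - \<epsilon>"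
      and "v1 = \<tau> - \<mu>" and "v2 = \<tau> + \<delta> + \<delta>' - \<epsilon>" and "v3 = \<tau> + \<delta> + \<mu>' - \<epsilon>"
    have uv: "u1 \<notin> \<int>\<^sub>\<le>\<^sub>0" "u2 \<notin> \<int>\<^sub>\<le>\<^sub>0" "u3 \<notin> \<int>\<^sub>\<le>\<^sub>0" "v1 \<notin> \<int>\<^sub>\<le>\<^sub>0" "v2 \<notin> \<int>\<^sub>\<le>\<^sub>0" "v3 \<notin> \<int>\<^sub>\<le>\<^sub>0"
      using \<tau>[THEN Re_pos_not_nonpos_Int] assms(4-6) by (auto simp: u1_def u2_def u3_def v1_def v2_def v3_def)
    have C: "C j = (- 1) ^ n * (- 1) ^ j * (Gamma (q + of_nat n + 1) / Gamma (q + 1) *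
      (pochhammer (1 + of_nat n - p) j * pochhammer (- of_nat n) j / (pochhammer (q + 1) j * fact j)))"
    proof -
      have "C j = (- 1) ^ n * (- 1) ^ j * (fact n * ((p - of_nat n - 1) gchoose j) * ((q + of_nat n) gchoose (n - j)))"
        unfolding C_def by (simp only: mult_ac)
      also have "fact n * ((p - of_nat n - 1) gchoose j) * ((q + of_nat n) gchoose (n - j)) =
          Gamma (q + of_nat n + 1) / Gamma (q + 1) *
          (pochhammer (1 + of_nat n - p) j * pochhammer (- of_nat n) j / (pochhammer (q + 1) j * fact j))"
        by (rule jacobi_type_M_coeff) (use assms(1) j in auto)
      finally show ?thesis .
    qed
    have "R j = Gamma (u1 + of_nat j) * Gamma (u2 + of_nat j) * Gamma (u3 + of_nat j) *
       rGamma (v1 + of_nat j) * rGamma (s j + of_nat k) * rGamma (v3 + of_nat j)"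
      unfolding R_def gamma_ratio3_def c_def u1_def u2_def u3_def v1_def v3_def s_def by (simp add: algebra_simps)
    moreover have "rGamma (s j + of_nat k) * pochhammer (s j) k = rGamma (v2 + of_nat j)"
      using pochhammer_rGamma[of "s j" k] by (simp add: s_def v2_def algebra_simps)
    ultimately have "R j * pochhammer (s j) k = Gamma (u1 + of_nat j) * Gamma (u2 + of_nat j) * Gamma (u3 + of_nat j) *
       rGamma (v1 + of_nat j) * rGamma (v2 + of_nat j) * rGamma (v3 + of_nat j)"
      by (simp add: mult_ac)
    then have R: "R j * pochhammer (s j) k = Gamma u1 * Gamma u2 * Gamma u3 / (Gamma v1 * Gamma v2 * Gamma v3) *
       (pochhammer u1 j * pochhammer u2 j * pochhammer u3 j / (pochhammer v1 j * pochhammer v2 j * pochhammer v3 j))"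
      unfolding Gamma_plus_nat[OF uv(1)] Gamma_plus_nat[OF uv(2)] Gamma_plus_nat[OF uv(3)]
        rGamma_plus_nat[OF uv(4)] rGamma_plus_nat[OF uv(5)] rGamma_plus_nat[OF uv(6)]
      unfolding rGamma_inverse_Gamma
      by (simp add: divide_inverse mult_ac)
    have X: "of_real x powr (s j - 1) = of_real x powr (\<delta> + \<delta>' - \<epsilon> + \<tau> - 1) * of_real x ^ j"
      using powr_add[of "of_real x" "\<delta> + \<delta>' - \<epsilon> + \<tau> - 1" "of_nat j"] assms(7) by (simp add: s_def powr_nat algebra_simps)
    have M: "(- complex_of_real x) ^ j = (- 1) ^ j * of_real x ^ j" by (rule power_minus)
    have e: "- \<mu> + \<delta> + \<tau> = u2" "\<delta> + \<delta>' + \<mu>' - \<epsilon> + \<tau> = u3" "- \<mu> + \<tau> = v1" "\<delta> + \<delta>' - \<epsilon> + \<tau> = v2" "\<delta> + \<mu>' - \<epsilon> + \<tau> = v3"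
      by (simp_all add: u2_def u3_def v1_def v2_def v3_def algebra_simps)
    show "C j * (R j * pochhammer (s j) k) * of_real x powr (s j - 1) =
      (-1) ^ n * Gamma (q + of_nat n + 1) * Gamma \<tau> * Gamma (\<tau> + \<delta> - \<mu>) *
           Gamma (\<tau> + \<delta> + \<delta>' + \<mu>' - \<epsilon>) /
         (Gamma (q + 1) * Gamma (\<tau> - \<mu>) * Gamma (\<tau> + \<delta> + \<delta>' - \<epsilon>) *
           Gamma (\<tau> + \<delta> + \<mu>' - \<epsilon>)) *
         of_real x powr (\<delta> + \<delta>' - \<epsilon> + \<tau> - 1) *
      ((\<Prod>a\<leftarrow>[1 + of_nat n - p, - of_nat n, \<tau>, - \<mu> + \<delta> + \<tau>, \<delta> + \<delta>' + \<mu>' - \<epsilon> + \<tau>]. pochhammer a j) /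
      (\<Prod>c\<leftarrow>[q + 1, - \<mu> + \<tau>, \<delta> + \<delta>' - \<epsilon> + \<tau>, \<delta> + \<mu>' - \<epsilon> + \<tau>]. pochhammer c j) * ((- of_real x) ^ j / fact j))"
      unfolding C R X M e u1_def u2_def[symmetric] u3_def[symmetric] v1_def[symmetric] v2_def[symmetric] v3_def[symmetric]
      by (simp only: list.map prod_list.Cons prod_list.Nil mult_1_right mult_1 times_divide_eq_left times_divide_eq_right
            divide_divide_eq_left mult_ac)
  qed
  also have "\<dots> = (-1) ^ n * Gamma (q + of_nat n + 1) * Gamma \<tau> * Gamma (\<tau> + \<delta> - \<mu>) *
           Gamma (\<tau> + \<delta> + \<delta>' + \<mu>' - \<epsilon>) /
         (Gamma (q + 1) * Gamma (\<tau> - \<mu>) * Gamma (\<tau> + \<delta> + \<delta>' - \<epsilon>) *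
           Gamma (\<tau> + \<delta> + \<mu>' - \<epsilon>)) *
         of_real x powr (\<delta> + \<delta>' - \<epsilon> + \<tau> - 1) *
         hypergeometric_F
           [1 + of_nat n - p, - of_nat n, \<tau>, - \<mu> + \<delta> + \<tau>, \<delta> + \<delta>' + \<mu>' - \<epsilon> + \<tau>]
           [q + 1, - \<mu> + \<tau>, \<delta> + \<delta>' - \<epsilon> + \<tau>, \<delta> + \<mu>' - \<epsilon> + \<tau>]
           (- of_real x)"
    unfolding sum_distrib_left[symmetric] by (subst hypergeometric_F_terminating[of n]) auto
  finally show ?thesis .
qed

end
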